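(* Fix an integer $n\ge1$. Assume $0\le s<d/2$, $\mu\in L^\infty\cap\mathcal P(\mathbb R^d)$, and $v:\mathbb R^d\to\mathbb R^d$ globally Lipschitz; if $s=0$, assume in addition $\int_{(\mathbb R^d)^2}|\log|x-y||\,d\mu^{\otimes2}(x,y)<\infty$. Then there exist a threshold $\beta_{\mathrm{loc}}=\beta_{\mathrm{loc}}(\mu,v,n)>0$ and, for every $\beta>0$, constants $\varepsilon_{\beta,n}>0$ and $C_{\mathrm{em}}(\beta,\mu,v,n)<\infty$, given explicitly below, such that, for every $\sigma\in\{\pm1\}$, $$\sup_{N\ge1}\mathbb E_{X_N\sim\mathbb Q_{N,\beta}(\mu)}\Big[e^{\sigma\varepsilon_{\beta,n}N\mathsf A_n(v,X_N,\mu)}\Big]\le C_{\mathrm{em}}(\beta,\mu,v,n).$$ Consequently, for every $f_N\in\mathcal P((\mathbb R^d)^N)$, $$\Big|\mathbb E_{X_N\sim f_N}\big[N\mathsf A_n(v,X_N,\mu)\big]\Big|\le C_{\beta,n,v}\,N\,\mathsf E_N(f_N,\mu)+C_{\beta,\mu,v,n},$$ where $$C_{\beta,n,v}=\frac{\beta}{\varepsilon_{\beta,n}},\qquad C_{\beta,\mu,v,n}=\frac1{\varepsilon_{\beta,n}}\Big(\log C_{\mathrm{pf}}(\beta,\mu)+\log C_{\mathrm{em}}(\beta,\mu,v,n)\Big).$$ Explicit constants: if $\|\nabla v\|_{L^\infty}=0$, one may take $C_{\mathrm{em}}=1$ and any $\varepsilon_{\beta,n}>0$. If $\|\nabla v\|_{L^\infty}>0$,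 one may take, for a constant $C_{\mathrm{sr},n}$ depending only on $d,s,n$ and a universal constant $L\ge 1$, $$\varepsilon_{\beta,n}=\begin{cases}\dfrac{\beta}{4C_{\mathrm{sr},n}\|\nabla v\|_{L^\infty}^n},&0<\beta\le\beta_{\mathrm{loc}},\\[2mm] \dfrac{\beta_{\mathrm{loc}}}{8C_{\mathrm{sr},n}\|\nabla v\|_{L^\infty}^n},&\beta>\beta_{\mathrm{loc}},\end{cases}$$ $$C_{\mathrm{em}}(\beta,\mu,v,n)=\begin{cases}e+L,&0<\beta\le\beta_{\mathrm{loc}},\ 0<s<d/2,\\ e^{-\beta I_\mu}(e+L),&0<\beta\le\beta_{\mathrm{loc}},\ s=0,\\ e^{-\beta I_\mu}(e+L)^{1/2}\,C_{\mathrm{ub}}(2\beta-\beta_{\mathrm{loc}},\mu)^{1/2},&\beta>\beta_{\mathrm{loc}}.\end{cases}$$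
   Context: Fix a dimension $d\ge1$. $\mathcal P(E)$ denotes the Borel probability measures on $E$; $\mu\in L^\infty\cap\mathcal P(\mathbb R^d)$ means $\mu$ has a bounded Lebesgue density. For $0\le s<d$ let $\mathsf g(x)=-\log|x|$ if $s=0$ and $\mathsf g(x)=\frac1s|x|^{-s}$ if $0<s<d$. Set $h_\mu(x)=\int\mathsf g(x-y)d\mu(y)$, $I_\mu=\frac12\iint\mathsf g(x-y)d\mu(x)d\mu(y)$, $\tilde{\mathsf g}(x,y)=\mathsf g(x-y)-h_\mu(x)-h_\mu(y)+2I_\mu$. For $X_N=(x_1,\dots,x_N)$: $$\mathsf F_N(X_N,\mu)=\frac1{2N^2}\sum_{i\ne j}\tilde{\mathsf g}(x_i,x_j)-\frac1{N^2}\sum_ih_\mu(x_i)+\frac1NI_\mu,\qquad \mathsf K_{N,\beta}(\mu)=\mathbb E_{\mu^{\otimes N}}[e^{-\beta N\mathsf F_N(X_N,\mu)}],$$ and the modulated Gibbs measure is $d\mathbb Q_{N,\beta}(\mu)(X_N)=\mathsf K_{N,\beta}(\mu)^{-1}e^{-\beta N\mathsf F_N(X_N,\mu)}\,d\mu^{\otimes N}(X_N)$. With $\mu_N=\frac1N\sum_i\delta_{x_i}$ and $\triangle$ the diagonal of $(\mathbb R^d)^2$, $$\mathsf A_n(v,X_N,\mu)=\int_{(\mathbb R^d)^2\setminus\triangle}\nabla^{\otimes n}\mathsf g(x-y):(v(x)-v(y))^{\otimes n}\,d(\mu_N-\mu)^{\otimes2}(x,y),$$ where $:$ is the full contraction of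 $n$-tensors. The modulated free energy is $\mathsf E_N(f_N,\mu)=\frac1{\beta N}\mathsf H(f_N|\mu^{\otimes N})+\mathbb E_{X_N\sim f_N}[\mathsf F_N(X_N,\mu)]$, with $\mathsf H(\cdot|\cdot)$ the (unnormalized) relative entropy. For each $\beta\ge0$, $C_{\mathrm{ub}}(\beta,\mu)$ denotes a fixed finite constant with $\sup_{N\ge1}\mathsf K_{N,\beta}(\mu)\le C_{\mathrm{ub}}(\beta,\mu)$ (such a constant exists under the stated hypotheses), and $C_{\mathrm{pf}}(\beta,\mu)=\max\{e,C_{\mathrm{ub}}(\beta,\mu)\}$. *)

theory Defs
  imports "HOL-Probability.Probability"
begin

text \<open>
  The space \<open>\<real>\<^sup>d\<close> is an arbitrary type of class \<open>euclidean_space\<close>, with \<open>d = DIM('a) \<ge> 1\<close>.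
  A configuration \<open>X\<^sub>N\<close> is a function \<open>nat \<Rightarrow> 'a\<close> of which only the values on \<open>{..<N}\<close> matter, and
  \<open>(\<real>\<^sup>d)\<^sup>N\<close> carries the product sigma-algebra \<open>\<Pi>\<^sub>M i\<in>{..<N}. borel\<close>.
\<close>

definition bounded_density_prob :: "'a::euclidean_space measure \<Rightarrow> bool" where
  "bounded_density_prob \<mu> \<longleftrightarrow> prob_space \<mu> \<and>
     (\<exists>\<rho>\<in>borel_measurable lborel. \<exists>B::real.
        (AE x in lborel. 0 \<le> \<rho> x \<and> \<rho> x \<le> B) \<and> \<mu> = density lborel (\<lambda>x. ennreal (\<rho> x)))"

text \<open>
  The function \<open>riesz s\<close> is the kernel \<open>g\<close>. The real-valued library functions give \<open>riesz s 0 = 0\<close>,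
  whereas the usual convention is \<open>g(0) = \<infinity>\<close>. Only configurations with two coinciding points are
  affected. They form a null set for \<open>\<mu>\<^sup>\<otimes>\<^sup>N\<close>, and a law \<open>f\<close> charging them has infinite relative
  entropy, hence infinite modulated free energy under either convention.
\<close>

definition riesz :: "real \<Rightarrow> 'a::euclidean_space \<Rightarrow> real" where
  "riesz s x = (if s = 0 then - ln (norm x) else norm x powr (- s) / s)"

definition pot :: "real \<Rightarrow> 'a::euclidean_space measure \<Rightarrow> 'a \<Rightarrow> real" where
  "pot s \<mu> x = (\<integral>y. riesz s (x - y) \<partial>\<mu>)"

definition self_energy :: "real \<Rightarrow> 'a::euclidean_space measure \<Rightarrow> real" where
  "self_energy s \<mu> = (1/2) * (\<integral>(x, y). riesz s (x - y) \<partial>(\<mu> \<Otimes>\<^sub>M \<mu>))"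

definition centered_riesz :: "real \<Rightarrow> 'a::euclidean_space measure \<Rightarrow> 'a \<Rightarrow> 'a \<Rightarrow> real" where
  "centered_riesz s \<mu> x y = riesz s (x - y) - pot s \<mu> x - pot s \<mu> y + 2 * self_energy s \<mu>"

definition mod_energy :: "real \<Rightarrow> nat \<Rightarrow> (nat \<Rightarrow> 'a::euclidean_space) \<Rightarrow> 'a measure \<Rightarrow> real" where
  "mod_energy s N X \<mu> =
     1 / (2 * (real N)\<^sup>2) * (\<Sum>i<N. \<Sum>j\<in>{..<N} - {i}. centered_riesz s \<mu> (X i) (X j))
     - 1 / (real N)\<^sup>2 * (\<Sum>i<N. pot s \<mu> (X i))
     + 1 / real N * self_energy s \<mu>"

abbreviation tensor_power :: "nat \<Rightarrow> 'a measure \<Rightarrow> (nat \<Rightarrow> 'a) measure" where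
  "tensor_power N \<mu> \<equiv> (\<Pi>\<^sub>M i\<in>{..<N}. \<mu>)"

definition mod_partition ::
  "real \<Rightarrow> nat \<Rightarrow> real \<Rightarrow> 'a::euclidean_space measure \<Rightarrow> ennreal" where
  "mod_partition s N \<beta> \<mu> =
     (\<integral>\<^sup>+ X. ennreal (exp (- \<beta> * real N * mod_energy s N X \<mu>)) \<partial>tensor_power N \<mu>)"

definition mod_gibbs ::
  "real \<Rightarrow> nat \<Rightarrow> real \<Rightarrow> 'a::euclidean_space measure \<Rightarrow> (nat \<Rightarrow> 'a) measure" where
  "mod_gibbs s N \<beta> \<mu> = density (tensor_power N \<mu>)
     (\<lambda>X. ennreal (exp (- \<beta> * real N * mod_energy s N X \<mu>)) / mod_partition s N \<beta> \<mu>)"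

text \<open>
  For a list \<open>[b\<^sub>1, \<dots>, b\<^sub>n]\<close> of basis vectors, \<open>iter_partial\<close> is the entry
  \<open>\<partial>\<^sub>b\<^sub>1 \<dots> \<partial>\<^sub>b\<^sub>n f\<close> of the tensor \<open>\<nabla>\<^sup>\<otimes>\<^sup>n f\<close>. For the kernel \<open>g\<close> it is used only away
  from the origin, where \<open>g\<close> is smooth.
\<close>

primrec iter_partial :: "'a list \<Rightarrow> ('a::euclidean_space \<Rightarrow> real) \<Rightarrow> 'a \<Rightarrow> real" where
  "iter_partial [] f = f"
| "iter_partial (b # bs) f = (\<lambda>z. frechet_derivative (iter_partial bs f) (at z) b)"

definition grad_contract ::
  "nat \<Rightarrow> ('a::euclidean_space \<Rightarrow> real) \<Rightarrow> 'a \<Rightarrow> 'a \<Rightarrow> real" where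
  "grad_contract n f z w =
     (\<Sum>bs\<in>{bs. length bs = n \<and> set bs \<subseteq> Basis}. iter_partial bs f z * (\<Prod>b\<leftarrow>bs. w \<bullet> b))"

definition empirical :: "nat \<Rightarrow> (nat \<Rightarrow> 'a::euclidean_space) \<Rightarrow> 'a measure" where
  "empirical N X = distr (uniform_count_measure {..<N}) borel X"

definition offdiag_integral ::
  "('a \<Rightarrow> 'a \<Rightarrow> real) \<Rightarrow> 'a::euclidean_space measure \<Rightarrow> 'a measure \<Rightarrow> real" where
  "offdiag_integral k \<mu> \<nu> = (LINT p:{p. fst p \<noteq> snd p}|(\<mu> \<Otimes>\<^sub>M \<nu>). k (fst p) (snd p))"

text \<open>
  The integral against the signed measure \<open>(\<mu>\<^sub>N - \<mu>)\<^sup>\<otimes>\<^sup>2\<close> is expanded bilinearly into four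
  integrals against products of probability measures.
\<close>

definition commutator ::
  "real \<Rightarrow> nat \<Rightarrow> nat \<Rightarrow> ('a::euclidean_space \<Rightarrow> 'a) \<Rightarrow> (nat \<Rightarrow> 'a) \<Rightarrow> 'a measure \<Rightarrow> real" where
  "commutator s n N v X \<mu> =
     (let k = (\<lambda>x y. grad_contract n (riesz s) (x - y) (v x - v y));
          \<mu>N = empirical N X
      in offdiag_integral k \<mu>N \<mu>N - offdiag_integral k \<mu>N \<mu>
         - offdiag_integral k \<mu> \<mu>N + offdiag_integral k \<mu> \<mu>)"

text \<open>
  The norm of \<open>\<nabla>v\<close> in \<open>L\<^sup>\<infinity>\<close>, with the operator norm on matrices. A Lipschitz \<open>v\<close> is differentiable
  almost everywhere, so the unspecified value of \<open>frechet_derivative\<close> elsewhere is irrelevant.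
\<close>

definition grad_sup :: "('a::euclidean_space \<Rightarrow> 'a) \<Rightarrow> real" where
  "grad_sup v = Inf {C. 0 \<le> C \<and> (AE x in lborel. onorm (frechet_derivative v (at x)) \<le> C)}"

text \<open>
  \<open>rel_entropy f m\<close> is \<open>H(f | m)\<close>. The arguments of \<open>KL_divergence\<close> are in the opposite order. For
  probability measures with \<open>f\<close> absolutely continuous, the negative part of the log-density is
  \<open>f\<close>-integrable, so a non-integrable log-density means \<open>H(f | m) = \<infinity>\<close>.
\<close>

definition rel_entropy :: "'b measure \<Rightarrow> 'b measure \<Rightarrow> ereal" where
  "rel_entropy f m =
     (if absolutely_continuous m f \<and> integrable f (entropy_density (exp 1) m f)
      then ereal (KL_divergence (exp 1) m f) else \<infinity>)"

text \<open>
  The extended expectation is the difference of the integrals of the positive and negative parts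
  (\<open>ennreal\<close> maps negative reals to \<open>0\<close>). The modulated energy is bounded below, so the difference
  \<open>\<infinity> - \<infinity>\<close> does not arise.
\<close>

definition ext_expectation :: "'b measure \<Rightarrow> ('b \<Rightarrow> real) \<Rightarrow> ereal" where
  "ext_expectation f F =
     enn2ereal (\<integral>\<^sup>+ x. ennreal (F x) \<partial>f) - enn2ereal (\<integral>\<^sup>+ x. ennreal (- F x) \<partial>f)"

definition mod_free_energy ::
  "real \<Rightarrow> real \<Rightarrow> nat \<Rightarrow> (nat \<Rightarrow> 'a::euclidean_space) measure \<Rightarrow> 'a measure \<Rightarrow> ereal" where
  "mod_free_energy s \<beta> N f \<mu> =
     ereal (1 / (\<beta> * real N)) * rel_entropy f (tensor_power N \<mu>)
     + ext_expectation f (\<lambda>X. mod_energy s N X \<mu>)"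

definition C_pf :: "(real \<Rightarrow> real) \<Rightarrow> real \<Rightarrow> real" where
  "C_pf C_ub \<beta> = max (exp 1) (C_ub \<beta>)"

definition eps_em :: "real \<Rightarrow> real \<Rightarrow> nat \<Rightarrow> ('a::euclidean_space \<Rightarrow> 'a) \<Rightarrow> real \<Rightarrow> real" where
  "eps_em C_sr \<beta>_loc n v \<beta> =
     (if \<beta> \<le> \<beta>_loc then \<beta> / (4 * C_sr * grad_sup v ^ n)
      else \<beta>_loc / (8 * C_sr * grad_sup v ^ n))"

definition C_em ::
  "real \<Rightarrow> real \<Rightarrow> real \<Rightarrow> (real \<Rightarrow> real) \<Rightarrow> 'a::euclidean_space measure \<Rightarrow> real \<Rightarrow> real" where
  "C_em s L \<beta>_loc C_ub \<mu> \<beta> =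
     (if \<beta> \<le> \<beta>_loc then
        (if s > 0 then exp 1 + L else exp (- \<beta> * self_energy s \<mu>) * (exp 1 + L))
      else exp (- \<beta> * self_energy s \<mu>) * sqrt (exp 1 + L) * sqrt (C_ub (2 * \<beta> - \<beta>_loc)))"

definition exp_moment_bound ::
  "real \<Rightarrow> nat \<Rightarrow> 'a::euclidean_space measure \<Rightarrow> ('a \<Rightarrow> 'a) \<Rightarrow> real \<Rightarrow> real \<Rightarrow> real \<Rightarrow> bool" where
  "exp_moment_bound s n \<mu> v \<beta> \<epsilon> C \<longleftrightarrow>
     (\<forall>\<sigma>\<in>{1, -1}.
        (SUP N\<in>{1..}. \<integral>\<^sup>+ X. ennreal (exp (\<sigma> * \<epsilon> * real N * commutator s n N v X \<mu>))
           \<partial>mod_gibbs s N \<beta> \<mu>) \<le> ennreal C)"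

text \<open>
  When the modulated free energy is infinite the inequality below is trivial. Otherwise the
  expectation on the left is claimed to exist, which has to be said explicitly since the library
  integral of a non-integrable function is \<open>0\<close>.
\<close>

definition commutator_bound ::
  "real \<Rightarrow> nat \<Rightarrow> 'a::euclidean_space measure \<Rightarrow> ('a \<Rightarrow> 'a) \<Rightarrow> real \<Rightarrow> real \<Rightarrow> real \<Rightarrow> bool" where
  "commutator_bound s n \<mu> v \<beta> C1 C2 \<longleftrightarrow>
     (\<forall>N\<ge>1. \<forall>f. prob_space f \<and> sets f = sets (\<Pi>\<^sub>M i\<in>{..<N}. (borel :: 'a measure)) \<longrightarrow>
        (mod_free_energy s \<beta> N f \<mu> \<noteq> \<infinity> \<longrightarrow> integrable f (\<lambda>X. commutator s n N v X \<mu>)) \<and>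
        ereal \<bar>\<integral>X. real N * commutator s n N v X \<mu> \<partial>f\<bar>
          \<le> ereal C1 * ereal (real N) * mod_free_energy s \<beta> N f \<mu> + ereal C2)"

end

theory Submission
  imports Defs
begin

text \<open>
  Both \<open>N F\<^sub>N\<close> and \<open>N A\<^sub>n\<close> are degenerate second-order statistics of the configuration. For a kernel bounded
  above with uniformly bounded second moments, the exponential moments of such a statistic at a small inverse
  temperature are bounded uniformly in \<open>N\<close>: integrating out the points one at a time only adds a multiple of
  the squared \<open>L\<^sup>2(\<mu>)\<close> norm of the field of the remaining points, with a coefficient that stays of order \<open>1/N\<close>.
  If \<open>s > 0\<close>, a small multiple of the kernel of \<open>N A\<^sub>n\<close> is absorbed by \<open>-g/2\<close>, and \<open>s < d/2\<close> gives the second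
  moments; if \<open>s = 0\<close>, that kernel is bounded. Hoelder's inequality handles all other \<open>\<beta>\<close>, Jensen's bounds the
  partition function below by \<open>exp (\<beta> I\<^sub>\<mu>)\<close>, and the Donsker-Varadhan inequality yields the bound on expectations.
  Rademacher's theorem is needed to replace the Lipschitz constant of \<open>v\<close> by \<open>\<parallel>\<nabla>v\<parallel>\<^sub>\<infinity>\<close>.
\<close>

section \<open>Differentiability of Lipschitz functions\<close>

text \<open>At small \<beta> everything reduces to one statistic: with \<epsilon> = \<beta> / (4
  C_sr G^n), where G is \<open>grad_sup v\<close>, the exponent -\<beta> N F_N + \<sigma> \<epsilon>
  N A_n is \<beta> times the statistic of the kernel -g/2 + \<sigma> k / (4 C_sr G^n). The repulsive
  singularity makes this kernel unbounded below, so the exponential may be expanded only by means of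
  a bound from above. For s = 0 the function -g = log |x - y| also grows at infinity; Cauchy-Schwarz
  then separates energy and commutator, and the energy factor is left to the partition function. The
  order of the quantifiers shapes the rest: C_sr is fixed before \<mu> and v, and the threshold
  before C_ub and L. The constant obtained by integrating out the points depends on \<mu> and v, so
  it is traded for a smaller threshold until the bound is e. Rademacher's theorem is proved with
  countably many closed sets on which the coordinate difference quotients are controlled; almost
  every point of such a set is not a porous point of it.\<close>

text \<open>The Stieltjes measures of \<open>F\<close> and \<open>G\<close> add up to Lebesgue
  measure, because their sum gives every open interval its length; each summand is therefore
  dominated by it. This turns a Lipschitz bound into absolute continuity.\<close>

lemma interval_measure_le_lborel:
  fixes F G :: "real \<Rightarrow> real"
  assumes F: "mono F" "continuous_on UNIV F" and G: "mono G" "continuous_on UNIV G"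
    and FG: "\<And>x. F x + G x = x" and A: "A \<in> sets borel"
  shows "emeasure (interval_measure F) A \<le> emeasure lborel A"
proof -
  let ?m = "\<lambda>A. emeasure (interval_measure F) A + emeasure (interval_measure G) A"
  define S where "S = measure_of UNIV (sets borel) ?m"
  have em: "emeasure S A = ?m A" if "A \<in> sets borel" for A
    unfolding S_def
  proof (rule emeasure_measure_of_sigma)
    show "sigma_algebra UNIV (sets (borel :: real measure))"
      using sets.sigma_algebra_axioms[of borel] by simp
    show "positive (sets borel) ?m" by (simp add: positive_def)
    show "countably_additive (sets borel) ?m"
    proof (rule countably_additiveI)
      fix B :: "nat \<Rightarrow> real set" assume B: "range B \<subseteq> sets borel" "disjoint_family B" 
      have "(\<Sum>i. ?m (B i)) = (\<Sum>i. emeasure (interval_measure F) (B i)) + (\<Sum>i. emeasure (interval_measure G) (B i))"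
        by (rule suminf_add[symmetric]) auto
      also have "\<dots> = ?m (\<Union>i. B i)"
        using B by (subst (1 2) suminf_emeasure) auto
      finally show "(\<Sum>i. ?m (B i)) = ?m (\<Union>i. B i)" .
    qed
  qed fact
  have mF: "\<And>x y. x \<le> y \<Longrightarrow> F x \<le> F y" and mG: "\<And>x y. x \<le> y \<Longrightarrow> G x \<le> G y"
    using F(1) G(1) by (auto simp: mono_def)
  have cF: "\<And>a. continuous (at_right a) F" and cG: "\<And>a. continuous (at_right a) G"
    using F(2) G(2) by (auto simp: continuous_on_eq_continuous_at intro: continuous_at_imp_continuous_at_within)
  have pt: "emeasure (interval_measure H) {a} = 0" if "\<And>x y. x \<le> y \<Longrightarrow> H x \<le> H y" "continuous_on UNIV H" for H :: "real \<Rightarrow> real" and a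
    using emeasure_interval_measure_Icc[of a a H] that by (auto intro: continuous_on_subset)
  have bx: "emeasure (interval_measure H) {l<..<u} = ennreal (H u - H l)" if "l \<le> u" "\<And>x y. x \<le> y \<Longrightarrow> H x \<le> H y" "continuous_on UNIV H" for H :: "real \<Rightarrow> real" and l u
  proof (cases "l = u")
    case False
    have "emeasure (interval_measure H) {l<..u} = ennreal (H u - H l)"
      using that by (intro emeasure_interval_measure_Ioc)
        (auto simp: continuous_on_eq_continuous_at intro: continuous_at_imp_continuous_at_within)
    moreover have "{l<..u} = {l<..<u} \<union> {u}" using that False by auto
    moreover have "emeasure (interval_measure H) ({l<..<u} \<union> {u}) = emeasure (interval_measure H) {l<..<u} + emeasure (interval_measure H) {u}"
      by (rule plus_emeasure[symmetric]) auto
    ultimately show ?thesis using pt[OF that(2,3)] by auto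
  qed auto
  have "lborel = S"
  proof (rule lborel_eqI)
    fix l u :: real assume "\<And>b. b \<in> Basis \<Longrightarrow> l \<bullet> b \<le> u \<bullet> b"
    then have lu: "l \<le> u" by simp
    have "?m {l<..<u} = ennreal (F u - F l) + ennreal (G u - G l)"
      using lu bx mF mG F(2) G(2) by simp
    also have "\<dots> = ennreal (u - l)"
      using mF[OF lu] mG[OF lu]
      by (subst ennreal_plus[symmetric], simp, simp) (rule arg_cong[where f=ennreal], use FG[of u] FG[of l] in linarith)
    finally show "emeasure S (box l u) = ennreal (\<Prod>b\<in>Basis. (u - l) \<bullet> b)"
      by (simp add: em box_real)
  qed (use sets.sigma_sets_eq[of "borel :: real measure"] in \<open>simp add: S_def\<close>)
  then have "emeasure lborel A = ?m A" using em A by simp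
  then show ?thesis by simp
qed

lemma has_real_derivative_two_sided:
  fixes f :: "real \<Rightarrow> real"
  assumes R: "\<And>e. e > 0 \<Longrightarrow> \<exists>d>0. \<forall>h. 0 < h \<and> h < d \<longrightarrow> \<bar>(f (x + h) - f x) / h - D\<bar> < e"
    and L: "\<And>e. e > 0 \<Longrightarrow> \<exists>d>0. \<forall>h. 0 < h \<and> h < d \<longrightarrow> \<bar>(f x - f (x - h)) / h - D\<bar> < e"
  shows "(f has_real_derivative D) (at x)"
  unfolding DERIV_def LIM_def
proof (intro allI impI)
  fix e :: real assume "e > 0"
  obtain d1 where d1: "d1 > 0" "\<And>h. 0 < h \<and> h < d1 \<Longrightarrow> \<bar>(f (x + h) - f x) / h - D\<bar> < e" using R[OF \<open>e>0\<close>] by auto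
  obtain d2 where d2: "d2 > 0" "\<And>h. 0 < h \<and> h < d2 \<Longrightarrow> \<bar>(f x - f (x - h)) / h - D\<bar> < e" using L[OF \<open>e>0\<close>] by auto
  show "\<exists>s>0. \<forall>h::real. h \<noteq> 0 \<and> dist h 0 < s \<longrightarrow> dist ((f (x + h) - f x) / h) D < e"
  proof (intro exI[of _ "min d1 d2"] conjI allI impI)
    fix h :: real assume h: "h \<noteq> 0 \<and> dist h 0 < min d1 d2"
    show "dist ((f (x + h) - f x) / h) D < e"
    proof (cases "h > 0")
      case True then show ?thesis using d1(2)[of h] h by (auto simp: dist_real_def)
    next
      case False
      moreover have "(f x - f (x - (- h))) / (- h) = (f (x + h) - f x) / h" using h by (simp add: field_simps)
      ultimately show ?thesis using d2(2)[of "-h"] h by (auto simp: dist_real_def)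
    qed
  qed (use d1 d2 in auto)
qed

text \<open>Both f + K x and K x - f are increasing and, after division by 2K, sum to the identity.
  The Stieltjes measure of the first then has a density \<open>h\<close> with respect to Lebesgue
  measure; undoing the affine change gives the candidate derivative \<open>g\<close>, and Lebesgue
  differentiation identifies it almost everywhere.\<close>

lemma lipschitz_real_ae_derivative:
  fixes f :: "real \<Rightarrow> real"
  assumes f: "L-lipschitz_on UNIV f"
  obtains g N where "negligible N"
    "\<And>x. x \<notin> N \<Longrightarrow> (f has_real_derivative g x) (at x)"
    "\<And>a b. a \<le> b \<Longrightarrow> (g has_integral (f b - f a)) {a..b}"
proof -
  \<comment> \<open>The summand 1 keeps \<open>K\<close> positive when \<open>L\<close> is
    0.\<close>
  define K where "K = L + 1"
  have L0: "L \<ge> 0" using f lipschitz_on_nonneg by blast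
  then have K: "K > 0" by (simp add: K_def)
  have lip: "\<bar>f x - f y\<bar> \<le> K * \<bar>x - y\<bar>" for x y
    using lipschitz_onD[OF f, of x y] L0 by (auto simp: K_def dist_real_def algebra_simps)
  have cf: "continuous_on UNIV f" using f lipschitz_on_continuous_on by blast
  define F where "F = (\<lambda>x. (f x + K * x) / (2 * K))"
  define G where "G = (\<lambda>x. (K * x - f x) / (2 * K))"
  have FG: "F x + G x = x" for x using K by (simp add: F_def G_def field_simps)
  have mF: "mono F"
  proof (rule monoI)
    fix x y :: real assume "x \<le> y"
    then show "F x \<le> F y" using lip[of x y] K unfolding F_def by (intro divide_right_mono) (auto simp: algebra_simps)
  qed
  have mG: "mono G"
  proof (rule monoI)
    fix x y :: real assume "x \<le> y"
    then show "G x \<le> G y" using lip[of x y] K unfolding G_def by (intro divide_right_mono) (auto simp: algebra_simps)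
  qed
  have cF: "continuous_on UNIV F" "continuous_on UNIV G" using K cf unfolding F_def G_def by (auto intro!: continuous_intros)
  let ?M = "interval_measure F"
  have ac: "absolutely_continuous lborel ?M"
    unfolding absolutely_continuous_def
  proof
    fix A :: "real set" assume "A \<in> null_sets lborel"
    then show "A \<in> null_sets ?M"
      using interval_measure_le_lborel[OF mF cF(1) mG cF(2) FG, of A] by (auto simp: null_sets_def)
  qed
  obtain h where h[measurable]: "h \<in> borel_measurable lborel" and hM: "density lborel h = ?M"
    using sigma_finite_measure.Radon_Nikodym[OF sigma_finite_lborel ac] by auto
  have hI: "(\<integral>\<^sup>+x. h x * indicator {a..b} x \<partial>lborel) = ennreal (F b - F a)" if "a \<le> b" for a b
  proof -
    have "emeasure ?M {a..b} = ennreal (F b - F a)"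
      using that mF cF by (intro emeasure_interval_measure_Icc) (auto simp: mono_def intro: continuous_on_subset)
    then show ?thesis by (simp flip: hM add: emeasure_density)
  qed
  have hfin: "AE x in lborel. h x \<noteq> \<infinity>"
  proof -
    have "AE x in lborel. \<forall>n::nat. h x * indicator {-real n..real n} x \<noteq> \<infinity>"
      unfolding AE_all_countable
      by (intro allI nn_integral_noteq_infinite) (auto simp: hI)
    then show ?thesis
    proof eventually_elim
      case (elim x)
      obtain n :: nat where "\<bar>x\<bar> \<le> real n" using real_arch_simple by blast
      then show ?case using elim[rule_format, of n] by (auto simp: indicator_def abs_le_iff minus_le_iff split: if_splits)
    qed
  qed
  \<comment> \<open>Inverts the definition of \<open>F\<close>: the derivative of f is 2K F' -
    K.\<close>
  define g where "g = (\<lambda>x. 2 * K * enn2real (h x) - K)"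
  have hasint: "((\<lambda>x. enn2real (h x)) has_integral (F b - F a)) {a..b}" if "a \<le> b" for a b
  proof -
    have "(\<integral>\<^sup>+x. ennreal (enn2real (h x) * indicator {a..b} x) \<partial>lborel) = ennreal (F b - F a)"
      unfolding hI[OF that, symmetric] using hfin
      by (intro nn_integral_cong_AE) (auto simp: indicator_def top.not_eq_extremum)
    moreover have "F a \<le> F b" using mF that by (auto simp: mono_def)
    ultimately have "((\<lambda>x. enn2real (h x) * indicator {a..b} x) has_integral (F b - F a)) UNIV"
      by (intro nn_integral_has_integral) auto
    moreover have "(\<lambda>x. enn2real (h x) * indicator {a..b} x) = (\<lambda>x. if x \<in> {a..b} then enn2real (h x) else 0)"
      by (auto simp: indicator_def)
    ultimately show ?thesis by (simp only: has_integral_restrict_UNIV)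
  qed
  have gint: "(g has_integral (f b - f a)) {a..b}" if "a \<le> b" for a b
  proof -
    have "(g has_integral (2 * K * (F b - F a) - K * (b - a))) {a..b}"
      unfolding g_def
      using has_integral_diff[OF has_integral_mult_right[OF hasint[OF that]] has_integral_const_real[of K a b], of "2*K"] that
      by (simp add: mult.commute)
    moreover have "2 * K * (F b - F a) - K * (b - a) = f b - f a"
      using K by (simp add: F_def field_simps)
    ultimately show ?thesis by simp
  qed
  have g1: "g integrable_on cbox a b" for a b
    using gint[of a b] by (cases "a \<le> b") (auto simp: cbox_interval)
  \<comment> \<open>The differentiation theorem used below concerns cells with lower corner
    \<open>x\<close>, that is, right-hand averages. The left-hand quotients at \<open>x\<close> are
    right-hand averages of the reflected function at \<open>-x\<close>.\<close>
  have g2int: "((\<lambda>x. g (- x)) has_integral (f (-a) - f (-b))) {a..b}" if "a \<le> b" for a b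
    using has_integral_reflect_lemma_real[OF gint[of "-b" "-a"]] that by simp
  have g2: "(\<lambda>x. g (- x)) integrable_on cbox a b" for a b
    using g2int[of a b] by (cases "a \<le> b") (auto simp: cbox_interval)
  obtain N1 where N1: "negligible N1" "\<And>x e. \<lbrakk>x \<notin> N1; 0 < e\<rbrakk> \<Longrightarrow>
       \<exists>d>0. \<forall>h. 0 < h \<and> h < d \<longrightarrow> norm (integral (cbox x (x + h *\<^sub>R One)) g /\<^sub>R h ^ DIM(real) - g x) < e"
    using integrable_ccontinuous_explicit[OF g1] by metis
  obtain N2 where N2: "negligible N2" "\<And>x e. \<lbrakk>x \<notin> N2; 0 < e\<rbrakk> \<Longrightarrow>
       \<exists>d>0. \<forall>h. 0 < h \<and> h < d \<longrightarrow> norm (integral (cbox x (x + h *\<^sub>R One)) (\<lambda>x. g (-x)) /\<^sub>R h ^ DIM(real) - g (- x)) < e"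
    using integrable_ccontinuous_explicit[OF g2] by metis
  show ?thesis
  proof
    have "negligible (uminus ` N2)"
      by (rule negligible_differentiable_image_negligible[OF _ N2(1)]) (auto intro!: differentiable_on_minus derivative_intros)
    then show "negligible (N1 \<union> uminus ` N2)" using N1 by simp
    show "(g has_integral (f b - f a)) {a..b}" if "a \<le> b" for a b by (rule gint[OF that])
    fix x assume x: "x \<notin> N1 \<union> uminus ` N2"
    then have x1: "x \<notin> N1" and x2: "-x \<notin> N2" by force+
    show "(f has_real_derivative g x) (at x)"
    proof (rule has_real_derivative_two_sided)
      fix e :: real assume e: "e > 0"
      obtain d where d: "d > 0" "\<And>h. 0 < h \<and> h < d \<Longrightarrow> norm (integral (cbox x (x + h *\<^sub>R One)) g /\<^sub>R h ^ DIM(real) - g x) < e"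
        using N1(2)[OF x1 e] by auto
      show "\<exists>d>0. \<forall>h. 0 < h \<and> h < d \<longrightarrow> \<bar>(f (x + h) - f x) / h - g x\<bar> < e"
      proof (intro exI[of _ d] conjI allI impI)
        fix h assume h: "0 < h \<and> h < d"
        have "integral {x..x+h} g = f (x + h) - f x" using gint[of x "x+h"] h by (simp add: integral_unique)
        then show "\<bar>(f (x + h) - f x) / h - g x\<bar> < e" using d(2)[OF h] by (simp add: divide_inverse mult.commute)
      qed fact
      obtain d where d: "d > 0" "\<And>h. 0 < h \<and> h < d \<Longrightarrow> norm (integral (cbox (-x) (-x + h *\<^sub>R One)) (\<lambda>x. g (-x)) /\<^sub>R h ^ DIM(real) - g (- (- x))) < e"
        using N2(2)[OF x2 e] by auto
      show "\<exists>d>0. \<forall>h. 0 < h \<and> h < d \<longrightarrow> \<bar>(f x - f (x - h)) / h - g x\<bar> < e"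
      proof (intro exI[of _ d] conjI allI impI)
        fix h assume h: "0 < h \<and> h < d"
        have "integral {-x..-x+h} (\<lambda>x. g (-x)) = f x - f (x - h)" using g2int[of "-x" "-x+h"] h by (simp add: integral_unique)
        then show "\<bar>(f x - f (x - h)) / h - g x\<bar> < e" using d(2)[OF h] by (simp add: divide_inverse mult.commute)
      qed fact
    qed
  qed
qed

section \<open>Porous points, and null sets seen along parallel lines\<close>

text \<open>Each porous point is the centre of small balls that contain a hole of comparable volume
  disjoint from \<open>S\<close>. Vitali's theorem selects disjoint ones that cover almost all
  porous points inside an open \<open>U\<close> with \<open>U - S\<close> small; the holes lie in
  \<open>U - S\<close>, so the selected balls are small in total as well. This plays the role of the
  Lebesgue density theorem.\<close>

lemma negligible_porous_points:
  fixes S :: "'a::euclidean_space set"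
  assumes S: "S \<in> sets borel" and c: "0 < c" "c \<le> 1"
  shows "negligible {x\<in>S. \<forall>r>0. \<exists>y. dist x y < r \<and> (\<forall>z\<in>S. c * dist x y < dist y z)}" (is "negligible ?P")
  unfolding negligible_outer_le
proof (intro allI impI)
  fix e :: real assume e: "e > 0"
  \<comment> \<open>Ratio of the volume of a ball of radius 2r to that of its hole of radius c
    r.\<close>
  let ?k = "(2 / c) ^ DIM('a)"
  have k: "?k > 0" using c by simp
  then have "e / ?k > 0" using e by simp
  then obtain U where U: "open U" "S \<subseteq> U" "emeasure lborel (U - S) < e / ?k"
    using outer_regular_lborel[OF S] by blast
  define K where "K = {(x, y). x \<in> ?P \<and> ball x (2 * dist x y) \<subseteq> U \<and> (\<forall>z\<in>S. c * dist x y < dist y z)}"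
  have "\<exists>i. i \<in> K \<and> x \<in> ball (fst i) (2 * dist (fst i) (snd i)) \<and> 2 * dist (fst i) (snd i) < d" if x: "x \<in> ?P" and d: "0 < d" for x d
  proof -
    have "x \<in> U" using x U by auto
    then obtain r where r: "r > 0" "ball x r \<subseteq> U" using U(1) open_contains_ball by blast
    have "\<forall>r>0. \<exists>y. dist x y < r \<and> (\<forall>z\<in>S. c * dist x y < dist y z)" using x by blast
    moreover have "min (r/2) (d/2) > 0" using r d by simp
    ultimately obtain y where y: "dist x y < min (r/2) (d/2)" "\<forall>z\<in>S. c * dist x y < dist y z" by blast
    \<comment> \<open>Taking \<open>z = x\<close> in the hole condition excludes
      \<open>y = x\<close>, so the radius of the covering ball is positive.\<close>
    have "x \<noteq> y" using y(2) x by auto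
    have "ball x (2 * dist x y) \<subseteq> U" using y(1) r(2) by (intro subset_trans[OF subset_ball r(2)]) simp
    then have "(x, y) \<in> K" using x y(2) unfolding K_def by blast
    then show ?thesis using y \<open>x \<noteq> y\<close> by (intro exI[of _ "(x,y)"]) auto
  qed
  then obtain C where C: "countable C" "C \<subseteq> K"
    "pairwise (\<lambda>i j. disjnt (ball (fst i) (2 * dist (fst i) (snd i))) (ball (fst j) (2 * dist (fst j) (snd j)))) C"
    "negligible (?P - (\<Union>i\<in>C. ball (fst i) (2 * dist (fst i) (snd i))))"
    by (rule Vitali_covering_theorem_balls[of ?P K fst "\<lambda>i. 2 * dist (fst i) (snd i)"]) auto
  let ?B = "\<lambda>i. ball (fst i) (2 * dist (fst i) (snd i)) :: 'a set"
  let ?H = "\<lambda>i. ball (snd i) (c * dist (fst i) (snd i)) :: 'a set"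
  have HB: "?H i \<subseteq> ?B i" for i
  proof
    fix z assume z: "z \<in> ?H i"
    have "dist (fst i) z \<le> dist (fst i) (snd i) + dist (snd i) z" by (rule dist_triangle)
    also have "dist (snd i) z < c * dist (fst i) (snd i)" using z by simp
    also have "\<dots> \<le> 1 * dist (fst i) (snd i)" by (intro mult_right_mono c) simp
    finally show "z \<in> ?B i" by simp
  qed
  have disjB: "disjoint_family_on ?B C"
    using C(3) by (auto simp: disjoint_family_on_def pairwise_def disjnt_def)
  have disjH: "disjoint_family_on ?H C"
    using disjB HB unfolding disjoint_family_on_def by blast
  have vol: "emeasure lborel (?B i) = ennreal ?k * emeasure lborel (?H i)" for i
    using c by (simp add: emeasure_ball ennreal_mult[symmetric] power_mult_distrib power_divide field_simps)
  have "emeasure lborel (\<Union>i\<in>C. ?B i) = (\<integral>\<^sup>+i. emeasure lborel (?B i) \<partial>count_space C)"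
    by (rule emeasure_UN_countable[OF _ C(1) disjB]) auto
  also have "\<dots> = ennreal ?k * (\<integral>\<^sup>+i. emeasure lborel (?H i) \<partial>count_space C)"
    unfolding vol by (rule nn_integral_cmult) auto
  also have "(\<integral>\<^sup>+i. emeasure lborel (?H i) \<partial>count_space C) = emeasure lborel (\<Union>i\<in>C. ?H i)"
    by (rule emeasure_UN_countable[OF _ C(1) disjH, symmetric]) auto
  also have "emeasure lborel (\<Union>i\<in>C. ?H i) \<le> emeasure lborel (U - S)"
  proof (rule emeasure_mono)
    show "(\<Union>i\<in>C. ?H i) \<subseteq> U - S"
    proof safe
      fix x y z assume i: "(x, y) \<in> C" and z: "z \<in> ?H (x, y)"
      have xy: "(x, y) \<in> K" using i C(2) by blast
      then have "ball x (2 * dist x y) \<subseteq> U" by (simp add: K_def)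
      then show "z \<in> U" using HB[of "(x,y)"] z unfolding fst_conv snd_conv by blast
      assume "z \<in> S" then show False using z xy by (auto simp: K_def)
    qed
  qed (use U S in auto)
  also have "ennreal ?k * emeasure lborel (U - S) \<le> ennreal ?k * ennreal (e / ?k)"
    using U(3) by (intro mult_left_mono) auto
  also have "\<dots> = ennreal e" using k e c by (subst ennreal_mult[symmetric]) auto
  finally have le: "emeasure lborel (\<Union>i\<in>C. ?B i) \<le> ennreal e" by (simp add: mult_left_mono)
  let ?T = "(\<Union>i\<in>C. ?B i) \<union> (?P - (\<Union>i\<in>C. ?B i))"
  have op: "(\<Union>i\<in>C. ?B i) \<in> sets borel" by (intro borel_open open_UN ballI open_ball)
  have m1: "(\<Union>i\<in>C. ?B i) \<in> lmeasurable"
    using le op by (auto intro!: fmeasurableI simp: le_less_trans[OF le])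
  have m2: "(?P - (\<Union>i\<in>C. ?B i)) \<in> lmeasurable" using C(4) by (rule negligible_imp_measurable)
  have "measure lebesgue ?T \<le> measure lebesgue (\<Union>i\<in>C. ?B i) + measure lebesgue (?P - (\<Union>i\<in>C. ?B i))"
    by (intro measure_Un_le fmeasurableD m1 m2)
  also have "\<dots> = measure lborel (\<Union>i\<in>C. ?B i)" using C(4) op by (simp add: negligible_imp_measure0)
  also have "\<dots> \<le> e" using le e by (simp add: measure_def enn2real_leI)
  finally show "\<exists>T. ?P \<subseteq> T \<and> T \<in> lmeasurable \<and> measure lebesgue T \<le> e"
    using m1 m2 by (intro exI[of _ ?T] conjI fmeasurable.Un) auto
qed

text \<open>Tonelli and translation invariance, for an arbitrary direction \<open>u\<close>:
  averaging the translates of \<open>B\<close> over [0,1] replaces a splitting of the space into a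
  line and a hyperplane. Read in both directions, the identity yields the next two lemmas.\<close>

lemma emeasure_eq_nn_integral_lines:
  fixes B :: "'a::euclidean_space set"
  assumes B[measurable]: "B \<in> sets borel"
  shows "(\<integral>\<^sup>+x. (\<integral>\<^sup>+t. indicator {0..1} t * indicator B (x + t *\<^sub>R u) \<partial>(lborel::real measure)) \<partial>lborel) = emeasure lborel B"
proof -
  have tr: "(\<integral>\<^sup>+x. indicator B (x + c) \<partial>lborel) = emeasure lborel B" for c
  proof -
    have "(\<integral>\<^sup>+x. indicator B (x + c) \<partial>lborel) = (\<integral>\<^sup>+x. indicator B x \<partial>distr lborel borel ((+) c))"
      by (subst nn_integral_distr) (auto simp: add.commute)
    then show ?thesis by (simp add: lborel_distr_plus)
  qed
  have "(\<integral>\<^sup>+x. (\<integral>\<^sup>+t. indicator {0..1} t * indicator B (x + t *\<^sub>R u) \<partial>(lborel::real measure)) \<partial>lborel)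
      = (\<integral>\<^sup>+t. (\<integral>\<^sup>+x. indicator {0..1} t * indicator B (x + t *\<^sub>R u) \<partial>lborel) \<partial>(lborel::real measure))"
    by (rule lborel_pair.Fubini') measurable
  also have "\<dots> = (\<integral>\<^sup>+t. indicator {0..1} t * emeasure lborel B \<partial>(lborel::real measure))"
    by (subst nn_integral_cmult) (auto simp: tr)
  also have "\<dots> = emeasure lborel B" by (subst nn_integral_multc) auto
  finally show ?thesis .
qed

lemma null_sets_of_null_lines:
  fixes B :: "'a::euclidean_space set"
  assumes B[measurable]: "B \<in> sets borel" and "\<And>x. AE t in lborel. x + t *\<^sub>R u \<notin> B"
  shows "B \<in> null_sets lborel"
proof -
  have "(\<integral>\<^sup>+t. indicator {0..1} t * indicator B (x + t *\<^sub>R u) \<partial>(lborel::real measure)) = 0" for x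
    using assms(2)[of x] by (subst nn_integral_0_iff_AE) (auto simp: indicator_def)
  then show ?thesis using emeasure_eq_nn_integral_lines[OF B, of u] by (simp add: null_sets_def)
qed

lemma AE_null_lines:
  fixes B :: "'a::euclidean_space set"
  assumes "B \<in> null_sets lborel"
  shows "AE x in lborel. AE t in lborel. t \<in> {0..1::real} \<longrightarrow> x + t *\<^sub>R u \<notin> B"
proof -
  have B[measurable]: "B \<in> sets borel" using assms by auto
  have "(\<integral>\<^sup>+x. (\<integral>\<^sup>+t. indicator {0..1} t * indicator B (x + t *\<^sub>R u) \<partial>(lborel::real measure)) \<partial>lborel) = 0"
    using emeasure_eq_nn_integral_lines[OF B, of u] assms by auto
  then have "AE x in lborel. (\<integral>\<^sup>+t. indicator {0..1} t * indicator B (x + t *\<^sub>R u) \<partial>(lborel::real measure)) = 0"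
    by (subst (asm) nn_integral_0_iff_AE) auto
  then show ?thesis
  proof eventually_elim
    case (elim x)
    then have "AE t in lborel. indicator {0..1::real} t * indicator B (x + t *\<^sub>R u) = (0::ennreal)"
      by (subst (asm) nn_integral_0_iff_AE) auto
    then show ?case by eventually_elim (auto simp: indicator_def split: if_splits)
  qed
qed

lemma negligible_imp_AE_notin:
  assumes "negligible N"
  shows "AE x in lborel. x \<notin> N"
proof -
  have "AE x in lebesgue. x \<notin> N" using assms unfolding negligible_iff_null_sets by (rule AE_not_in)
  then show ?thesis by (rule AE_completion_iff[THEN iffD1])
qed

text \<open>The vector \<open>a\<close> may change with \<open>e\<close>. Two such vectors
  approximate the same increments on a common ball, so they differ by at most the sum of the two
  tolerances; the sequence for the tolerances 1/(k+1) is Cauchy and its limit is the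
  gradient.\<close>

lemma differentiable_of_linear_approximations:
  fixes f :: "'a::euclidean_space \<Rightarrow> real"
  assumes "\<And>e. e > 0 \<Longrightarrow> \<exists>a. \<exists>r>0. \<forall>h. norm h < r \<longrightarrow> \<bar>f (x + h) - f x - a \<bullet> h\<bar> \<le> e * norm h"
  shows "f differentiable (at x)"
proof -
  have "\<forall>k::nat. \<exists>a. \<exists>r>0. \<forall>h. norm h < r \<longrightarrow> \<bar>f (x + h) - f x - a \<bullet> h\<bar> \<le> inverse (Suc k) * norm h"
    using assms by simp
  then obtain a r where r: "\<And>k::nat. r k > 0"
    and a: "\<And>k h. norm h < r k \<Longrightarrow> \<bar>f (x + h) - f x - a k \<bullet> h\<bar> \<le> inverse (Suc k) * norm h"
    by metis
  have dist: "norm (a k - a l) \<le> inverse (Suc k) + inverse (Suc l)" for k l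
  proof (cases "a k = a l")
    case False
    \<comment> \<open>Scales the test vector along \<open>a k - a l\<close> to half the smaller
      radius, so that both approximations apply to it.\<close>
    define c where "c = min (r k) (r l) / (2 * norm (a k - a l))"
    have c: "c > 0" using r False by (simp add: c_def)
    let ?h = "c *\<^sub>R (a k - a l)"
    have nh: "norm ?h = min (r k) (r l) / 2" using False less_imp_le[OF r[of k]] less_imp_le[OF r[of l]] by (simp add: c_def)
    then have h: "norm ?h < r k" "norm ?h < r l" using r[of k] r[of l] by linarith+
    have "norm (a k - a l) * norm ?h = (a k - a l) \<bullet> ?h"
      using c by (simp add: dot_square_norm power2_eq_square)
    also have "\<dots> = (f (x + ?h) - f x - a l \<bullet> ?h) - (f (x + ?h) - f x - a k \<bullet> ?h)" by (simp add: inner_diff_left right_diff_distrib)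
    also have "\<dots> \<le> (inverse (Suc k) + inverse (Suc l)) * norm ?h"
      using a[OF h(1)] a[OF h(2)] unfolding distrib_right by linarith
    finally show ?thesis using nh r[of k] r[of l] by (subst (asm) mult_le_cancel_right) auto
  qed auto
  have "Cauchy a"
  proof (rule metric_CauchyI)
    fix e :: real assume "e > 0"
    then obtain n where n: "inverse (real (Suc n)) < e / 2" using reals_Archimedean[of "e/2"] by auto
    have inv: "inverse (real (Suc m)) \<le> inverse (real (Suc n))" if "m \<ge> n" for m using that by (simp add: field_simps)
    show "\<exists>M. \<forall>m\<ge>M. \<forall>n\<ge>M. dist (a m) (a n) < e"
    proof (intro exI[of _ n] allI impI)
      fix k l assume "k \<ge> n" "l \<ge> n"
      then show "dist (a k) (a l) < e" unfolding dist_norm using dist[of k l] inv[of k] inv[of l] n by linarith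
    qed
  qed
  then obtain A where A: "a \<longlonglongrightarrow> A" using Cauchy_convergent_iff convergent_def by blast
  have aA: "norm (a k - A) \<le> inverse (Suc k)" for k
  proof (rule LIMSEQ_le)
    show "(\<lambda>l. norm (a k - a l)) \<longlonglongrightarrow> norm (a k - A)" by (intro tendsto_intros A)
    show "(\<lambda>l. inverse (real (Suc k)) + inverse (Suc l)) \<longlonglongrightarrow> inverse (Suc k)"
      using tendsto_add[OF tendsto_const LIMSEQ_inverse_real_of_nat] by simp
  qed (use dist in auto)
  have "(f has_derivative (\<lambda>h. A \<bullet> h)) (at x)"
    unfolding has_derivative_at_alt
  proof (intro conjI allI impI)
    show "bounded_linear (\<lambda>h. A \<bullet> h)" by (rule bounded_linear_inner_right)
    fix e :: real assume "e > 0"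
    then obtain n where n: "inverse (real (Suc n)) < e / 2" using reals_Archimedean[of "e/2"] by auto
    show "\<exists>d>0. \<forall>y. norm (y - x) < d \<longrightarrow> norm (f y - f x - A \<bullet> (y - x)) \<le> e * norm (y - x)"
    proof (intro exI[of _ "r n"] conjI allI impI r)
      fix y assume y: "norm (y - x) < r n"
      have "\<bar>(a n - A) \<bullet> (y - x)\<bar> \<le> inverse (Suc n) * norm (y - x)"
        using Cauchy_Schwarz_ineq2[of "a n - A" "y - x"] mult_right_mono[OF aA[of n], of "norm (y - x)"] by simp
      moreover have "\<bar>f y - f x - a n \<bullet> (y - x)\<bar> \<le> inverse (Suc n) * norm (y - x)" using a[OF y] by simp
      ultimately have "norm (f y - f x - A \<bullet> (y - x)) \<le> 2 * inverse (Suc n) * norm (y - x)"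
        by (simp add: inner_diff_left)
      also have "\<dots> \<le> e * norm (y - x)" using n by (intro mult_right_mono) auto
      finally show "norm (f y - f x - A \<bullet> (y - x)) \<le> e * norm (y - x)" .
    qed
  qed
  then show ?thesis by (rule differentiableI)
qed

section \<open>Rademacher's theorem\<close>

text \<open>Tolerance 1/(k+1), range 1/(j+1) and slope \<open>q\<close> are separate parameters so
  that, with rational \<open>q\<close>, countably many sets suffice, each of them closed when
  \<open>f\<close> is continuous. Closed sets are Borel, as the porosity argument requires.\<close>

definition dir_approx :: "('a::real_normed_vector \<Rightarrow> real) \<Rightarrow> 'a \<Rightarrow> nat \<Rightarrow> nat \<Rightarrow> real \<Rightarrow> 'a set" where
  "dir_approx f u k j q = {x. \<forall>t. \<bar>t\<bar> \<le> inverse (Suc j) \<longrightarrow> \<bar>f (x + t *\<^sub>R u) - f x - q * t\<bar> \<le> \<bar>t\<bar> * inverse (Suc k)}"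

lemma closed_dir_approx:
  assumes "continuous_on UNIV f"
  shows "closed (dir_approx f u k j q)"
proof -
  have c: "continuous_on UNIV (\<lambda>x. f (x + c))" for c
    by (rule continuous_on_compose2[OF assms]) (auto intro!: continuous_intros)
  have "dir_approx f u k j q = (\<Inter>t\<in>{t. \<bar>t\<bar> \<le> inverse (Suc j)}. {x. \<bar>f (x + t *\<^sub>R u) - f x - q * t\<bar> \<le> \<bar>t\<bar> * inverse (Suc k)})"
    by (auto simp: dir_approx_def)
  moreover have "closed {x. \<bar>f (x + t *\<^sub>R u) - f x - q * t\<bar> \<le> \<bar>t\<bar> * inverse (Suc k)}" for t
    by (intro closed_Collect_le continuous_intros c assms)
  ultimately show ?thesis by auto
qed

lemma dir_approx_mono: "j \<le> j' \<Longrightarrow> dir_approx f u k j q \<subseteq> dir_approx f u k j' q"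
  unfolding dir_approx_def
proof clarify
  fix x t assume j: "j \<le> j'" and H: "\<forall>t. \<bar>t\<bar> \<le> inverse (Suc j) \<longrightarrow> \<bar>f (x + t *\<^sub>R u) - f x - q * t\<bar> \<le> \<bar>t\<bar> * inverse (Suc k)"
    and t: "\<bar>t\<bar> \<le> inverse (real (Suc j'))"
  have le: "inverse (real (Suc j')) \<le> inverse (real (Suc j))" using j by (simp add: field_simps)
  show "\<bar>f (x + t *\<^sub>R u) - f x - q * t\<bar> \<le> \<bar>t\<bar> * inverse (Suc k)" by (rule H[rule_format, OF order_trans[OF t le]])
qed

text \<open>The set of good points is Borel, and on every line parallel to \<open>u\<close> the
  parameters of bad points form a null set by the one-dimensional theorem. The criterion for null
  sets along lines then applies.\<close>

lemma AE_dir_approx: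
  fixes f :: "'a::euclidean_space \<Rightarrow> real"
  assumes f: "L-lipschitz_on UNIV f"
  shows "AE x in lborel. \<forall>k. \<exists>j. \<exists>q\<in>\<rat>. x \<in> dir_approx f u k j q"
proof -
  let ?G = "\<Inter>k. \<Union>j. \<Union>q\<in>\<rat>. dir_approx f u k j q"
  have cf: "continuous_on UNIV f" using f lipschitz_on_continuous_on by blast
  have L: "L \<ge> 0" using f lipschitz_on_nonneg by blast
  have "(\<Union>q\<in>\<rat>. dir_approx f u k j q) \<in> sets borel" for k j
    using closed_dir_approx[OF cf] by (intro sets.countable_UN' countable_rat) auto
  then have "(\<Union>j. \<Union>q\<in>\<rat>. dir_approx f u k j q) \<in> sets borel" for k
    by (intro sets.countable_UN) auto
  then have Gb: "?G \<in> sets borel"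
    by (intro sets.countable_INT) auto
  have "- ?G \<in> null_sets lborel"
  proof (rule null_sets_of_null_lines)
    show "- ?G \<in> sets borel" using Gb by (metis borel_comp)
    fix x
    have lip: "(L * norm u)-lipschitz_on UNIV (\<lambda>t. f (x + t *\<^sub>R u))"
    proof (rule lipschitz_onI)
      fix s t :: real
      have "dist (f (x + s *\<^sub>R u)) (f (x + t *\<^sub>R u)) \<le> L * dist (x + s *\<^sub>R u) (x + t *\<^sub>R u)" using f by (rule lipschitz_onD) auto
      also have "dist (x + s *\<^sub>R u) (x + t *\<^sub>R u) = norm u * dist s t"
        by (simp add: dist_norm flip: scaleR_left_diff_distrib)
      finally show "dist (f (x + s *\<^sub>R u)) (f (x + t *\<^sub>R u)) \<le> L * norm u * dist s t" by (simp add: mult.assoc)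
    qed (use L in simp)
    obtain g N where N: "negligible N" and g: "\<And>t. t \<notin> N \<Longrightarrow> ((\<lambda>t. f (x + t *\<^sub>R u)) has_real_derivative g t) (at t)"
      and "\<And>a b. a \<le> b \<Longrightarrow> (g has_integral (f (x + b *\<^sub>R u) - f (x + a *\<^sub>R u))) {a..b}"
      by (rule lipschitz_real_ae_derivative[OF lip], rule that, assumption+)
    have "AE t in lborel. t \<notin> N"
      using N by (rule negligible_imp_AE_notin)
    then show "AE t in lborel. x + t *\<^sub>R u \<notin> - ?G"
    proof eventually_elim
      case (elim t)
      have "\<exists>j. \<exists>q\<in>\<rat>. x + t *\<^sub>R u \<in> dir_approx f u k j q" for k
      proof -
        \<comment> \<open>Half of the tolerance is spent on replacing the derivative by a rational
          slope, the other half on the difference quotient.\<close>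
        let ?e = "inverse (Suc k) / 2 :: real"
        obtain q where q: "q \<in> \<rat>" "g t - ?e < q" "q < g t + ?e" using Rats_dense_in_real[of "g t - ?e" "g t + ?e"] by auto
        obtain d where d: "d > 0" "\<And>h. h \<noteq> 0 \<and> dist h 0 < d \<Longrightarrow> dist ((f (x + (t + h) *\<^sub>R u) - f (x + t *\<^sub>R u)) / h) (g t) < ?e"
          using g[OF elim, unfolded DERIV_def LIM_def, rule_format, of ?e] by auto
        obtain j where j: "inverse (real (Suc j)) < d" using reals_Archimedean[OF d(1)] by auto
        have "x + t *\<^sub>R u \<in> dir_approx f u k j q"
          unfolding dir_approx_def mem_Collect_eq
        proof (intro allI impI)
          fix h :: real assume h: "\<bar>h\<bar> \<le> inverse (Suc j)"
          show "\<bar>f (x + t *\<^sub>R u + h *\<^sub>R u) - f (x + t *\<^sub>R u) - q * h\<bar> \<le> \<bar>h\<bar> * inverse (Suc k)"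
          proof (cases "h = 0")
            case False
            let ?D = "f (x + t *\<^sub>R u + h *\<^sub>R u) - f (x + t *\<^sub>R u)"
            have "\<bar>?D / h - g t\<bar> < ?e"
              using d(2)[of h] False h j by (simp add: dist_real_def scaleR_add_left add.assoc)
            then have "\<bar>?D / h - q\<bar> \<le> inverse (Suc k)" using q by linarith
            then have "\<bar>h\<bar> * \<bar>?D / h - q\<bar> \<le> \<bar>h\<bar> * inverse (Suc k)" by (intro mult_left_mono) auto
            moreover have "\<bar>h\<bar> * \<bar>?D / h - q\<bar> = \<bar>?D - q * h\<bar>" using False by (simp add: field_simps flip: abs_mult)
            ultimately show ?thesis by simp
          qed simp
        qed
        then show ?thesis using q(1) by blast
      qed
      then show ?case by auto
    qed
  qed
  then have "AE x in lborel. x \<notin> - ?G" by (rule AE_not_in)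
  then show ?thesis by eventually_elim auto
qed

text \<open>
  Walking from \<open>x\<close> to \<open>x + h\<close> along the coordinate axes, each intermediate point is replaced by a nearby
  point of \<open>E\<close>, where the difference quotients are already controlled with the same slopes.
\<close>

lemma coordinatewise_increment:
  fixes f :: "'a::euclidean_space \<Rightarrow> real"
  assumes f: "L-lipschitz_on UNIV f" and x: "x \<in> E"
    and E: "\<And>b. b \<in> Basis \<Longrightarrow> E \<subseteq> dir_approx f b k j (q b)"
    and por: "\<And>y. dist x y < r \<Longrightarrow> \<exists>z\<in>E. dist y z \<le> e * dist x y"
    and e: "e \<ge> 0" and h: "norm h < r" "norm h \<le> inverse (Suc j)"
  shows "\<bar>f (x + h) - f x - (\<Sum>b\<in>Basis. q b *\<^sub>R b) \<bullet> h\<bar> \<le> DIM('a) * (2 * L * e + inverse (Suc k)) * norm h"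
proof -
  have L: "L \<ge> 0" using f lipschitz_on_nonneg by blast
  have lip: "\<bar>f y - f z\<bar> \<le> L * dist y z" for y z using lipschitz_onD[OF f, of y z] by (simp add: dist_real_def)
  have walk: "\<bar>f (x + (\<Sum>b\<in>S. (h \<bullet> b) *\<^sub>R b)) - f x - (\<Sum>b\<in>S. q b * (h \<bullet> b))\<bar> \<le> card S * (2 * L * e + inverse (Suc k)) * norm h"
    if "finite S" "S \<subseteq> Basis" for S
    using that
  proof (induction S rule: finite_induct)
    case (insert b S)
    define p where "p = x + (\<Sum>b\<in>S. (h \<bullet> b) *\<^sub>R b)"
    let ?t = "h \<bullet> b"
    have b: "b \<in> Basis" using insert by simp
    have t: "\<bar>?t\<bar> \<le> norm h" using Basis_le_norm[OF b] .
    have "dist x p = norm (\<Sum>b\<in>S. (h \<bullet> b) *\<^sub>R b)" by (simp add: p_def dist_norm)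
    also have "\<dots> \<le> norm h"
    proof (rule norm_le_componentwise)
      fix c :: 'a assume c: "c \<in> Basis"
      have "(\<Sum>b\<in>S. (h \<bullet> b) *\<^sub>R b) \<bullet> c = (\<Sum>b\<in>S. if b = c then h \<bullet> c else 0)"
        unfolding inner_sum_left using insert.prems c by (intro sum.cong) (auto simp: inner_Basis)
      then show "\<bar>(\<Sum>b\<in>S. (h \<bullet> b) *\<^sub>R b) \<bullet> c\<bar> \<le> \<bar>h \<bullet> c\<bar>" using insert.hyps by simp
    qed
    finally have xp: "dist x p \<le> norm h" .
    then obtain z where z: "z \<in> E" "dist p z \<le> e * dist x p" using por[of p] h by auto
    have pz: "dist p z \<le> e * norm h" using z(2) mult_left_mono[OF xp e] by linarith
    have Lpz: "L * dist p z \<le> L * e * norm h" using mult_left_mono[OF pz L] by (simp add: mult.assoc)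
    have "z \<in> dir_approx f b k j (q b)" using E[OF b] z by auto
    then have 1: "\<bar>f (z + ?t *\<^sub>R b) - f z - q b * ?t\<bar> \<le> \<bar>?t\<bar> * inverse (Suc k)"
      using t h unfolding dir_approx_def mem_Collect_eq by (meson order_trans)
    have 2: "\<bar>f p - f z\<bar> \<le> L * e * norm h" using lip[of p z] Lpz by linarith
    have 3: "\<bar>f (p + ?t *\<^sub>R b) - f (z + ?t *\<^sub>R b)\<bar> \<le> L * e * norm h" using lip[of "p + ?t *\<^sub>R b" "z + ?t *\<^sub>R b"] Lpz by simp
    have 4: "\<bar>?t\<bar> * inverse (Suc k) \<le> norm h * inverse (Suc k)" using t by (intro mult_right_mono) auto
    have 5: "\<bar>f p - f x - (\<Sum>b\<in>S. q b * (h \<bullet> b))\<bar> \<le> card S * (2 * L * e + inverse (Suc k)) * norm h"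
      using insert by (simp add: p_def)
    have eq: "x + (\<Sum>b\<in>insert b S. (h \<bullet> b) *\<^sub>R b) = p + ?t *\<^sub>R b" "(\<Sum>b\<in>insert b S. q b * (h \<bullet> b)) = (\<Sum>b\<in>S. q b * (h \<bullet> b)) + q b * ?t"
      using insert.hyps by (simp_all add: p_def add_ac)
    \<comment> \<open>One axis costs twice L e |h|, for the detour to \<open>z\<close> at both ends
      of the step, and |h|/(k+1) for the slope.\<close>
    have "card (insert b S) * (2 * L * e + inverse (Suc k)) * norm h = card S * (2 * L * e + inverse (Suc k)) * norm h + 2 * (L * e * norm h) + norm h * inverse (Suc k)"
      using insert.hyps by (simp add: algebra_simps)
    then show ?case unfolding eq using 1 2 3 4 5 by linarith
  qed simp
  have "(\<Sum>b\<in>Basis. q b *\<^sub>R b) \<bullet> h = (\<Sum>b\<in>Basis. q b * (h \<bullet> b))"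
    by (simp add: inner_sum_left inner_commute[of h])
  then show ?thesis
    using walk[OF finite_Basis order_refl] unfolding euclidean_representation by simp
qed

text \<open>Almost every \<open>x\<close> lies, for each tolerance, in some set
  \<open>E k j q\<close>, and is not a porous point of any such set containing it, there being only
  countably many. Near \<open>x\<close> such a set is then dense up to a relative error 1/(k+1),
  which is what the walk along the axes asks for.\<close>

lemma rademacher_real:
  fixes f :: "'a::euclidean_space \<Rightarrow> real"
  assumes f: "L-lipschitz_on UNIV f"
  shows "AE x in lborel. f differentiable (at x)"
proof -
  have cf: "continuous_on UNIV f" using f lipschitz_on_continuous_on by blast
  have L: "L \<ge> 0" using f lipschitz_on_nonneg by blast
  define E where "E k j q = (\<Inter>b\<in>Basis. dir_approx f b k j (q b))" for k j and q :: "'a \<Rightarrow> real"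
  let ?Q = "Basis \<rightarrow>\<^sub>E \<rat> :: ('a \<Rightarrow> real) set"
  have cQ: "countable ?Q" by (intro countable_PiE) (auto simp: countable_rat)
  have 1: "AE x in lborel. \<forall>b\<in>Basis. \<forall>k. \<exists>j. \<exists>q\<in>\<rat>. x \<in> dir_approx f b k j q"
    by (intro AE_finite_allI AE_dir_approx[OF f]) auto
  have 2: "AE x in lborel. \<forall>k. \<forall>j. \<forall>q\<in>?Q. x \<in> E k j q \<longrightarrow>
      (\<exists>r>0. \<forall>y. dist x y < r \<longrightarrow> (\<exists>z\<in>E k j q. dist y z \<le> inverse (Suc k) * dist x y))"
    unfolding AE_all_countable AE_ball_countable[OF cQ]
  proof (intro allI ballI)
    fix k j q assume "q \<in> ?Q"
    have "E k j q \<in> sets borel" unfolding E_def by (intro borel_closed closed_INT ballI closed_dir_approx cf)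
    moreover have "0 < inverse (real (Suc k))" "inverse (real (Suc k)) \<le> 1" by (auto simp: field_simps)
    ultimately have "negligible {x\<in>E k j q. \<forall>r>0. \<exists>y. dist x y < r \<and> (\<forall>z\<in>E k j q. inverse (Suc k) * dist x y < dist y z)}"
      by (rule negligible_porous_points)
    then have "AE x in lborel. x \<notin> {x\<in>E k j q. \<forall>r>0. \<exists>y. dist x y < r \<and> (\<forall>z\<in>E k j q. inverse (Suc k) * dist x y < dist y z)}"
      by (rule negligible_imp_AE_notin)
    then show "AE x in lborel. x \<in> E k j q \<longrightarrow>
      (\<exists>r>0. \<forall>y. dist x y < r \<longrightarrow> (\<exists>z\<in>E k j q. dist y z \<le> inverse (Suc k) * dist x y))"
      by eventually_elim (simp only: mem_Collect_eq not_less[symmetric], blast)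
  qed
  from 1 2 show ?thesis
  proof eventually_elim
    case (elim x)
    show ?case
    proof (rule differentiable_of_linear_approximations)
      fix e :: real assume e: "e > 0"
      let ?c = "DIM('a) * (2 * L + 1) :: real"
      have c: "?c > 0" using L by simp
      then obtain k where k: "inverse (real (Suc k)) < e / ?c" using reals_Archimedean[of "e / ?c"] e by auto
      have "\<forall>b\<in>Basis. \<exists>j q. q \<in> \<rat> \<and> x \<in> dir_approx f b k j q" using elim(1) by blast
      then obtain J q where Jq: "\<And>b. b \<in> Basis \<Longrightarrow> q b \<in> \<rat> \<and> x \<in> dir_approx f b k (J b) (q b)" by metis
      define j where "j = Max (J ` Basis)"
      define q' where "q' = restrict q Basis"
      have xE: "x \<in> E k j q'"
        unfolding E_def
      proof
        fix b :: 'a assume b: "b \<in> Basis"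
        then have "J b \<le> j" by (simp add: j_def)
        then show "x \<in> dir_approx f b k j (q' b)" using Jq[OF b] b dir_approx_mono[of "J b" j f b k "q b"] by (auto simp: q'_def)
      qed
      moreover have "q' \<in> ?Q" using Jq by (auto simp: q'_def)
      ultimately obtain r where r: "r > 0" "\<And>y. dist x y < r \<Longrightarrow> \<exists>z\<in>E k j q'. dist y z \<le> inverse (Suc k) * dist x y"
        using elim(2) by blast
      show "\<exists>a. \<exists>r>0. \<forall>h. norm h < r \<longrightarrow> \<bar>f (x + h) - f x - a \<bullet> h\<bar> \<le> e * norm h"
      proof (intro exI[of _ "\<Sum>b\<in>Basis. q' b *\<^sub>R b"] exI[of _ "min r (inverse (Suc j))"] conjI allI impI)
        fix h :: 'a assume h: "norm h < min r (inverse (real (Suc j)))"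
        have "\<bar>f (x + h) - f x - (\<Sum>b\<in>Basis. q' b *\<^sub>R b) \<bullet> h\<bar> \<le> DIM('a) * (2 * L * inverse (Suc k) + inverse (Suc k)) * norm h"
          by (rule coordinatewise_increment[OF f xE _ r(2)]) (use h in \<open>auto simp: E_def\<close>)
        also have "\<dots> = inverse (Suc k) * ?c * norm h" by (simp add: algebra_simps)
        also have "\<dots> \<le> e * norm h" using k c by (intro mult_right_mono) (simp_all add: pos_less_divide_eq)
        finally show "\<bar>f (x + h) - f x - (\<Sum>b\<in>Basis. q' b *\<^sub>R b) \<bullet> h\<bar> \<le> e * norm h" .
      qed (use r in auto)
    qed
  qed
qed

theorem rademacher:
  fixes v :: "'a::euclidean_space \<Rightarrow> 'b::euclidean_space"
  assumes v: "L-lipschitz_on UNIV v"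
  shows "AE x in lborel. v differentiable (at x)"
proof -
  have "AE x in lborel. \<forall>b\<in>Basis. (\<lambda>x. v x \<bullet> b) differentiable (at x)"
  proof (intro AE_finite_allI)
    fix b :: 'b assume b: "b \<in> Basis"
    have "L-lipschitz_on UNIV (\<lambda>x. v x \<bullet> b)"
    proof (rule lipschitz_onI)
      fix x y
      have "dist (v x \<bullet> b) (v y \<bullet> b) \<le> dist (v x) (v y)"
        using Basis_le_norm[OF b, of "v x - v y"] by (simp add: dist_norm inner_diff_left)
      also have "\<dots> \<le> L * dist x y" using v by (rule lipschitz_onD) auto
      finally show "dist (v x \<bullet> b) (v y \<bullet> b) \<le> L * dist x y" .
    qed (use v lipschitz_on_nonneg in blast)
    then show "AE x in lborel. (\<lambda>x. v x \<bullet> b) differentiable (at x)" by (rule rademacher_real)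
  qed simp
  then show ?thesis by eventually_elim (subst differentiable_componentwise_within, simp)
qed

section \<open>The gradient bound as a Lipschitz constant\<close>

text \<open>Almost every segment in direction \<open>h\<close> meets the exceptional null set in a
  null set of parameters, so for almost every \<open>x\<close> the increment is the integral of a
  derivative bounded by means of \<open>C\<close>. By continuity the \<open>x\<close> where the
  inequality fails form an open set; being null, it is empty. Testing against a fixed
  \<open>w\<close> reduces the claim to real functions, and \<open>w = v (x + h) - v x\<close>
  concludes.\<close>

lemma lipschitz_of_AE_derivative_bound:
  fixes v :: "'a::euclidean_space \<Rightarrow> 'b::euclidean_space"
  assumes v: "L-lipschitz_on UNIV v" 
    and C: "AE x in lborel. onorm (frechet_derivative v (at x)) \<le> C"
  shows "norm (v (x + h) - v x) \<le> C * norm h"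
proof -
  have L: "L \<ge> 0" using v lipschitz_on_nonneg by blast
  have cv: "continuous_on UNIV v" using v lipschitz_on_continuous_on by blast
  have "AE x in lborel. v differentiable (at x) \<and> onorm (frechet_derivative v (at x)) \<le> C"
    using rademacher[OF v] C by eventually_elim simp
  then obtain B where B: "B \<in> null_sets lborel" "{x. \<not> (v differentiable (at x) \<and> onorm (frechet_derivative v (at x)) \<le> C)} \<subseteq> B"
    unfolding eventually_ae_filter space_lborel by auto
  let ?c = "\<lambda>w. C * norm h * norm w"
  have key: "(v (x + h) - v x) \<bullet> w \<le> ?c w" for x w
  proof -
    have "AE x in lborel. (v (x + h) - v x) \<bullet> w \<le> ?c w"
      using AE_null_lines[OF B(1), of h]
    proof eventually_elim
      case (elim x)
      define p where "p = (\<lambda>t. v (x + t *\<^sub>R h) \<bullet> w)"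
      have lip: "(L * norm h * norm w)-lipschitz_on UNIV p"
      proof (rule lipschitz_onI)
        fix s t :: real
        have "norm (v (x + s *\<^sub>R h) - v (x + t *\<^sub>R h)) \<le> L * dist (x + s *\<^sub>R h) (x + t *\<^sub>R h)" 
          using lipschitz_onD[OF v, of "x + s *\<^sub>R h" "x + t *\<^sub>R h"] by (simp add: dist_norm)
        also have "dist (x + s *\<^sub>R h) (x + t *\<^sub>R h) = norm h * dist s t"
          by (simp add: dist_norm flip: scaleR_left_diff_distrib)
        finally have "norm (v (x + s *\<^sub>R h) - v (x + t *\<^sub>R h)) * norm w \<le> L * (norm h * dist s t) * norm w"
          by (rule mult_right_mono) simp
        moreover have "dist (p s) (p t) \<le> norm (v (x + s *\<^sub>R h) - v (x + t *\<^sub>R h)) * norm w"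
          unfolding p_def dist_real_def inner_diff_left[symmetric] by (rule Cauchy_Schwarz_ineq2)
        ultimately show "dist (p s) (p t) \<le> L * norm h * norm w * dist s t" by (simp add: mult_ac)
      qed (use L in simp)
      obtain g N where N: "negligible N" and g: "\<And>t. t \<notin> N \<Longrightarrow> (p has_real_derivative g t) (at t)"
        and int: "\<And>a b. a \<le> b \<Longrightarrow> (g has_integral (p b - p a)) {a..b}"
        by (rule lipschitz_real_ae_derivative[OF lip], rule that, assumption+)
      have "AE t in lborel. t \<notin> N"
        using N by (rule negligible_imp_AE_notin)
      with elim have "AE t in lborel. t \<in> {0..1} \<longrightarrow> g t \<le> ?c w"
      proof eventually_elim
        case (elim t)
        show ?case
        proof
          assume "t \<in> {0..1}"
          then have nb: "x + t *\<^sub>R h \<notin> B" using elim by simp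
          let ?D = "frechet_derivative v (at (x + t *\<^sub>R h))"
          have D: "(v has_derivative ?D) (at (x + t *\<^sub>R h))" and on: "onorm ?D \<le> C"
            using nb B(2) frechet_derivative_works by blast+
          have "((\<lambda>t. v (x + t *\<^sub>R h)) has_derivative (\<lambda>s. ?D (s *\<^sub>R h))) (at t)"
          proof -
            have "((\<lambda>t. x + t *\<^sub>R h) has_derivative (\<lambda>s. s *\<^sub>R h)) (at t)" by (auto intro!: derivative_eq_intros)
            from has_derivative_compose[OF this, of v ?D] D show ?thesis by simp
          qed
          then have "(p has_derivative (\<lambda>s. ?D (s *\<^sub>R h) \<bullet> w)) (at t)"
            unfolding p_def by (rule has_derivative_inner_left)
          moreover have "(p has_derivative (\<lambda>s. g t * s)) (at t)" using g elim by (auto simp: has_field_derivative_def)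
          ultimately have "(\<lambda>s. ?D (s *\<^sub>R h) \<bullet> w) = (\<lambda>s. g t * s)" by (rule has_derivative_unique)
          from fun_cong[OF this, of 1] have "g t = ?D h \<bullet> w" by simp
          also have "\<dots> \<le> norm (?D h) * norm w" by (rule norm_cauchy_schwarz)
          also have "\<dots> \<le> ?c w"
          proof (rule mult_right_mono)
            have "norm (?D h) \<le> onorm ?D * norm h" by (rule onorm[OF has_derivative_bounded_linear[OF D]])
            also have "\<dots> \<le> C * norm h" using on by (intro mult_right_mono) auto
            finally show "norm (?D h) \<le> C * norm h" .
          qed simp
          finally show "g t \<le> ?c w" .
        qed
      qed
      then have "\<exists>M\<in>null_sets lborel. {t. \<not> (t \<in> {0..1} \<longrightarrow> g t \<le> ?c w)} \<subseteq> M"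
        by (auto elim!: AE_E simp: null_sets_def)
      then obtain M where M: "M \<in> null_sets lborel" "{t. \<not> (t \<in> {0..1} \<longrightarrow> g t \<le> ?c w)} \<subseteq> M" by blast
      have M': "negligible M" using M(1) by (simp add: negligible_iff_null_sets null_sets_completionI)
      have "p 1 - p 0 \<le> ?c w"
      proof -
        have "((\<lambda>t. if t \<in> M then ?c w else g t) has_integral (p 1 - p 0)) {0..1}"
          by (rule has_integral_spike[OF M' _ int]) auto
        moreover have "((\<lambda>t. ?c w) has_integral (?c w)) {0..1::real}"
          using has_integral_const_real[of "?c w" 0 1] by simp
        ultimately show ?thesis by (rule has_integral_le) (use M(2) in auto)
      qed
      then show ?case by (simp add: p_def inner_diff_left)
    qed
    then obtain B' where B': "B' \<in> null_sets lborel" "{x. \<not> (v (x + h) - v x) \<bullet> w \<le> ?c w} \<subseteq> B'"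
      by (auto elim!: AE_E simp: null_sets_def)
    have c2: "continuous_on UNIV (\<lambda>x. v (x + h))" by (rule continuous_on_compose2[OF cv]) (auto intro!: continuous_intros)
    have "open {x. \<not> (v (x + h) - v x) \<bullet> w \<le> ?c w}"
      unfolding not_le by (intro open_Collect_less continuous_intros c2 cv)
    moreover have "negligible {x. \<not> (v (x + h) - v x) \<bullet> w \<le> ?c w}"
      by (rule negligible_subset[OF _ B'(2)]) (use B'(1) in \<open>simp add: negligible_iff_null_sets null_sets_completionI\<close>)
    ultimately have "{x. \<not> (v (x + h) - v x) \<bullet> w \<le> ?c w} = {}"
      using open_not_negligible by blast
    then show ?thesis by blast
  qed
  let ?w = "v (x + h) - v x"
  have "norm ?w * norm ?w \<le> C * norm h * norm ?w" using key[of x ?w] by (simp add: dot_square_norm power2_eq_square)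
  \<comment> \<open>Covers the case of a zero increment: at a point of differentiability,
    \<open>C\<close> bounds an operator norm.\<close>
  moreover have "C \<ge> 0" 
  proof -
    have "AE x::'a in lborel. 0 \<le> C"
      using rademacher[OF v] C
    proof eventually_elim
      case (elim x)
      then have "(v has_derivative frechet_derivative v (at x)) (at x)" by (simp add: frechet_derivative_works)
      then show ?case using elim(2) onorm_pos_le[OF has_derivative_bounded_linear] by fastforce
    qed
    then show ?thesis by (simp add: eventually_const_iff ae_filter_eq_bot_iff emeasure_lborel_UNIV)
  qed
  ultimately show ?thesis by (cases "?w = 0") auto
qed

lemma onorm_derivative_le_lipschitz:
  fixes v :: "'a::euclidean_space \<Rightarrow> 'b::euclidean_space"
  assumes D: "(v has_derivative D) (at x)" and v: "L-lipschitz_on UNIV v"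
  shows "onorm D \<le> L"
proof (rule onorm_bound)
  show "L \<ge> 0" using v lipschitz_on_nonneg by blast
  interpret D: bounded_linear D using D by (rule has_derivative_bounded_linear)
  fix h
  have "norm (D h) \<le> L * norm h + e" if e: "e > 0" for e
  proof (cases "h = 0")
    case False
    let ?e = "e / norm h"
    have "?e > 0" using e False by simp
    then obtain d where d: "d > 0" "\<And>y. norm (y - x) < d \<Longrightarrow> norm (v y - v x - D (y - x)) \<le> ?e * norm (y - x)"
      using D unfolding has_derivative_at_alt by blast
    define t where "t = d / (2 * norm h)"
    have t: "t > 0" "t * norm h < d" using d(1) False by (auto simp: t_def)
    have "norm (v (x + t *\<^sub>R h) - v x - D (t *\<^sub>R h)) \<le> ?e * (t * norm h)"
      using d(2)[of "x + t *\<^sub>R h"] t by simp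
    moreover have "norm (v (x + t *\<^sub>R h) - v x) \<le> L * (t * norm h)"
      using lipschitz_onD[OF v, of "x + t *\<^sub>R h" x] t by (simp add: dist_norm)
    moreover have "norm (D (t *\<^sub>R h)) \<le> norm (v (x + t *\<^sub>R h) - v x) + norm (v (x + t *\<^sub>R h) - v x - D (t *\<^sub>R h))"
      using norm_triangle_ineq4[of "v (x + t *\<^sub>R h) - v x" "v (x + t *\<^sub>R h) - v x - D (t *\<^sub>R h)"] by simp
    moreover have "norm (D (t *\<^sub>R h)) = t * norm (D h)" using t by (simp add: D.scaleR)
    moreover have "?e * (t * norm h) = t * e" using False by simp
    ultimately have "t * norm (D h) \<le> t * (L * norm h + e)" by (simp add: algebra_simps)
    then show ?thesis using t by simp
  qed (use e in \<open>simp add: D.zero\<close>)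
  then show "norm (D h) \<le> L * norm h" by (rule field_le_epsilon)
qed

text \<open>Rademacher's theorem places \<open>L\<close> in the set whose infimum defines
  \<open>grad_sup v\<close>, so that set is nonempty. Each of its members is a Lipschitz constant,
  and this bound on a fixed difference quotient passes to the infimum.\<close>

lemma grad_sup_lipschitz:
  fixes v :: "'a::euclidean_space \<Rightarrow> 'a"
  assumes v: "L-lipschitz_on UNIV v"
  shows "grad_sup v \<ge> 0" "norm (v x - v y) \<le> grad_sup v * norm (x - y)"
proof -
  let ?S = "{C. 0 \<le> C \<and> (AE x in lborel. onorm (frechet_derivative v (at x)) \<le> C)}"
  have L: "L \<ge> 0" using v lipschitz_on_nonneg by blast
  have "AE x in lborel. onorm (frechet_derivative v (at x)) \<le> L"
    using rademacher[OF v]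
  proof eventually_elim
    case (elim x)
    let ?D = "frechet_derivative v (at x)"
    have "(v has_derivative ?D) (at x)" using elim by (simp add: frechet_derivative_works)
    then show ?case by (rule onorm_derivative_le_lipschitz[OF _ v])
  qed
  then have ne: "L \<in> ?S" using L by simp
  show g0: "grad_sup v \<ge> 0" unfolding grad_sup_def by (rule cInf_greatest) (use ne in auto)
  show "norm (v x - v y) \<le> grad_sup v * norm (x - y)"
  proof (cases "x = y")
    case False
    have "norm (v x - v y) / norm (x - y) \<le> grad_sup v"
      unfolding grad_sup_def
    proof (rule cInf_greatest)
      fix C assume "C \<in> ?S"
      then show "norm (v x - v y) / norm (x - y) \<le> C"
        using lipschitz_of_AE_derivative_bound[OF v, of C y "x - y"] False by (simp add: divide_le_eq)
    qed (use ne in auto)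
    then show ?thesis using False by (simp add: divide_le_eq)
  qed simp
qed

section \<open>Exponential moments of degenerate second-order statistics\<close>

abbreviation offdiag_sum :: "nat \<Rightarrow> (nat \<Rightarrow> nat \<Rightarrow> real) \<Rightarrow> real" where
  "offdiag_sum N a \<equiv> \<Sum>i<N. \<Sum>j\<in>{..<N} - {i}. a i j"

abbreviation exp_moment :: "'b measure \<Rightarrow> ('b \<Rightarrow> real) \<Rightarrow> ennreal" where
  "exp_moment M f \<equiv> \<integral>\<^sup>+x. ennreal (exp (f x)) \<partial>M"

lemma abs_mult_le_squares: "\<bar>a * b\<bar> \<le> (a\<^sup>2 + b\<^sup>2) / 2" for a b :: real
  using sum_squares_bound[of "\<bar>a\<bar>" "\<bar>b\<bar>"] by (simp add: abs_mult)

text \<open>Only an upper bound on \<open>y\<close> is available in the application, where the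
  kernel may tend to -\<infinity>. For negative \<open>y\<close> the quadratic is compared with the
  Taylor bound of exp (-y): the product of the two polynomials is at least 1.\<close>

lemma exp_le_quadratic:
  fixes y :: real
  assumes "y \<le> 1"
  shows "exp y \<le> 1 + y + y\<^sup>2"
proof (cases "y \<ge> 0")
  case True
  then show ?thesis using exp_bound[of y] assms by simp
next
  case False
  define z where "z = - y"
  have z: "z > 0" using False by (simp add: z_def)
  have p: "1 + z + z\<^sup>2 / 2 > 0" using z by (simp add: add_pos_pos)
  have "exp y * (1 + z + z\<^sup>2 / 2) \<le> exp y * exp z"
    using exp_lower_Taylor_quadratic[of z] z by (intro mult_left_mono) auto
  also have "\<dots> = 1" by (simp add: z_def flip: exp_add)
  also have "1 \<le> (1 + y + y\<^sup>2) * (1 + z + z\<^sup>2 / 2)"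
  proof -
    have "(1 + y + y\<^sup>2) * (1 + z + z\<^sup>2 / 2) = 1 + z\<^sup>2 / 2 + z ^ 3 / 2 + z ^ 4 / 2"
      by (simp add: z_def field_simps power2_eq_square power3_eq_cube power4_eq_xxxx)
    then show ?thesis using z by (simp add: add_nonneg_nonneg)
  qed
  finally show ?thesis using p by (simp add: mult_le_cancel_right)
qed

section \<open>Integrating out one point at a time\<close>

text \<open>The normal form of a completely degenerate pair kernel: bounded above by 1, with rows of
  mean 0 and of L^2 norm at most 1. Symmetry and the upper bound are imposed at all points, also
  outside \<open>space M\<close>.\<close>

locale centered_kernel = prob_space M for M :: "'a measure" +
  fixes w :: "'a \<Rightarrow> 'a \<Rightarrow> real"
  assumes kernel_measurable [measurable]: "case_prod w \<in> borel_measurable (M \<Otimes>\<^sub>M M)"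
    and kernel_sym: "w x y = w y x"
    and kernel_le_1: "w x y \<le> 1"
    and kernel_sq_integrable: "x \<in> space M \<Longrightarrow> integrable M (\<lambda>y. (w x y)\<^sup>2)"
    and kernel_sq_le_1: "x \<in> space M \<Longrightarrow> (\<integral>y. (w x y)\<^sup>2 \<partial>M) \<le> 1"
    and kernel_centered: "x \<in> space M \<Longrightarrow> (\<integral>y. w x y \<partial>M) = 0"
begin

definition field_sum :: "nat \<Rightarrow> (nat \<Rightarrow> 'a) \<Rightarrow> 'a \<Rightarrow> real" where
  "field_sum m X y = (\<Sum>i<m. w (X i) y)"

definition field_energy :: "nat \<Rightarrow> (nat \<Rightarrow> 'a) \<Rightarrow> real" where
  "field_energy m X = (\<integral>y. (field_sum m X y)\<^sup>2 \<partial>M)"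

definition pair_sum :: "nat \<Rightarrow> (nat \<Rightarrow> 'a) \<Rightarrow> real" where
  "pair_sum m X = (\<Sum>i<m. \<Sum>j<i. w (X j) (X i))"

abbreviation P :: "nat \<Rightarrow> (nat \<Rightarrow> 'a) measure" where
  "P m \<equiv> \<Pi>\<^sub>M i\<in>{..<m}. M"

lemma kernel_measurable_2: "x \<in> space M \<Longrightarrow> w x \<in> borel_measurable M"
  using measurable_compose_Pair1[OF _ kernel_measurable] by simp

lemma kernel_integrable: "x \<in> space M \<Longrightarrow> integrable M (w x)"
  by (rule square_integrable_imp_integrable[OF kernel_measurable_2 kernel_sq_integrable])

lemma kernel_prod_integrable:
  assumes "x \<in> space M" "z \<in> space M"
  shows "integrable M (\<lambda>y. w x y * w z y)" and "\<bar>\<integral>y. w x y * w z y \<partial>M\<bar> \<le> 1"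
proof -
  note [measurable] = kernel_measurable_2[OF assms(1)] kernel_measurable_2[OF assms(2)]
  have i2: "integrable M (\<lambda>y. ((w x y)\<^sup>2 + (w z y)\<^sup>2) / 2)"
    using kernel_sq_integrable[OF assms(1)] kernel_sq_integrable[OF assms(2)] by simp
  show i: "integrable M (\<lambda>y. w x y * w z y)"
    by (rule Bochner_Integration.integrable_bound[OF i2]) (use abs_mult_le_squares in \<open>auto intro: order_trans\<close>)
  have "\<bar>\<integral>y. w x y * w z y \<partial>M\<bar> \<le> (\<integral>y. \<bar>w x y * w z y\<bar> \<partial>M)" using integral_norm_bound[of M "\<lambda>y. w x y * w z y"] by simp
  also have "\<dots> \<le> (\<integral>y. ((w x y)\<^sup>2 + (w z y)\<^sup>2) / 2 \<partial>M)"
    by (intro integral_mono i2 integrable_abs i abs_mult_le_squares)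
  also have "\<dots> \<le> 1"
    using kernel_sq_integrable[OF assms(1)] kernel_sq_integrable[OF assms(2)] kernel_sq_le_1[OF assms(1)] kernel_sq_le_1[OF assms(2)]
    by simp
  finally show "\<bar>\<integral>y. w x y * w z y \<partial>M\<bar> \<le> 1" .
qed

lemma measurable_field_sum:
  "m \<le> k \<Longrightarrow> (\<lambda>(X, y). field_sum m X y) \<in> borel_measurable (P k \<Otimes>\<^sub>M M)"
  unfolding field_sum_def by measurable

lemma measurable_field_energy: "m \<le> k \<Longrightarrow> field_energy m \<in> borel_measurable (P k)"
  unfolding field_energy_def
  using measurable_field_sum[of m k] by measurable

lemma measurable_pair_sum: "m \<le> k \<Longrightarrow> pair_sum m \<in> borel_measurable (P k)"
  unfolding pair_sum_def by measurable

context
  fixes m :: nat and X :: "nat \<Rightarrow> 'a"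
  assumes X: "\<And>i. i < m \<Longrightarrow> X i \<in> space M"
begin

text \<open>The L^2 inner product of the field with the row of a new point. Twice this value is the
  linear term in the change of \<open>field_energy\<close> when that point is added.\<close>

definition cross :: "'a \<Rightarrow> real" where
  "cross x = (\<integral>y. field_sum m X y * w x y \<partial>M)"

lemma field_sum_measurable: "field_sum m X \<in> borel_measurable M"
  unfolding field_sum_def using kernel_measurable_2[OF X] by (intro borel_measurable_sum) auto

lemma field_sum_integrable: "integrable M (field_sum m X)" "(\<integral>y. field_sum m X y \<partial>M) = 0"
  unfolding field_sum_def using kernel_integrable[OF X] kernel_centered[OF X]
  by (auto intro!: Bochner_Integration.integrable_sum simp: Bochner_Integration.integral_sum)

lemma field_sum_sq_integrable: "integrable M (\<lambda>y. (field_sum m X y)\<^sup>2)"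
  unfolding field_sum_def power2_eq_square sum_product
  using kernel_prod_integrable(1)[OF X X] by (intro Bochner_Integration.integrable_sum) auto

lemma field_cross_integrable: "x \<in> space M \<Longrightarrow> integrable M (\<lambda>y. field_sum m X y * w x y)"
  unfolding field_sum_def sum_distrib_right
  using kernel_prod_integrable(1)[OF X] by (intro Bochner_Integration.integrable_sum) auto

lemma cross_eq: "x \<in> space M \<Longrightarrow> cross x = (\<Sum>i<m. \<integral>y. w (X i) y * w x y \<partial>M)"
  unfolding cross_def field_sum_def sum_distrib_right
  using kernel_prod_integrable(1)[OF X] by (intro Bochner_Integration.integral_sum) auto

lemma cross_measurable [measurable]: "cross \<in> borel_measurable M"
  unfolding cross_def using field_sum_measurable by measurable

lemma abs_cross_le: "x \<in> space M \<Longrightarrow> \<bar>cross x\<bar> \<le> m"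
proof -
  assume x: "x \<in> space M"
  have "\<bar>cross x\<bar> \<le> (\<Sum>i<m. \<bar>\<integral>y. w (X i) y * w x y \<partial>M\<bar>)" unfolding cross_eq[OF x] by (rule sum_abs)
  also have "\<dots> \<le> (\<Sum>i<m. 1)" using kernel_prod_integrable(2)[OF X x] by (intro sum_mono) auto
  finally show ?thesis by simp
qed

lemma cross_integrable: "integrable M cross"
  by (rule integrable_const_bound[of _ "real m"]) (auto intro!: abs_cross_le)

lemma cross_sq_integrable: "integrable M (\<lambda>x. (cross x)\<^sup>2)"
  by (rule integrable_const_bound[of _ "(real m)\<^sup>2"]) (use abs_cross_le in \<open>auto simp: abs_le_square_iff[symmetric]\<close>)

text \<open>Cauchy-Schwarz against a row of norm at most 1, obtained by expanding the square of
  \<open>field_sum m X y - ?T * w x y\<close>.\<close>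

lemma cross_sq_le: "x \<in> space M \<Longrightarrow> (cross x)\<^sup>2 \<le> field_energy m X"
proof -
  assume x: "x \<in> space M"
  let ?T = "cross x"
  let ?n = "\<integral>y. (w x y)\<^sup>2 \<partial>M"
  have "0 \<le> (\<integral>y. (field_sum m X y - ?T * w x y)\<^sup>2 \<partial>M)" by simp
  also have "(\<lambda>y. (field_sum m X y - ?T * w x y)\<^sup>2) = (\<lambda>y. (field_sum m X y)\<^sup>2 - 2 * ?T * (field_sum m X y * w x y) + ?T\<^sup>2 * (w x y)\<^sup>2)"
    by (simp add: power2_eq_square algebra_simps)
  also have "(\<integral>y. (field_sum m X y)\<^sup>2 - 2 * ?T * (field_sum m X y * w x y) + ?T\<^sup>2 * (w x y)\<^sup>2 \<partial>M) = field_energy m X - 2 * ?T * ?T + ?T\<^sup>2 * ?n"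
    using field_sum_sq_integrable field_cross_integrable[OF x] kernel_sq_integrable[OF x]
    by (simp add: field_energy_def cross_def)
  also have "?T\<^sup>2 * ?n \<le> ?T\<^sup>2 * 1" using kernel_sq_le_1[OF x] by (intro mult_left_mono) auto
  finally show ?thesis by (simp add: power2_eq_square)
qed

text \<open>Fubini integrates out the argument of \<open>cross\<close> first, and by symmetry that
  inner integral is a row mean, hence 0.\<close>

lemma integral_cross: "(\<integral>x. cross x \<partial>M) = 0"
proof -
  interpret PP: pair_prob_space M M ..
  have "(\<integral>x. (\<integral>y. w (X i) y * w x y \<partial>M) \<partial>M) = 0" if i: "i < m" for i
  proof -
    note [measurable] = kernel_measurable_2[OF X[OF i]]
    have int: "integrable (M \<Otimes>\<^sub>M M) (\<lambda>(x, y). w (X i) y * w x y)"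
    proof (rule PP.Fubini_integrable)
      have "\<bar>\<integral>y. norm (w (X i) y * w x y) \<partial>M\<bar> \<le> 1" if x: "x \<in> space M" for x
      proof -
        have "(\<integral>y. \<bar>w (X i) y * w x y\<bar> \<partial>M) \<le> (\<integral>y. ((w (X i) y)\<^sup>2 + (w x y)\<^sup>2) / 2 \<partial>M)"
          using kernel_sq_integrable[OF x] kernel_sq_integrable[OF X[OF i]] kernel_prod_integrable(1)[OF X[OF i] x]
          by (intro integral_mono integrable_abs abs_mult_le_squares) auto
        also have "\<dots> \<le> 1"
          using kernel_sq_integrable[OF x] kernel_sq_integrable[OF X[OF i]] kernel_sq_le_1[OF x] kernel_sq_le_1[OF X[OF i]] by simp
        finally show ?thesis by simp
      qed
      then show "integrable M (\<lambda>x. \<integral>y. norm (case (x, y) of (x, y) \<Rightarrow> w (X i) y * w x y) \<partial>M)"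
        by (intro integrable_const_bound[of _ 1]) auto
    qed (use kernel_prod_integrable(1)[OF X[OF i]] in auto)
    have "(\<integral>x. (\<integral>y. w (X i) y * w x y \<partial>M) \<partial>M) = (\<integral>y. (\<integral>x. w (X i) y * w x y \<partial>M) \<partial>M)"
      by (rule PP.Fubini_integral[OF int, symmetric])
    also have "\<dots> = (\<integral>y. w (X i) y * (\<integral>x. w y x \<partial>M) \<partial>M)"
      by (subst kernel_sym) simp
    also have "\<dots> = (\<integral>y. 0 \<partial>M)" by (intro Bochner_Integration.integral_cong) (auto simp: kernel_centered)
    finally show ?thesis by simp
  qed
  then have "(\<Sum>i<m. \<integral>x. (\<integral>y. w (X i) y * w x y \<partial>M) \<partial>M) = 0" by simp
  moreover have "(\<integral>x. cross x \<partial>M) = (\<integral>x. (\<Sum>i<m. \<integral>y. w (X i) y * w x y \<partial>M) \<partial>M)"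
    by (intro Bochner_Integration.integral_cong) (auto simp: cross_eq)
  moreover have "integrable M (\<lambda>x. \<integral>y. w (X i) y * w x y \<partial>M)" if i: "i < m" for i
  proof -
    note [measurable] = kernel_measurable_2[OF X[OF i]]
    show ?thesis by (rule integrable_const_bound[of _ 1]) (auto intro!: kernel_prod_integrable(2) X i)
  qed
  ultimately show ?thesis by simp
qed

text \<open>Both linear terms have mean 0, so what the quadratic bound on the exponential leaves is
  of second order, and 1 + z \<le> exp z restores the exponential form. The condition on
  \<open>m\<close> keeps the exponent at most 1. The coefficients 2 and 8 come from (p + q)^2 \<le>
  2 p^2 + 2 q^2 with q equal to 2a times \<open>cross\<close>.\<close>

lemma nn_integral_exp_increment_le:
  fixes a b :: real
  assumes a: "0 \<le> a" and b: "0 \<le> b" and ab: "(b + 2 * a) * m \<le> 1"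
  shows "exp_moment M (\<lambda>x. b * field_sum m X x + 2 * a * cross x)
    \<le> ennreal (exp ((2 * b\<^sup>2 + 8 * a\<^sup>2) * field_energy m X))"
proof -
  note [measurable] = field_sum_measurable
  let ?Y = "\<lambda>x. b * field_sum m X x + 2 * a * cross x"
  let ?W = "field_energy m X"
  let ?q = "\<lambda>x. 1 + ?Y x + (2 * b\<^sup>2 * (field_sum m X x)\<^sup>2 + 8 * a\<^sup>2 * (cross x)\<^sup>2)"
  have le: "exp (?Y x) \<le> ?q x" if x: "x \<in> space M" for x
  proof -
    have "field_sum m X x \<le> m" unfolding field_sum_def using sum_mono[of "{..<m}" "\<lambda>i. w (X i) x" "\<lambda>_. 1"] kernel_le_1 by simp
    then have "?Y x \<le> b * m + 2 * a * m"
      using abs_cross_le[OF x] a b by (intro add_mono mult_left_mono) (simp_all add: abs_le_iff)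
    then have "?Y x \<le> 1" using ab by (simp add: algebra_simps)
    then have "exp (?Y x) \<le> 1 + ?Y x + (?Y x)\<^sup>2" by (rule exp_le_quadratic)
    moreover have "(?Y x)\<^sup>2 \<le> 2 * (b * field_sum m X x)\<^sup>2 + 2 * (2 * a * cross x)\<^sup>2"
      using sum_squares_bound[of "b * field_sum m X x" "2 * a * cross x"] by (simp add: power2_sum)
    ultimately show ?thesis by (simp add: power_mult_distrib)
  qed
  have i: "integrable M ?q"
    using field_sum_integrable(1) cross_integrable field_sum_sq_integrable cross_sq_integrable by simp
  have "exp_moment M ?Y \<le> (\<integral>\<^sup>+x. ennreal (?q x) \<partial>M)"
    by (intro nn_integral_mono ennreal_leI le)
  also have "\<dots> = ennreal (\<integral>x. ?q x \<partial>M)"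
    by (intro nn_integral_eq_integral i AE_I2 order_trans[OF exp_ge_zero le])
  also have "(\<integral>x. ?q x \<partial>M) = 1 + (2 * b\<^sup>2 * ?W + 8 * a\<^sup>2 * (\<integral>x. (cross x)\<^sup>2 \<partial>M))"
    using field_sum_integrable cross_integrable field_sum_sq_integrable cross_sq_integrable integral_cross
    by (simp add: field_energy_def prob_space)
  also have "\<dots> \<le> 1 + (2 * b\<^sup>2 * ?W + 8 * a\<^sup>2 * ?W)"
  proof -
    have "(\<integral>x. (cross x)\<^sup>2 \<partial>M) \<le> (\<integral>x. ?W \<partial>M)"
      by (intro integral_mono cross_sq_integrable cross_sq_le) auto
    then show ?thesis by (simp add: prob_space mult_left_mono)
  qed
  also have "\<dots> \<le> exp ((2 * b\<^sup>2 + 8 * a\<^sup>2) * ?W)"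
    using exp_ge_add_one_self[of "(2 * b\<^sup>2 + 8 * a\<^sup>2) * ?W"] by (simp add: algebra_simps)
  finally show ?thesis by (simp add: ennreal_leI)
qed

lemma field_energy_Suc:
  assumes x: "x \<in> space M"
  shows "field_energy (Suc m) (X(m := x)) \<le> field_energy m X + 2 * cross x + 1"
proof -
  have "(\<lambda>y. (field_sum (Suc m) (X(m := x)) y)\<^sup>2) = (\<lambda>y. (field_sum m X y)\<^sup>2 + 2 * (field_sum m X y * w x y) + (w x y)\<^sup>2)"
    by (simp add: field_sum_def power2_sum algebra_simps)
  then have "field_energy (Suc m) (X(m := x)) = field_energy m X + 2 * cross x + (\<integral>y. (w x y)\<^sup>2 \<partial>M)"
    unfolding field_energy_def[of "Suc m"]
    using field_sum_sq_integrable field_cross_integrable[OF x] kernel_sq_integrable[OF x]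
    by (simp add: field_energy_def cross_def)
  then show ?thesis using kernel_sq_le_1[OF x] by simp
qed

lemma pair_sum_Suc: "pair_sum (Suc m) (X(m := x)) = pair_sum m X + field_sum m X x"
  by (simp add: pair_sum_def field_sum_def)

end

text \<open>
  Integrating out the last variable trades the weight \<open>a\<close> of the quadratic functional
  \<open>field_energy\<close> for \<open>a + 2 b\<^sup>2 + 8 a\<^sup>2\<close>. The condition on \<open>a\<close> and \<open>m\<close> is stable under this map.
\<close>

lemma nn_integral_exp_pair_sum_le:
  fixes a b :: real
  assumes "0 < b" "0 \<le> a" "a + 10 * b\<^sup>2 * m \<le> b"
  shows "exp_moment (P m) (\<lambda>X. b * pair_sum m X + a * field_energy m X) \<le> ennreal (exp (b * m))"
  using assms(2,3)
proof (induction m arbitrary: a)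
  case 0
  interpret P0: prob_space "P 0" by (intro prob_space_PiM prob_space_axioms)
  show ?case using P0.emeasure_space_1 by (simp add: pair_sum_def field_energy_def field_sum_def)
next
  case (Suc m)
  interpret PS: product_sigma_finite "\<lambda>_. M" ..
  \<comment> \<open>As \<open>a\<close> is at most \<open>b\<close>, the weight increases by at most
    10 b^2, which is exactly what the hypothesis releases when \<open>Suc m\<close> drops to
    \<open>m\<close>.\<close>
  let ?a = "a + 2 * b\<^sup>2 + 8 * a\<^sup>2"
  have "10 * b\<^sup>2 * real (Suc m) \<ge> 0" by simp
  then have ab: "a \<le> b" using Suc.prems by linarith
  have a2: "a\<^sup>2 \<le> b\<^sup>2" using ab Suc.prems by (intro power_mono) auto
  have "?a + 10 * b\<^sup>2 * m \<le> b" using a2 Suc.prems(2) by (simp add: algebra_simps)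
  then have IH: "exp_moment (P m) (\<lambda>X. b * pair_sum m X + ?a * field_energy m X) \<le> ennreal (exp (b * m))"
    using Suc.prems by (intro Suc.IH) auto
  have "(b + 2 * a) * m \<le> 1"
  proof -
    have "b * (10 * b * real (Suc m)) \<le> b * 1" using Suc.prems by (simp add: power2_eq_square algebra_simps)
    then have "10 * b * real (Suc m) \<le> 1" using assms(1) by (simp only: mult_le_cancel_left_pos)
    moreover have "(b + 2 * a) * m \<le> (3 * b) * m" using ab by (intro mult_right_mono) auto
    moreover have "(3 * b) * m \<le> 10 * b * real (Suc m)" using assms(1) by (intro mult_mono) auto
    ultimately show ?thesis by linarith
  qed
  note inc = nn_integral_exp_increment_le[OF _ Suc.prems(1) less_imp_le[OF assms(1)] this]
  note [measurable] = measurable_field_energy[of "Suc m" "Suc m"] measurable_pair_sum[of "Suc m" "Suc m"]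
     measurable_field_energy[of "m" "m"] measurable_pair_sum[of "m" "m"]
  have "exp_moment (P (Suc m)) (\<lambda>X. b * pair_sum (Suc m) X + a * field_energy (Suc m) X)
    = (\<integral>\<^sup>+X. exp_moment M (\<lambda>x. b * pair_sum (Suc m) (X(m := x)) + a * field_energy (Suc m) (X(m := x))) \<partial>P m)"
    unfolding lessThan_Suc
    by (rule PS.product_nn_integral_insert) (auto simp flip: lessThan_Suc)
  \<comment> \<open>The factor exp a accounts for the squared norm, at most 1, of the removed row.
    Since a \<le> b, each removed point costs at most exp b.\<close>
  also have "\<dots> \<le> (\<integral>\<^sup>+X. ennreal (exp a) * ennreal (exp (b * pair_sum m X + ?a * field_energy m X)) \<partial>P m)"
  proof (rule nn_integral_mono)
    fix X assume "X \<in> space (P m)"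
    then have X: "\<And>i. i < m \<Longrightarrow> X i \<in> space M" by (auto simp: space_PiM)
    let ?c = "b * pair_sum m X + a * field_energy m X + a"
    have "exp_moment M (\<lambda>x. b * pair_sum (Suc m) (X(m := x)) + a * field_energy (Suc m) (X(m := x)))
      \<le> (\<integral>\<^sup>+x. ennreal (exp ?c) * ennreal (exp (b * field_sum m X x + 2 * a * cross m X x)) \<partial>M)"
    proof (rule nn_integral_mono)
      fix x assume x: "x \<in> space M"
      have "a * field_energy (Suc m) (X(m := x)) \<le> a * (field_energy m X + 2 * cross m X x + 1)"
        using field_energy_Suc[OF _ x, of m X] X Suc.prems by (intro mult_left_mono) auto
      then have "b * pair_sum (Suc m) (X(m := x)) + a * field_energy (Suc m) (X(m := x)) \<le> ?c + (b * field_sum m X x + 2 * a * cross m X x)"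
        using pair_sum_Suc[of m X x] X by (simp add: algebra_simps)
      then show "ennreal (exp (b * pair_sum (Suc m) (X(m := x)) + a * field_energy (Suc m) (X(m := x))))
        \<le> ennreal (exp ?c) * ennreal (exp (b * field_sum m X x + 2 * a * cross m X x))"
        by (simp only: ennreal_mult[symmetric] exp_ge_zero exp_add[symmetric] ennreal_leI exp_le_cancel_iff)
    qed
    also have "\<dots> = ennreal (exp ?c) * exp_moment M (\<lambda>x. b * field_sum m X x + 2 * a * cross m X x)"
    proof -
      have [measurable]: "field_sum m X \<in> borel_measurable M" by (rule field_sum_measurable) (rule X)
      have [measurable]: "cross m X \<in> borel_measurable M" by (rule cross_measurable) (rule X)
      show ?thesis by (rule nn_integral_cmult) measurable
    qed
    also have "\<dots> \<le> ennreal (exp ?c) * ennreal (exp ((2 * b\<^sup>2 + 8 * a\<^sup>2) * field_energy m X))"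
      by (rule mult_left_mono, rule inc, rule X, assumption, simp)
    also have "\<dots> = ennreal (exp a) * ennreal (exp (b * pair_sum m X + ?a * field_energy m X))"
    proof -
      have "?c + (2 * b\<^sup>2 + 8 * a\<^sup>2) * field_energy m X = a + (b * pair_sum m X + ?a * field_energy m X)"
        by (simp only: distrib_right add.assoc add.commute add.left_commute)
      then show ?thesis by (simp only: ennreal_mult[symmetric] exp_ge_zero exp_add[symmetric])
    qed
    finally show "exp_moment M (\<lambda>x. b * pair_sum (Suc m) (X(m := x)) + a * field_energy (Suc m) (X(m := x)))
      \<le> ennreal (exp a) * ennreal (exp (b * pair_sum m X + ?a * field_energy m X))" .
  qed
  also have "\<dots> = ennreal (exp a) * exp_moment (P m) (\<lambda>X. b * pair_sum m X + ?a * field_energy m X)"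
    by (rule nn_integral_cmult) measurable
  also have "\<dots> \<le> ennreal (exp b) * ennreal (exp (b * m))"
    using ab by (intro mult_mono IH) (auto intro: ennreal_leI)
  also have "\<dots> = ennreal (exp (b * real (Suc m)))"
    by (simp only: ennreal_mult[symmetric] exp_ge_zero exp_add[symmetric] of_nat_Suc distrib_left mult_1_right)
  finally show ?case .
qed

text \<open>With b = 1/(10N) and a = 0 the condition of the induction holds with equality. Each
  unordered pair occurs twice in the double sum, whence 1/(20N); the induction then gives exp
  (1/10), which is below e.\<close>

lemma nn_integral_exp_offdiag_sum_le:
  fixes N :: nat
  assumes N: "N \<ge> 1"
  shows "exp_moment (P N) (\<lambda>X. 1 / (20 * real N) * offdiag_sum N (\<lambda>i j. w (X i) (X j))) \<le> ennreal (exp 1)"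
proof -
  have split: "(\<Sum>i<n. \<Sum>j\<in>{..<n} - {i}. w (X i) (X j)) = 2 * pair_sum n X" for X and n :: nat
  proof (induction n)
    case (Suc n)
    have "(\<Sum>i<Suc n. \<Sum>j\<in>{..<Suc n} - {i}. w (X i) (X j))
      = (\<Sum>i<n. \<Sum>j\<in>{..<Suc n} - {i}. w (X i) (X j)) + (\<Sum>j\<in>{..<Suc n} - {n}. w (X n) (X j))" by simp
    also have "{..<Suc n} - {n} = {..<n}" by auto
    also have "(\<Sum>i<n. \<Sum>j\<in>{..<Suc n} - {i}. w (X i) (X j)) = (\<Sum>i<n. w (X i) (X n) + (\<Sum>j\<in>{..<n} - {i}. w (X i) (X j)))"
    proof (rule sum.cong[OF refl])
      fix i assume "i \<in> {..<n}"
      then have "{..<Suc n} - {i} = insert n ({..<n} - {i})" by auto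
      then show "(\<Sum>j\<in>{..<Suc n} - {i}. w (X i) (X j)) = w (X i) (X n) + (\<Sum>j\<in>{..<n} - {i}. w (X i) (X j))" by simp
    qed
    also have "\<dots> = (\<Sum>i<n. w (X i) (X n)) + 2 * pair_sum n X" by (simp add: sum.distrib Suc.IH)
    also have "(\<Sum>j<n. w (X n) (X j)) = (\<Sum>j<n. w (X j) (X n))" by (rule sum.cong[OF refl], rule kernel_sym)
    finally show ?case by (simp add: pair_sum_def)
  qed (simp add: pair_sum_def)
  have "exp_moment (P N) (\<lambda>X. 1 / (10 * real N) * pair_sum N X + 0 * field_energy N X) \<le> ennreal (exp (1 / (10 * real N) * N))"
    by (rule nn_integral_exp_pair_sum_le) (use N in \<open>simp_all add: power2_eq_square divide_simps\<close>)
  also have "\<dots> \<le> ennreal (exp 1)" using N by (intro ennreal_leI) simp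
  finally have *: "exp_moment (P N) (\<lambda>X. 1 / (10 * real N) * pair_sum N X + 0 * field_energy N X) \<le> ennreal (exp 1)" .
  have eq: "1 / (10 * real N) * pair_sum N X + 0 * field_energy N X = 1 / (20 * real N) * (2 * pair_sum N X)" for X
    by simp
  show ?thesis using * unfolding split eq .
qed

end

text \<open>
  For symmetric \<open>q\<close> this is \<open>N\<close> times the integral of \<open>q\<close> off the diagonal against \<open>(\<mu>\<^sub>N - M)\<^sup>\<otimes>\<^sup>2\<close>.
\<close>

definition ustat :: "nat \<Rightarrow> 'a measure \<Rightarrow> ('a \<Rightarrow> 'a \<Rightarrow> real) \<Rightarrow> (nat \<Rightarrow> 'a) \<Rightarrow> real" where
  "ustat N M q X = 1 / real N * offdiag_sum N (\<lambda>i j. q (X i) (X j))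
     - 2 * (\<Sum>i<N. \<integral>y. q (X i) y \<partial>M) + real N * (\<integral>x. \<integral>y. q x y \<partial>M \<partial>M)"

text \<open>Hoeffding's projection. In the double sum each point meets only N - 1 others, whereas
  the one-point terms carry the weight of N; the mismatch is the remainder outside the double sum.
  For q = g it is, up to normalisation, the correction by h_\<mu> and I_\<mu> in the definition of
  F_N.\<close>

lemma ustat_centered:
  fixes m :: "'a \<Rightarrow> real"
  assumes N: "N \<ge> 1" and m: "\<And>i. i < N \<Longrightarrow> m (X i) = (\<integral>y. q (X i) y \<partial>M)" and c: "c = (\<integral>x. \<integral>y. q x y \<partial>M \<partial>M)"
  shows "ustat N M q X = 1 / real N * offdiag_sum N (\<lambda>i j. q (X i) (X j) - m (X i) - m (X j) + c)
    - 2 / real N * (\<Sum>i<N. m (X i)) + c"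
proof -
  let ?S = "\<Sum>i<N. m (X i)"
  have 1: "offdiag_sum N (\<lambda>i j. m (X i)) = (real N - 1) * ?S"
    using N by (simp add: sum_distrib_left card_Diff_singleton of_nat_diff)
  have 2: "offdiag_sum N (\<lambda>i j. m (X j)) = (real N - 1) * ?S"
  proof -
    have "offdiag_sum N (\<lambda>i j. m (X j)) = (\<Sum>i<N. ?S - m (X i))"
      by (intro sum.cong refl) (simp add: sum_diff1)
    then show ?thesis by (simp add: sum_subtractf algebra_simps)
  qed
  have 3: "offdiag_sum N (\<lambda>i j. c) = real N * (real N - 1) * c"
    using N by (simp add: card_Diff_singleton of_nat_diff)
  have "offdiag_sum N (\<lambda>i j. q (X i) (X j) - m (X i) - m (X j) + c)
    = offdiag_sum N (\<lambda>i j. q (X i) (X j)) - (real N - 1) * ?S - (real N - 1) * ?S + real N * (real N - 1) * c"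
    unfolding sum.distrib sum_subtractf 1 2 3 ..
  moreover have "ustat N M q X = 1 / real N * offdiag_sum N (\<lambda>i j. q (X i) (X j)) - 2 * ?S + real N * c"
    using m c by (simp add: ustat_def)
  ultimately show ?thesis using N by (simp add: field_simps)
qed

text \<open>The second moments of the rows bound the marginals by \<open>K\<close>, so the remainder
  left by centring is at most 3K for every \<open>N\<close>. The centred kernel still has an upper
  bound and bounded row moments, and division by \<open>R\<close> makes it a
  \<open>centered_kernel\<close>.\<close>

lemma ustat_exp_moment:
  fixes q :: "'a \<Rightarrow> 'a \<Rightarrow> real"
  assumes "prob_space M"
    and meas[measurable]: "case_prod q \<in> borel_measurable (M \<Otimes>\<^sub>M M)"
    and sym: "\<And>x y. q x y = q y x" and upper: "\<And>x y. q x y \<le> B"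
    and sq: "\<And>x. x \<in> space M \<Longrightarrow> integrable M (\<lambda>y. (q x y)\<^sup>2)"
    and sq_le: "\<And>x. x \<in> space M \<Longrightarrow> (\<integral>y. (q x y)\<^sup>2 \<partial>M) \<le> D"
  shows "\<exists>b>0. \<exists>C. \<forall>N\<ge>1. exp_moment (tensor_power N M) (\<lambda>X. b * ustat N M q X) \<le> ennreal C"
proof -
  interpret prob_space M by fact
  have qx: "q x \<in> borel_measurable M" if "x \<in> space M" for x
    using measurable_compose_Pair1[OF that meas] by simp
  have int: "integrable M (q x)" if "x \<in> space M" for x
    by (rule square_integrable_imp_integrable[OF qx[OF that] sq[OF that]])
  \<comment> \<open>From |q| \<le> (1 + q^2)/2, integrated over a row.\<close>
  define K where "K = (1 + D) / 2"
  \<comment> \<open>The value 0 outside \<open>space M\<close> makes the bound by \<open>K\<close>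
    hold everywhere, as the upper bound in the locale demands.\<close>
  define m where "m x = (if x \<in> space M then \<integral>y. q x y \<partial>M else 0)" for x
  define c where "c = (\<integral>x. \<integral>y. q x y \<partial>M \<partial>M)"
  obtain x0 where "x0 \<in> space M" using not_empty by blast
  then have D0: "D \<ge> 0" using order_trans[OF _ sq_le] by simp
  then have K0: "K \<ge> 0" by (simp add: K_def)
  have mK: "\<bar>m x\<bar> \<le> K" for x
  proof (cases "x \<in> space M")
    case True
    have "\<bar>\<integral>y. q x y \<partial>M\<bar> \<le> (\<integral>y. \<bar>q x y\<bar> \<partial>M)" by (rule integral_abs_bound)
    also have "\<dots> \<le> (\<integral>y. (1 + (q x y)\<^sup>2) / 2 \<partial>M)"
    proof (rule integral_mono)
      show "\<bar>q x y\<bar> \<le> (1 + (q x y)\<^sup>2) / 2" for y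
        using sum_squares_bound[of 1 "\<bar>q x y\<bar>"] by simp
    qed (use int[OF True] sq[OF True] in auto)
    also have "\<dots> \<le> K" using sq[OF True] sq_le[OF True] by (simp add: K_def prob_space)
    finally show ?thesis using True by (simp add: m_def)
  qed (simp add: m_def K0)
  have mm[measurable]: "m \<in> borel_measurable M"
  proof -
    have "(\<lambda>x. \<integral>y. q x y \<partial>M) \<in> borel_measurable M" by measurable
    then show ?thesis by (rule measurable_cong[THEN iffD1, rotated]) (simp add: m_def)
  qed
  have mint: "integrable M m" by (rule integrable_const_bound[of _ K]) (use mK in auto)
  have cm: "c = (\<integral>x. m x \<partial>M)" unfolding c_def by (rule Bochner_Integration.integral_cong) (auto simp: m_def)
  have cK: "\<bar>c\<bar> \<le> K"
  proof -
    have "\<bar>c\<bar> \<le> (\<integral>x. \<bar>m x\<bar> \<partial>M)" unfolding cm by (rule integral_abs_bound)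
    also have "\<dots> \<le> (\<integral>x. K \<partial>M)" by (intro integral_mono integrable_abs mint mK) auto
    finally show ?thesis by (simp add: prob_space)
  qed
  define u where "u x y = q x y - m x - m y + c" for x y
  \<comment> \<open>|B| + 3K dominates the centred kernel from above and 4D + 12K^2 its row second
    moments; as R \<ge> 1, dividing the latter by R^2 leaves at most 1.\<close>
  define R where "R = 1 + \<bar>B\<bar> + 3 * K + 4 * D + 12 * K\<^sup>2"
  have R1: "R \<ge> 1" using D0 K0 by (simp add: R_def)
  have four: "(p - a - r + t)\<^sup>2 \<le> 4 * (p\<^sup>2 + a\<^sup>2 + r\<^sup>2 + t\<^sup>2)" for p a r t :: real
  proof -
    have "0 \<le> (p + a)\<^sup>2 + (p + r)\<^sup>2 + (p - t)\<^sup>2 + (a - r)\<^sup>2 + (a + t)\<^sup>2 + (r + t)\<^sup>2" by simp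
    then show ?thesis by (simp add: power2_eq_square algebra_simps)
  qed
  have usq: "(u x y)\<^sup>2 \<le> 4 * (q x y)\<^sup>2 + 12 * K\<^sup>2" for x y
  proof -
    have "(m x)\<^sup>2 \<le> K\<^sup>2" "(m y)\<^sup>2 \<le> K\<^sup>2" "c\<^sup>2 \<le> K\<^sup>2" using mK cK K0 by (auto simp: abs_le_square_iff[symmetric])
    moreover have "4 * (p + a + r + t) \<le> 4 * p + 12 * k" if "a \<le> k" "r \<le> k" "t \<le> k" for p a r t k :: real
      using that by (simp add: distrib_left)
    ultimately have "4 * ((q x y)\<^sup>2 + (m x)\<^sup>2 + (m y)\<^sup>2 + c\<^sup>2) \<le> 4 * (q x y)\<^sup>2 + 12 * K\<^sup>2" by blast
    with four[of "q x y" "m x" "m y" c] show ?thesis unfolding u_def by (rule order_trans)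
  qed
  have uint: "integrable M (\<lambda>y. (u x y)\<^sup>2)" and ule: "(\<integral>y. (u x y)\<^sup>2 \<partial>M) \<le> R" if x: "x \<in> space M" for x
  proof -
    note [measurable] = qx[OF x]
    have i: "integrable M (\<lambda>y. 4 * (q x y)\<^sup>2 + 12 * K\<^sup>2)" using sq[OF x] by simp
    show i2: "integrable M (\<lambda>y. (u x y)\<^sup>2)"
      by (rule Bochner_Integration.integrable_bound[OF i]) (use usq in \<open>auto simp: u_def intro: order_trans\<close>)
    have "(\<integral>y. (u x y)\<^sup>2 \<partial>M) \<le> (\<integral>y. 4 * (q x y)\<^sup>2 + 12 * K\<^sup>2 \<partial>M)" by (intro integral_mono i i2 usq)
    also have "\<dots> \<le> 4 * D + 12 * K\<^sup>2" using sq[OF x] sq_le[OF x] by (simp add: prob_space)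
    also have "\<dots> \<le> R" using K0 by (simp add: R_def)
    finally show "(\<integral>y. (u x y)\<^sup>2 \<partial>M) \<le> R" .
  qed
  define w where "w x y = u x y / R" for x y
  interpret centered_kernel M w
  proof
    show "case_prod w \<in> borel_measurable (M \<Otimes>\<^sub>M M)" unfolding w_def u_def by measurable
    show "w x y = w y x" for x y using sym[of x y] by (simp add: w_def u_def)
    show "w x y \<le> 1" for x y
    proof -
      have "u x y \<le> \<bar>B\<bar> + K + K + K"
        unfolding u_def using upper[of x y] mK[of x] mK[of y] cK by linarith
      also have "\<dots> \<le> R" using D0 by (simp add: R_def)
      finally show ?thesis using R1 by (simp add: w_def)
    qed
    fix x assume x: "x \<in> space M"
    show "integrable M (\<lambda>y. (w x y)\<^sup>2)" using uint[OF x] by (simp add: w_def power_divide)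
    have "R \<le> R * R" using mult_left_mono[OF R1, of R] R1 by simp
    then show "(\<integral>y. (w x y)\<^sup>2 \<partial>M) \<le> 1"
      using order_trans[OF ule[OF x]] R1 by (simp add: w_def power_divide power2_eq_square)
    have "(\<integral>y. u x y \<partial>M) = m x - m x - c + c"
      unfolding u_def using int[OF x] mint x by (simp add: prob_space cm) (simp add: m_def)
    then show "(\<integral>y. w x y \<partial>M) = 0" by (simp add: w_def)
  qed
  show ?thesis
  proof (rule exI[of _ "1 / (20 * R)"], intro conjI exI[of _ "exp (1 + 3 * K)"] allI impI)
    show "0 < 1 / (20 * R)" using R1 by simp
    fix N :: nat assume N: "N \<ge> 1"
    have "exp (1 / (20 * R) * ustat N M q X) \<le> exp (3 * K) * exp (1 / (20 * real N) * offdiag_sum N (\<lambda>i j. w (X i) (X j)))"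
      if X: "X \<in> space (tensor_power N M)" for X
    proof -
      let ?P = "\<Sum>i<N. \<Sum>j\<in>{..<N} - {i}. w (X i) (X j)"
      have "X i \<in> space M" if "i < N" for i using X that by (auto simp: space_PiM)
      then have "ustat N M q X = 1 / real N * offdiag_sum N (\<lambda>i j. u (X i) (X j)) - 2 / real N * (\<Sum>i<N. m (X i)) + c"
        unfolding u_def by (intro ustat_centered N c_def) (simp add: m_def)
      also have "offdiag_sum N (\<lambda>i j. u (X i) (X j)) = R * ?P"
        using R1 by (simp add: w_def sum_distrib_left)
      finally have eq: "ustat N M q X = R * (1 / real N * ?P) + (c - 2 / real N * (\<Sum>i<N. m (X i)))" by (simp add: algebra_simps)
      have "\<bar>\<Sum>i<N. m (X i)\<bar> \<le> real N * K"
        by (rule order_trans[OF sum_abs]) (use sum_mono[of "{..<N}" "\<lambda>i. \<bar>m (X i)\<bar>" "\<lambda>_. K"] mK in simp)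
      then have "\<bar>2 / real N * (\<Sum>i<N. m (X i))\<bar> \<le> 2 * K" using N by (simp add: abs_mult field_simps)
      then have rest: "c - 2 / real N * (\<Sum>i<N. m (X i)) \<le> 3 * K" using cK by linarith
      have "1 / (20 * R) * ustat N M q X = 1 / (20 * real N) * ?P + 1 / (20 * R) * (c - 2 / real N * (\<Sum>i<N. m (X i)))"
        unfolding eq distrib_left using R1 by simp
      also have "1 / (20 * R) * (c - 2 / real N * (\<Sum>i<N. m (X i))) \<le> 1 / (20 * R) * (3 * K)"
        using rest R1 by (intro mult_left_mono) auto
      also have "\<dots> \<le> 1 * (3 * K)" using R1 K0 by (intro mult_right_mono) auto
      finally show ?thesis by (simp flip: exp_add)
    qed
    then have "exp_moment (tensor_power N M) (\<lambda>X. 1 / (20 * R) * ustat N M q X)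
      \<le> (\<integral>\<^sup>+X. ennreal (exp (3 * K)) * ennreal (exp (1 / (20 * real N) * offdiag_sum N (\<lambda>i j. w (X i) (X j)))) \<partial>tensor_power N M)"
      by (intro nn_integral_mono) (simp add: ennreal_leI flip: ennreal_mult)
    also have "\<dots> = ennreal (exp (3 * K)) * exp_moment (tensor_power N M) (\<lambda>X. 1 / (20 * real N) * offdiag_sum N (\<lambda>i j. w (X i) (X j)))"
      by (rule nn_integral_cmult) measurable
    also have "\<dots> \<le> ennreal (exp (3 * K)) * ennreal (exp 1)"
      by (intro mult_left_mono nn_integral_exp_offdiag_sum_le N) auto
    also have "\<dots> = ennreal (exp (1 + 3 * K))" by (simp only: ennreal_mult[symmetric] exp_ge_zero exp_add[symmetric] add.commute)
    finally show "exp_moment (tensor_power N M) (\<lambda>X. 1 / (20 * R) * ustat N M q X) \<le> ennreal (exp (1 + 3 * K))" .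
  qed
qed

section \<open>The Riesz kernel and its derivatives\<close>

text \<open>Linear combinations of powers of the norm times products of linear forms, all of
  homogeneity degree \<open>q\<close>. This class gives growth bounds and measurability of the
  derivatives of g without a closed formula for them.\<close>

inductive homog :: "real \<Rightarrow> ('a::euclidean_space \<Rightarrow> real) \<Rightarrow> bool" where
  powr: "homog q (\<lambda>z. norm z powr q)"
| mult: "homog q f \<Longrightarrow> homog (q + 1) (\<lambda>z. (z \<bullet> u) * f z)"
| add: "homog q f \<Longrightarrow> homog q g \<Longrightarrow> homog q (\<lambda>z. f z + g z)"
| scale: "homog q f \<Longrightarrow> homog q (\<lambda>z. c * f z)"

lemma homog_bound:
  assumes "homog q f"
  shows "\<exists>C\<ge>0. \<forall>z. z \<noteq> 0 \<longrightarrow> \<bar>f z\<bar> \<le> C * norm z powr q"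
  using assms
proof induction
  case (powr q)
  show ?case by (rule exI[of _ 1]) simp
next
  case (mult q f u)
  then obtain C where C: "C \<ge> 0" "\<And>z. z \<noteq> 0 \<Longrightarrow> \<bar>f z\<bar> \<le> C * norm z powr q" by blast
  show ?case
  proof (intro exI[of _ "norm u * C"] conjI allI impI)
    fix z :: 'a assume z: "z \<noteq> 0"
    have "\<bar>z \<bullet> u\<bar> * \<bar>f z\<bar> \<le> (norm z * norm u) * (C * norm z powr q)"
      using C z by (intro mult_mono Cauchy_Schwarz_ineq2) auto
    then show "\<bar>(z \<bullet> u) * f z\<bar> \<le> norm u * C * norm z powr (q + 1)"
      using z by (simp add: abs_mult powr_add mult_ac)
  qed (use C in simp)
next
  case (add q f g)
  then obtain C D where C: "C \<ge> 0" "\<And>z. z \<noteq> 0 \<Longrightarrow> \<bar>f z\<bar> \<le> C * norm z powr q"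
    and D: "D \<ge> 0" "\<And>z. z \<noteq> 0 \<Longrightarrow> \<bar>g z\<bar> \<le> D * norm z powr q" by blast
  show ?case
  proof (intro exI[of _ "C + D"] conjI allI impI)
    fix z :: 'a assume "z \<noteq> 0"
    then show "\<bar>f z + g z\<bar> \<le> (C + D) * norm z powr q"
      using C(2)[of z] D(2)[of z] unfolding distrib_right by linarith
  qed (use C D in simp)
next
  case (scale q f c)
  then obtain C where C: "C \<ge> 0" "\<And>z. z \<noteq> 0 \<Longrightarrow> \<bar>f z\<bar> \<le> C * norm z powr q" by blast
  show ?case
  proof (intro exI[of _ "\<bar>c\<bar> * C"] conjI allI impI)
    fix z :: 'a assume "z \<noteq> 0"
    then show "\<bar>c * f z\<bar> \<le> \<bar>c\<bar> * C * norm z powr q"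
      using mult_left_mono[OF C(2), of z "\<bar>c\<bar>"] by (simp add: abs_mult mult.assoc)
  qed (use C in simp)
qed

lemma homog_measurable: "homog q f \<Longrightarrow> f \<in> borel_measurable borel"
  by (induction rule: homog.induct) (auto intro!: borel_measurable_times borel_measurable_add)

text \<open>The product rule keeps every generator inside the class and lowers the degree by 1; a
  power of the norm contributes q (z . b) |z|^(q-2).\<close>

lemma homog_derivative:
  assumes "homog q f"
  shows "\<exists>f'. homog (q - 1) f' \<and> (\<forall>z. z \<noteq> 0 \<longrightarrow> (\<exists>D. (f has_derivative D) (at z) \<and> D b = f' z))"
  using assms
proof induction
  case (powr q)
  have "homog (q - 2 + 1) (\<lambda>z. (z \<bullet> b) * norm z powr (q - 2))" by (intro homog.intros)
  then have "homog (q - 1) (\<lambda>z. q * ((z \<bullet> b) * norm z powr (q - 2)))" by (intro homog.scale) simp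
  moreover have "\<exists>D. ((\<lambda>z. norm z powr q) has_derivative D) (at z) \<and> D b = q * ((z \<bullet> b) * norm z powr (q - 2))"
    if z: "z \<noteq> 0" for z :: 'a
  proof -
    have "((\<lambda>z. norm z powr q) has_derivative (\<lambda>h. (norm z powr q) * (0 * ln (norm z) + (h \<bullet> sgn z) * q / norm z))) (at z)"
      by (rule has_derivative_powr[OF has_derivative_norm[OF z] has_derivative_const]) (use z in auto)
    moreover have "(norm z powr q) * (0 * ln (norm z) + (b \<bullet> sgn z) * q / norm z) = q * ((z \<bullet> b) * norm z powr (q - 2))"
      using z by (simp add: sgn_div_norm powr_diff inner_commute power2_eq_square field_simps)
    ultimately show ?thesis by blast
  qed
  ultimately show ?case by blast
next
  case (mult q f u)
  then obtain f' where f': "homog (q - 1) f'" "\<And>z. z \<noteq> 0 \<Longrightarrow> \<exists>D. (f has_derivative D) (at z) \<and> D b = f' z" by blast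
  have "homog q (\<lambda>z. (b \<bullet> u) * f z)" using mult(1) by (rule homog.scale)
  moreover have "homog (q - 1 + 1) (\<lambda>z. (z \<bullet> u) * f' z)" using f'(1) by (rule homog.mult)
  ultimately have h: "homog (q + 1 - 1) (\<lambda>z. (b \<bullet> u) * f z + (z \<bullet> u) * f' z)" by (intro homog.add) simp_all
  have "\<exists>D. ((\<lambda>z. (z \<bullet> u) * f z) has_derivative D) (at z) \<and> D b = (b \<bullet> u) * f z + (z \<bullet> u) * f' z" if z: "z \<noteq> 0" for z
  proof -
    obtain D where D: "(f has_derivative D) (at z)" "D b = f' z" using f'(2)[OF z] by blast
    have "((\<lambda>z. (z \<bullet> u) * f z) has_derivative (\<lambda>h. (z \<bullet> u) * D h + (h \<bullet> u) * f z)) (at z)"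
      by (intro has_derivative_mult has_derivative_inner_left D has_derivative_ident)
    then show ?thesis using D(2) by (auto simp: add.commute)
  qed
  with h show ?case by blast
next
  case (add q f g)
  then obtain f' g' where f': "homog (q - 1) f'" "\<And>z. z \<noteq> 0 \<Longrightarrow> \<exists>D. (f has_derivative D) (at z) \<and> D b = f' z"
    and g': "homog (q - 1) g'" "\<And>z. z \<noteq> 0 \<Longrightarrow> \<exists>D. (g has_derivative D) (at z) \<and> D b = g' z" by blast
  have "homog (q - 1) (\<lambda>z. f' z + g' z)" using f'(1) g'(1) by (rule homog.add)
  moreover have "\<exists>D. ((\<lambda>z. f z + g z) has_derivative D) (at z) \<and> D b = f' z + g' z" if z: "z \<noteq> 0" for z
  proof -
    obtain D E where "(f has_derivative D) (at z)" "D b = f' z" "(g has_derivative E) (at z)" "E b = g' z"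
      using f'(2)[OF z] g'(2)[OF z] by blast
    then show ?thesis by (intro exI[of _ "\<lambda>h. D h + E h"]) (auto intro: has_derivative_add)
  qed
  ultimately show ?case by blast
next
  case (scale q f c)
  then obtain f' where f': "homog (q - 1) f'" "\<And>z. z \<noteq> 0 \<Longrightarrow> \<exists>D. (f has_derivative D) (at z) \<and> D b = f' z" by blast
  have "homog (q - 1) (\<lambda>z. c * f' z)" using f'(1) by (rule homog.scale)
  moreover have "\<exists>D. ((\<lambda>z. c * f z) has_derivative D) (at z) \<and> D b = c * f' z" if z: "z \<noteq> 0" for z
  proof -
    obtain D where "(f has_derivative D) (at z)" "D b = f' z" using f'(2)[OF z] by blast
    then show ?thesis by (intro exI[of _ "\<lambda>h. c * D h"]) (auto intro: has_derivative_mult_right)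
  qed
  ultimately show ?case by blast
qed

text \<open>Differentiation is local and the complement of the origin is open, so agreement with
  \<open>f\<close> there determines the derivatives there. The iterated derivatives can thus be
  tracked through representatives in the class.\<close>

lemma homog_frechet_derivative:
  fixes F :: "'a::euclidean_space \<Rightarrow> real"
  assumes "homog q f" and eq: "\<And>z. z \<noteq> 0 \<Longrightarrow> F z = f z"
  shows "\<exists>f'. homog (q - 1) f' \<and> (\<forall>z. z \<noteq> 0 \<longrightarrow> frechet_derivative F (at z) b = f' z)"
proof -
  obtain f' where f': "homog (q - 1) f'" "\<And>z. z \<noteq> 0 \<Longrightarrow> \<exists>D. (f has_derivative D) (at z) \<and> D b = f' z"
    using homog_derivative[OF assms(1)] by blast
  have "frechet_derivative F (at z) b = f' z" if z: "z \<noteq> 0" for z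
  proof -
    obtain D where D: "(f has_derivative D) (at z)" "D b = f' z" using f'(2)[OF z] by blast
    have "(F has_derivative D) (at z)"
      by (rule has_derivative_transform_within_open[OF D(1), of "- {0}"]) (use z eq in auto)
    then show ?thesis using D(2) frechet_derivative_at by metis
  qed
  with f'(1) show ?thesis by blast
qed

text \<open>The induction starts at one derivative because the logarithm itself is not homogeneous,
  whereas its first derivatives are, of degree -1.\<close>

lemma iter_partial_riesz_homog:
  fixes s :: real
  assumes "bs \<noteq> []"
  shows "\<exists>f. homog (- s - length bs) f \<and> (\<forall>z::'a::euclidean_space. z \<noteq> 0 \<longrightarrow> iter_partial bs (riesz s) z = f z)"
  using assms
proof (induction bs rule: list_nonempty_induct)
  case (single b)
  show ?case
  proof (cases "s = 0")
    case True
    have "homog (-2 + 1) (\<lambda>z::'a. (z \<bullet> b) * norm z powr (-2))" by (intro homog.intros)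
    then have "homog (- s - length [b]) (\<lambda>z::'a. (-1) * ((z \<bullet> b) * norm z powr (-2)))" using True by (intro homog.scale) simp
    moreover have "iter_partial [b] (riesz s) z = (-1) * ((z \<bullet> b) * norm z powr (-2))" if z: "z \<noteq> 0" for z :: 'a
    proof -
      have "((\<lambda>z::'a. - ln (norm z)) has_derivative (\<lambda>h. - ((h \<bullet> sgn z) * inverse (norm z)))) (at z)"
        using z by (auto intro!: derivative_eq_intros has_derivative_norm simp: field_simps)
      then have "(riesz s has_derivative (\<lambda>h. - ((h \<bullet> sgn z) * inverse (norm z)))) (at z)"
        using True by (simp add: riesz_def[abs_def])
      from frechet_derivative_at[OF this, symmetric] show ?thesis
        using z by (simp add: sgn_div_norm inner_commute powr_minus power2_eq_square field_simps)
    qed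
    ultimately show ?thesis by blast
  next
    case False
    have "homog (- s) (\<lambda>z::'a. (1 / s) * norm z powr (- s))" by (intro homog.intros)
    moreover have "riesz s z = (1 / s) * norm z powr (- s)" for z :: 'a using False by (simp add: riesz_def)
    ultimately have "\<exists>f'. homog (- s - 1) f' \<and> (\<forall>z::'a. z \<noteq> 0 \<longrightarrow> frechet_derivative (riesz s) (at z) b = f' z)"
      by (intro homog_frechet_derivative)
    then show ?thesis by simp
  qed
next
  case (cons b bs)
  then obtain f where "homog (- s - length bs) f" "\<And>z::'a. z \<noteq> 0 \<Longrightarrow> iter_partial bs (riesz s) z = f z" by blast
  from homog_frechet_derivative[OF this, of b] show ?case by (simp add: algebra_simps)
qed

text \<open>Derivatives of order n have degree -s - n, which gives the growth bound. Measurability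
  has to cope with the unspecified derivatives at the origin: on the diagonal they are multiplied by
  a nonempty product of entries of v x - v x = 0, so there too the kernel agrees with the measurable
  expression built from the representatives.\<close>

lemma grad_contract_riesz:
  fixes s :: real
  assumes n: "n \<ge> 1"
  shows "\<exists>C>0. \<forall>z w::'a::euclidean_space. z \<noteq> 0 \<longrightarrow> \<bar>grad_contract n (riesz s) z w\<bar> \<le> C * norm z powr (- s - n) * norm w ^ n"
    and "\<And>v :: 'a \<Rightarrow> 'a. v \<in> borel_measurable borel \<Longrightarrow>
      (\<lambda>(x, y). grad_contract n (riesz s) (x - y) (v x - v y)) \<in> borel_measurable (borel \<Otimes>\<^sub>M borel)"
    and "grad_contract n (riesz s) z (0::'a) = 0"
proof -
  let ?L = "{bs::'a list. length bs = n \<and> set bs \<subseteq> Basis}"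
  have fin: "finite ?L" using finite_lists_length_eq[OF finite_Basis] by (simp add: conj_commute)
  have "\<forall>bs\<in>?L. \<exists>f. homog (- s - n) f \<and> (\<forall>z. z \<noteq> 0 \<longrightarrow> iter_partial bs (riesz s) z = f z)"
  proof
    fix bs assume "bs \<in> ?L"
    then have len: "length bs = n" and "bs \<noteq> []" using n by auto
    from iter_partial_riesz_homog[OF this(2), of s] show "\<exists>f. homog (- s - n) f \<and> (\<forall>z. z \<noteq> 0 \<longrightarrow> iter_partial bs (riesz s) z = f z)"
      unfolding len .
  qed
  from bchoice[OF this] obtain f where "\<forall>bs\<in>?L. homog (- s - n) (f bs) \<and> (\<forall>z. z \<noteq> 0 \<longrightarrow> iter_partial bs (riesz s) z = f bs z)" ..
  then have f: "\<And>bs. bs \<in> ?L \<Longrightarrow> homog (- s - n) (f bs)"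
    "\<And>bs z. bs \<in> ?L \<Longrightarrow> z \<noteq> 0 \<Longrightarrow> iter_partial bs (riesz s) z = f bs z" by simp_all
  have "\<forall>bs\<in>?L. \<exists>C\<ge>0. \<forall>z. z \<noteq> 0 \<longrightarrow> \<bar>f bs z\<bar> \<le> C * norm z powr (- s - n)" using homog_bound f(1) by blast
  from bchoice[OF this] obtain C where "\<forall>bs\<in>?L. C bs \<ge> 0 \<and> (\<forall>z. z \<noteq> 0 \<longrightarrow> \<bar>f bs z\<bar> \<le> C bs * norm z powr (- s - n))" ..
  then have C: "\<And>bs. bs \<in> ?L \<Longrightarrow> C bs \<ge> 0" "\<And>bs z. bs \<in> ?L \<Longrightarrow> z \<noteq> 0 \<Longrightarrow> \<bar>f bs z\<bar> \<le> C bs * norm z powr (- s - n)" by simp_all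
  have prod: "\<bar>\<Prod>b\<leftarrow>bs. w \<bullet> b\<bar> \<le> norm w ^ length bs" if "set bs \<subseteq> Basis" for bs and w :: 'a
    using that
  proof (induction bs)
    case (Cons b bs)
    have "\<bar>w \<bullet> b\<bar> * \<bar>\<Prod>b\<leftarrow>bs. w \<bullet> b\<bar> \<le> norm w * norm w ^ length bs"
      using Cons by (intro mult_mono) (auto intro: Basis_le_norm)
    then show ?case by (simp add: abs_mult)
  qed simp
  show "\<exists>C>0. \<forall>z w::'a. z \<noteq> 0 \<longrightarrow> \<bar>grad_contract n (riesz s) z w\<bar> \<le> C * norm z powr (- s - n) * norm w ^ n"
  proof (intro exI[of _ "sum C ?L + 1"] conjI allI impI)
    have "sum C ?L \<ge> 0" using C(1) by (intro sum_nonneg) auto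
    then show "sum C ?L + 1 > 0" by simp
    fix z w :: 'a assume z: "z \<noteq> 0"
    have "\<bar>grad_contract n (riesz s) z w\<bar> \<le> (\<Sum>bs\<in>?L. \<bar>iter_partial bs (riesz s) z * (\<Prod>b\<leftarrow>bs. w \<bullet> b)\<bar>)"
      unfolding grad_contract_def by (rule sum_abs)
    also have "\<dots> \<le> (\<Sum>bs\<in>?L. C bs * norm z powr (- s - n) * norm w ^ n)"
    proof (rule sum_mono)
      fix bs assume bs: "bs \<in> ?L"
      show "\<bar>iter_partial bs (riesz s) z * (\<Prod>b\<leftarrow>bs. w \<bullet> b)\<bar> \<le> C bs * norm z powr (- s - n) * norm w ^ n"
        unfolding abs_mult using C[OF bs] f(2)[OF bs z] z prod[of bs w] bs by (intro mult_mono) auto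
    qed
    also have "\<dots> = sum C ?L * (norm z powr (- s - n) * norm w ^ n)" by (simp add: sum_distrib_right mult.assoc)
    also have "\<dots> \<le> (sum C ?L + 1) * (norm z powr (- s - n) * norm w ^ n)" by (intro mult_right_mono) auto
    finally show "\<bar>grad_contract n (riesz s) z w\<bar> \<le> (sum C ?L + 1) * norm z powr (- s - n) * norm w ^ n" by (simp add: mult.assoc)
  qed
  have zero: "(\<Prod>b\<leftarrow>bs. (0::'a) \<bullet> b) = 0" if "bs \<in> ?L" for bs
    using that n by (cases bs) auto
  show z0: "grad_contract n (riesz s) z (0::'a) = 0" for z
    unfolding grad_contract_def by (intro sum.neutral ballI) (simp only: zero mult_zero_right)
  fix v :: "'a \<Rightarrow> 'a" assume v[measurable]: "v \<in> borel_measurable borel"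
  have "(\<lambda>(x, y). grad_contract n (riesz s) (x - y) (v x - v y)) =
    (\<lambda>(x, y). \<Sum>bs\<in>?L. f bs (x - y) * (\<Prod>b\<leftarrow>bs. (v x - v y) \<bullet> b))"
  proof (clarsimp simp: fun_eq_iff)
    fix x y :: 'a
    show "grad_contract n (riesz s) (x - y) (v x - v y) = (\<Sum>bs\<in>?L. f bs (x - y) * (\<Prod>b\<leftarrow>bs. (v x - v y) \<bullet> b))"
    proof (cases "x = y")
      case True
      have "(\<Sum>bs\<in>?L. f bs (x - y) * (\<Prod>b\<leftarrow>bs. (v x - v y) \<bullet> b)) = 0"
        unfolding True diff_self by (intro sum.neutral ballI) (simp only: zero mult_zero_right)
      then show ?thesis using z0[of 0] True by simp
    next
      case False
      then show ?thesis unfolding grad_contract_def using f(2) by (intro sum.cong) auto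
    qed
  qed
  moreover have "(\<lambda>(x, y). \<Sum>bs\<in>?L. f bs (x - y) * (\<Prod>b\<leftarrow>bs. (v x - v y) \<bullet> b)) \<in> borel_measurable (borel \<Otimes>\<^sub>M borel)"
  proof -
    have [measurable]: "(\<lambda>(x::'a, y). \<Prod>b\<leftarrow>bs. (v x - v y) \<bullet> b) \<in> borel_measurable (borel \<Otimes>\<^sub>M borel)" for bs
      by (induction bs) auto
    have "(\<lambda>p::'a \<times> 'a. f bs (fst p - snd p)) \<in> borel_measurable (borel \<Otimes>\<^sub>M borel)" if "bs \<in> ?L" for bs
      by (rule measurable_compose[OF _ homog_measurable[OF f(1)[OF that]]]) measurable
    then show ?thesis
      unfolding split_beta' by (intro borel_measurable_sum borel_measurable_times) (auto simp: split_beta')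
  qed
  ultimately show "(\<lambda>(x, y). grad_contract n (riesz s) (x - y) (v x - v y)) \<in> borel_measurable (borel \<Otimes>\<^sub>M borel)" by simp
qed

section \<open>Integrability of the singular kernels\<close>

text \<open>The witness \<open>k\<close> is the index of the dyadic shell 2^-(k+1) < r \<le> 2^-k
  that contains \<open>r\<close>.\<close>

lemma powr_le_dyadic_sum:
  fixes r t :: real
  assumes r: "0 < r" "r \<le> 1" and t: "t \<ge> 0"
  shows "\<exists>k::nat. r \<le> (1/2) ^ k \<and> r powr (- t) \<le> 2 powr (t * (real k + 1))"
proof -
  have ex: "\<exists>k. (1/2::real) ^ k < r" using real_arch_pow_inv[of r "1/2"] r by auto
  define K where "K = (LEAST k. (1/2::real) ^ k < r)"
  have K: "(1/2::real) ^ K < r" unfolding K_def using ex by (rule LeastI_ex)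
  then have "K \<noteq> 0" using r by (intro notI) simp
  then obtain k where k: "K = Suc k" using not0_implies_Suc by blast
  then have le: "\<not> (1/2::real) ^ k < r" unfolding K_def by (metis lessI not_less_Least)
  have "r powr (- t) \<le> ((1/2) ^ Suc k) powr (- t)"
    using K k t r by (intro powr_mono2') auto
  also have "(1/2::real) ^ Suc k = inverse (2 powr real (Suc k))"
    by (subst powr_realpow) (simp_all add: power_one_over inverse_eq_divide)
  also have "\<dots> = 2 powr (- (real k + 1))" by (simp only: powr_minus[symmetric] of_nat_Suc add.commute)
  also have "(2 powr (- (real k + 1))) powr (- t) = 2 powr (t * (real k + 1))" by (simp add: powr_powr algebra_simps)
  finally show ?thesis using le by (intro exI[of _ k]) auto
qed

text \<open>The singularity is dominated by a weighted sum of indicators of dyadic balls, whose k-th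
  term integrates to \<open>a k\<close>. These numbers form a geometric series of ratio 2^(t-d),
  convergent since t < d, with a sum independent of the centre.\<close>

lemma nn_integral_powr_ball_le:
  fixes t :: real
  assumes t: "0 \<le> t" "t < real DIM('a::euclidean_space)"
  obtains C where "C \<ge> 0" "\<And>x::'a. (\<integral>\<^sup>+y. ennreal (norm (x - y) powr (- t)) * indicator (cball x 1) y \<partial>lborel) \<le> ennreal C"
proof -
  let ?d = "real DIM('a)"
  let ?V = "unit_ball_vol ?d"
  define a where "a = (\<lambda>k::nat. 2 powr (t * (real k + 1)) * (?V * ((1/2) ^ k) ^ DIM('a)))"
  have V: "?V \<ge> 0" using unit_ball_vol_nonneg[of ?d] by simp
  have a0: "a k \<ge> 0" for k using V by (simp add: a_def)
  have aeq: "a k = (2 powr t * ?V) * (2 powr (t - ?d)) ^ k" for k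
  proof -
    have "((1/2::real) ^ k) ^ DIM('a) = 2 powr (- ?d * k)"
      by (simp add: powr_minus powr_realpow[symmetric] power_one_over powr_powr inverse_eq_divide mult.commute flip: power_mult)
    then have "a k = ?V * (2 powr (t * (real k + 1)) * 2 powr (- ?d * k))" by (simp add: a_def)
    also have "2 powr (t * (real k + 1)) * 2 powr (- ?d * k) = 2 powr t * (2 powr (t - ?d)) ^ k"
      by (simp add: powr_powr powr_realpow[symmetric] algebra_simps flip: powr_add)
    finally show ?thesis by simp
  qed
  have "norm (2 powr (t - ?d)) < 1" using t powr_less_mono[of "t - ?d" 0 2] by simp
  then have "summable (\<lambda>k. (2 powr (t - ?d)) ^ k)" by (rule summable_geometric)
  then have sum: "summable a" unfolding aeq[abs_def] by (rule summable_mult)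
  show thesis
  proof
    show "suminf a \<ge> 0" using sum a0 by (rule suminf_nonneg)
    fix x :: 'a
    let ?S = "\<lambda>k. cball x ((1/2) ^ k)"
    let ?p = "\<lambda>y. ennreal (norm (x - y) powr (- t)) * indicator (cball x 1) y" and ?q = "\<lambda>k y. ennreal (2 powr (t * (real k + 1))) * indicator (?S k) y"
    have "(\<integral>\<^sup>+y. ?p y \<partial>lborel)
      \<le> (\<integral>\<^sup>+y. (\<Sum>k. ?q k y) \<partial>lborel)"
    proof (rule nn_integral_mono)
      fix y :: 'a
      show "?p y \<le> (\<Sum>k. ?q k y)"
      \<comment> \<open>At y = x the integrand is 0, since \<open>0 powr (- t) = 0\<close>.\<close>
      proof (cases "y \<in> cball x 1 \<and> x \<noteq> y")
        case True
        have n0: "0 < norm (x - y)" using True by simp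
        have n1: "norm (x - y) \<le> 1" using True by (simp add: dist_norm)
        from powr_le_dyadic_sum[OF n0 n1 t(1)]
        obtain k where k: "norm (x - y) \<le> (1/2) ^ k \<and> norm (x - y) powr (- t) \<le> 2 powr (t * (real k + 1))" ..
        have "?p y \<le> ?q k y"
          using k True by (auto simp: dist_norm indicator_def intro!: ennreal_leI)
        also have "\<dots> \<le> (\<Sum>k. ?q k y)"
        proof -
          define h where "h = (\<lambda>k. ?q k y)"
          have "h k \<le> suminf h" using sum_le_suminf[of h "{k}"] by simp
          then show ?thesis by (simp only: h_def)
        qed
        finally show ?thesis .
      next
        case False
        then have "?p y = 0" by (auto simp: indicator_def)
        then show ?thesis by (simp only: zero_le)
      qed
    qed
    also have "\<dots> = (\<Sum>k. \<integral>\<^sup>+y. ?q k y \<partial>lborel)"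
    proof (rule nn_integral_suminf)
      fix k
      have [measurable]: "?S k \<in> sets lborel" by simp
      show "(\<lambda>y. ?q k y) \<in> borel_measurable lborel"
        by (intro borel_measurable_times_ennreal borel_measurable_const borel_measurable_indicator) fact
    qed
    also have "\<dots> = (\<Sum>k. ennreal (a k))"
    proof (intro suminf_cong)
      fix k
      have "(\<integral>\<^sup>+y. ?q k y \<partial>lborel) = ennreal (2 powr (t * (real k + 1))) * emeasure lborel (?S k)"
        by (rule nn_integral_cmult_indicator) simp
      also have "\<dots> = ennreal (a k)" using V by (simp add: emeasure_cball a_def ennreal_mult)
      finally show "(\<integral>\<^sup>+y. ?q k y \<partial>lborel) = ennreal (a k)" .
    qed
    also have "\<dots> = ennreal (suminf a)" using a0 sum by (rule suminf_ennreal2)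
    finally show "(\<integral>\<^sup>+y. ?p y \<partial>lborel) \<le> ennreal (suminf a)" .
  qed
qed

text \<open>In the unit ball around \<open>x\<close> the density is replaced by its bound; outside,
  the power is at most 1 and contributes at most the total mass.\<close>

lemma bounded_density_powr_bound:
  fixes \<mu> :: "'a::euclidean_space measure" and t :: real
  assumes \<mu>: "bounded_density_prob \<mu>" and t: "0 \<le> t" "t < real DIM('a)"
  obtains C where "C \<ge> 0" "\<And>x::'a. (\<integral>\<^sup>+y. ennreal (norm (x - y) powr (- t)) \<partial>\<mu>) \<le> ennreal C"
proof -
  from \<mu> obtain \<rho> B where \<rho>[measurable]: "\<rho> \<in> borel_measurable lborel"
    and B: "AE x in lborel. 0 \<le> \<rho> x \<and> \<rho> x \<le> B" and \<mu>eq: "\<mu> = density lborel (\<lambda>x. ennreal (\<rho> x))" and p: "prob_space \<mu>"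
    unfolding bounded_density_prob_def by blast
  interpret prob_space \<mu> by fact
  obtain C where C: "C \<ge> 0" "\<And>x::'a. (\<integral>\<^sup>+y. ennreal (norm (x - y) powr (- t)) * indicator (cball x 1) y \<partial>lborel) \<le> ennreal C"
    using nn_integral_powr_ball_le[OF t] by blast
  have sets[measurable_cong, simp]: "sets \<mu> = sets borel" by (simp add: \<mu>eq)
  have [measurable]: "cball x 1 \<in> sets borel" for x :: 'a by simp
  show thesis
  proof
    show "\<bar>B\<bar> * C + 1 \<ge> 0" using C by simp
    fix x :: 'a
    let ?p = "\<lambda>y. ennreal (norm (x - y) powr (- t)) * indicator (cball x 1) y"
    have "(\<integral>\<^sup>+y. ennreal (norm (x - y) powr (- t)) \<partial>\<mu>)
      \<le> (\<integral>\<^sup>+y. ?p y + 1 \<partial>\<mu>)"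
    proof (rule nn_integral_mono)
      fix y :: 'a
      show "ennreal (norm (x - y) powr (- t)) \<le> ?p y + 1"
      proof (cases "y \<in> cball x 1")
        case False
        then have "norm (x - y) powr (- t) \<le> 1" using t by (simp add: dist_norm powr_minus inverse_le_1_iff ge_one_powr_ge_zero)
        then show ?thesis using False by simp
      qed (simp add: add_increasing2)
    qed
    also have "\<dots> = (\<integral>\<^sup>+y. ?p y \<partial>\<mu>) + 1"
      by (subst nn_integral_add) (simp_all add: emeasure_space_1)
    also have "(\<integral>\<^sup>+y. ?p y \<partial>\<mu>)
      = (\<integral>\<^sup>+y. ennreal (\<rho> y) * (?p y) \<partial>lborel)"
      unfolding \<mu>eq by (rule nn_integral_density) measurable
    also have "\<dots> \<le> (\<integral>\<^sup>+y. ennreal \<bar>B\<bar> * (?p y) \<partial>lborel)"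
      by (rule nn_integral_mono_AE) (use B in \<open>eventually_elim, auto intro!: mult_right_mono ennreal_leI\<close>)
    also have "\<dots> = ennreal \<bar>B\<bar> * (\<integral>\<^sup>+y. ?p y \<partial>lborel)"
      by (rule nn_integral_cmult) measurable
    also have "\<dots> \<le> ennreal \<bar>B\<bar> * ennreal C" by (intro mult_left_mono C) auto
    finally show "(\<integral>\<^sup>+y. ennreal (norm (x - y) powr (- t)) \<partial>\<mu>) \<le> ennreal (\<bar>B\<bar> * C + 1)"
      using C(1) by (simp add: ennreal_mult)
  qed
qed

section \<open>Exponential moments and relative entropy\<close>

text \<open>Jensen's inequality, integrated from the tangent of exp at the mean of
  \<open>f\<close>.\<close>

lemma nn_integral_exp_ge_exp_integral:
  assumes "prob_space P" and f: "integrable P f"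
  shows "ennreal (exp (\<integral>x. f x \<partial>P)) \<le> exp_moment P f"
proof (cases "exp_moment P f = \<infinity>")
  case False
  interpret prob_space P by fact
  have [measurable]: "f \<in> borel_measurable P" using f by auto
  have i: "integrable P (\<lambda>x. exp (f x))"
    using False by (intro integrableI_nonneg) (auto simp: less_top)
  let ?m = "\<integral>x. f x \<partial>P"
  have "exp ?m = (\<integral>x. exp ?m * (1 + (f x - ?m)) \<partial>P)" using f by (simp add: prob_space)
  also have "\<dots> \<le> (\<integral>x. exp (f x) \<partial>P)"
  proof (rule integral_mono)
    fix x
    have "exp ?m * (1 + (f x - ?m)) \<le> exp ?m * exp (f x - ?m)" by (intro mult_left_mono exp_ge_add_one_self) auto
    then show "exp ?m * (1 + (f x - ?m)) \<le> exp (f x)" by (simp flip: exp_add)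
  qed (use f i in auto)
  finally show ?thesis using i by (simp add: nn_integral_eq_integral ennreal_leI)
qed simp

text \<open>Hoelder's inequality against the constant 1. The convexity bound exp (t a) \<le> t exp a
  + 1 - t is applied to a = f - ln M, whose exponential moment is at most 1.\<close>

lemma nn_integral_exp_scale:
  assumes "prob_space P" and [measurable]: "f \<in> borel_measurable P"
    and le: "exp_moment P f \<le> ennreal M" and M: "M > 0" and t: "0 \<le> t" "t \<le> 1"
  shows "exp_moment P (\<lambda>x. t * f x) \<le> ennreal (M powr t)"
proof -
  interpret prob_space P by fact
  have conv: "exp (t * a) \<le> t * exp a + (1 - t)" for a :: real
  proof -
    \<comment> \<open>The bracket equals 1: the linear terms of the two weighted tangents
      cancel.\<close>
    have "exp (t * a) = exp (t * a) * (t * (1 + (1 - t) * a) + (1 - t) * (1 + - t * a))" by (simp add: algebra_simps)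
    also have "\<dots> \<le> exp (t * a) * (t * exp ((1 - t) * a) + (1 - t) * exp (- t * a))"
      using t by (intro mult_left_mono add_mono exp_ge_add_one_self) auto
    also have "\<dots> = t * exp (t * a + (1 - t) * a) + (1 - t) * exp (t * a + - t * a)"
      by (simp only: exp_add distrib_left mult_ac)
    also have "\<dots> = t * exp a + (1 - t)" by (simp add: algebra_simps)
    finally show ?thesis .
  qed
  have "exp_moment P (\<lambda>x. t * f x) \<le> (\<integral>\<^sup>+x. ennreal (M powr t) * (ennreal (t / M) * ennreal (exp (f x)) + ennreal (1 - t)) \<partial>P)"
  proof (rule nn_integral_mono)
    fix x
    have "exp (t * f x) = M powr t * exp (t * (f x - ln M))"
      using M by (simp add: powr_def right_diff_distrib flip: exp_add)
    also have "\<dots> \<le> M powr t * (t * exp (f x - ln M) + (1 - t))" by (intro mult_left_mono conv) auto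
    also have "exp (f x - ln M) = exp (f x) / M" using M by (simp add: exp_diff)
    finally have "exp (t * f x) \<le> M powr t * (t / M * exp (f x) + (1 - t))" by simp
    then show "ennreal (exp (t * f x)) \<le> ennreal (M powr t) * (ennreal (t / M) * ennreal (exp (f x)) + ennreal (1 - t))"
      using t M by (subst ennreal_mult[symmetric], simp, simp, subst ennreal_plus[symmetric], simp, simp, subst ennreal_mult[symmetric]) (auto intro!: ennreal_leI)
  qed
  also have "\<dots> = ennreal (M powr t) * (ennreal (t / M) * exp_moment P f + ennreal (1 - t))"
    by (subst nn_integral_cmult, measurable) (subst nn_integral_add, auto simp: nn_integral_cmult emeasure_space_1)
  also have "\<dots> \<le> ennreal (M powr t) * (ennreal (t / M) * ennreal M + ennreal (1 - t))"
    by (intro mult_left_mono add_mono le) auto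
  also have "\<dots> = ennreal (M powr t)"
  proof -
    have "ennreal (t / M) * ennreal M + ennreal (1 - t) = ennreal (t / M * M + (1 - t))"
      using t M by (subst ennreal_mult[symmetric], simp, simp, subst ennreal_plus[symmetric]) auto
    also have "\<dots> = 1" using M by simp
    finally show ?thesis by simp
  qed
  finally show ?thesis .
qed

lemma ennreal_linear_combination:
  "0 \<le> p \<Longrightarrow> 0 \<le> q \<Longrightarrow> 0 \<le> a \<Longrightarrow> 0 \<le> b \<Longrightarrow>
    ennreal (p * a + q * b) = ennreal p * ennreal a + ennreal q * ennreal b"
  by (simp add: ennreal_mult)

text \<open>Normalising the two factors by sqrt A and sqrt B before using 2 a b \<le> a^2 + b^2
  makes both halves contribute equally, so that the product of the square roots comes out.\<close>

lemma nn_integral_exp_Cauchy_Schwarz: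
  assumes [measurable]: "f \<in> borel_measurable P" "g \<in> borel_measurable P"
    and A: "exp_moment P f \<le> ennreal A" "A > 0"
    and B: "exp_moment P g \<le> ennreal B" "B > 0"
  shows "exp_moment P (\<lambda>x. (f x + g x) / 2) \<le> ennreal (sqrt A * sqrt B)"
proof -
  let ?c = "sqrt A * sqrt B / 2"
  have c: "?c \<ge> 0" using A B by simp
  have "exp_moment P (\<lambda>x. (f x + g x) / 2) \<le> (\<integral>\<^sup>+x. ennreal (?c / A) * ennreal (exp (f x)) + ennreal (?c / B) * ennreal (exp (g x)) \<partial>P)"
  proof (rule nn_integral_mono)
    fix x
    let ?a = "exp (f x / 2) / sqrt A" and ?b = "exp (g x / 2) / sqrt B"
    have "exp ((f x + g x) / 2) = 2 * ?c * (?a * ?b)"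
      using A B by (simp add: add_divide_distrib exp_add)
    also have "2 * (?a * ?b) \<le> ?a\<^sup>2 + ?b\<^sup>2" using sum_squares_bound[of ?a ?b] by simp
    then have "?c * (2 * (?a * ?b)) \<le> ?c * (?a\<^sup>2 + ?b\<^sup>2)" using c by (rule mult_left_mono)
    then have "2 * ?c * (?a * ?b) \<le> ?c * (?a\<^sup>2 + ?b\<^sup>2)" by (simp only: mult_ac)
    also have "?a\<^sup>2 + ?b\<^sup>2 = exp (f x) / A + exp (g x) / B"
      using A B by (simp add: power_divide flip: exp_double)
    finally have le: "exp ((f x + g x) / 2) \<le> ?c / A * exp (f x) + ?c / B * exp (g x)" by (simp add: distrib_left)
    have "ennreal (?c / A * exp (f x) + ?c / B * exp (g x)) = ennreal (?c / A) * ennreal (exp (f x)) + ennreal (?c / B) * ennreal (exp (g x))"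
      using A B c by (intro ennreal_linear_combination) auto
    then show "ennreal (exp ((f x + g x) / 2)) \<le> ennreal (?c / A) * ennreal (exp (f x)) + ennreal (?c / B) * ennreal (exp (g x))"
      using ennreal_leI[OF le] by (simp only:)
  qed
  also have "\<dots> = ennreal (?c / A) * exp_moment P f + ennreal (?c / B) * exp_moment P g"
    by (subst nn_integral_add) (simp_all add: nn_integral_cmult)
  also have "\<dots> \<le> ennreal (?c / A) * ennreal A + ennreal (?c / B) * ennreal B"
    by (intro add_mono mult_left_mono A B) auto
  also have "\<dots> = ennreal (sqrt A * sqrt B)"
    using A B c by (subst ennreal_linear_combination[symmetric]) auto
  finally show ?thesis .
qed

text \<open>Trades an uncontrolled constant for a smaller range of \<beta>: with t = \<beta> / b the
  moment is at most M^t, which is at most e once \<beta> \<le> b / ln M. All dependence on the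
  constant is moved to the threshold.\<close>

lemma exp_moment_small_temperature:
  fixes Y :: "nat \<Rightarrow> 'b \<Rightarrow> real"
  assumes P: "\<And>N. N \<ge> 1 \<Longrightarrow> prob_space (P N)" and Y: "\<And>N. N \<ge> 1 \<Longrightarrow> Y N \<in> borel_measurable (P N)"
    and b: "b > 0" and C: "\<And>N. N \<ge> 1 \<Longrightarrow> exp_moment (P N) (\<lambda>x. b * Y N x) \<le> ennreal C"
  shows "\<exists>b'>0. \<forall>\<beta>. 0 < \<beta> \<longrightarrow> \<beta> \<le> b' \<longrightarrow> (\<forall>N\<ge>1. exp_moment (P N) (\<lambda>x. \<beta> * Y N x) \<le> ennreal (exp 1))"
proof -
  \<comment> \<open>The maximum with e gives ln M \<ge> 1, hence t \<le> 1 below.\<close>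
  define M where "M = max C (exp 1)"
  have M: "M \<ge> exp 1" "M > 0" by (simp_all add: M_def less_max_iff_disj)
  then have l: "ln M \<ge> 1" using ln_ge_iff[of M 1] by simp
  show ?thesis
  proof (intro exI[of _ "b / ln M"] conjI allI impI)
    show "b / ln M > 0" using b l by simp
    fix \<beta> N assume \<beta>: "0 < \<beta>" "\<beta> \<le> b / ln M" and N: "(1::nat) \<le> N"
    define t where "t = \<beta> / b"
    have tM: "t * ln M \<le> 1" using \<beta> b l by (simp add: t_def field_simps)
    have t: "0 \<le> t" using \<beta> b by (simp add: t_def)
    have "t * 1 \<le> t * ln M" using t l by (rule mult_left_mono[rotated])
    then have t1: "t \<le> 1" using tM by linarith
    have m: "(\<lambda>x. b * Y N x) \<in> borel_measurable (P N)" using Y[OF N] by measurable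
    have "exp_moment (P N) (\<lambda>x. b * Y N x) \<le> ennreal M"
      using C[OF N] by (rule order_trans) (simp add: M_def ennreal_leI)
    from nn_integral_exp_scale[OF P[OF N] m this M(2) t t1]
    have "exp_moment (P N) (\<lambda>x. \<beta> * Y N x) \<le> ennreal (M powr t)" using b by (simp add: t_def)
    also have "\<dots> \<le> ennreal (exp 1)" using tM M by (intro ennreal_leI) (simp add: powr_def)
    finally show "exp_moment (P N) (\<lambda>x. \<beta> * Y N x) \<le> ennreal (exp 1)" .
  qed
qed

text \<open>\<open>W\<close> is exp Y / B divided by the density of \<open>f\<close>, so its
  integral against \<open>f\<close> is at most 1; integrating ln W \<le> W - 1 gives the duality.
  The first conclusion follows from the same pointwise inequality before \<open>Y\<close> is known
  to be integrable, and is what later establishes integrability of the energy and of the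
  commutator.\<close>

lemma donsker_varadhan:
  fixes f m :: "'b measure"
  assumes m: "prob_space m" and f: "prob_space f" and sets: "sets f = sets m" and ac: "absolutely_continuous m f"
    and ent: "integrable f (entropy_density (exp 1) m f)"
    and Y[measurable]: "Y \<in> borel_measurable m"
    and B: "exp_moment m Y \<le> ennreal B" "B > 0"
  shows "(\<integral>\<^sup>+x. ennreal (Y x) \<partial>f) < \<infinity>"
    and "integrable f Y \<Longrightarrow> (\<integral>x. Y x \<partial>f) \<le> KL_divergence (exp 1) m f + ln B"
proof -
  interpret m: prob_space m by fact
  interpret f: prob_space f by fact
  define D where "D = RN_deriv m f"
  have [measurable]: "D \<in> borel_measurable m" by (simp add: D_def)
  have [measurable_cong]: "sets f = sets m" by fact
  have fD: "f = density m D" unfolding D_def using m.density_RN_deriv[OF ac sets] by simp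
  have Dfin: "AE x in m. D x \<noteq> \<infinity>" unfolding D_def by (rule m.RN_deriv_finite[OF _ ac sets]) unfold_locales
  define h where "h = (\<lambda>x. ln (enn2real (D x)))"
  have h: "entropy_density (exp 1) m f = h"
    by (simp add: entropy_density_def h_def D_def fun_eq_iff log_def)
  have hint: "integrable f h" using ent by (simp add: h)
  define W where "W = (\<lambda>x. exp (Y x) / (B * enn2real (D x)))"
  have [measurable]: "W \<in> borel_measurable m" unfolding W_def by measurable
  have [measurable]: "h \<in> borel_measurable m" unfolding h_def by measurable
  have Dpos: "AE x in f. 0 < D x"
    unfolding fD by (subst AE_density) (auto)
  have Dfin': "AE x in f. D x \<noteq> \<infinity>"
    by (rule absolutely_continuous_AE[OF sets ac Dfin])
  have WI: "(\<integral>\<^sup>+x. ennreal (W x) \<partial>f) \<le> 1"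
  proof -
    have "(\<integral>\<^sup>+x. ennreal (W x) \<partial>f) = (\<integral>\<^sup>+x. D x * ennreal (W x) \<partial>m)"
      unfolding fD by (rule nn_integral_density) measurable
    also have "\<dots> \<le> (\<integral>\<^sup>+x. ennreal (1 / B) * ennreal (exp (Y x)) \<partial>m)"
    proof (rule nn_integral_mono_AE, use Dfin in eventually_elim)
      fix x assume "D x \<noteq> \<infinity>"
      then obtain d where d: "D x = ennreal d" "d \<ge> 0" by (cases "D x") auto
      show "D x * ennreal (W x) \<le> ennreal (1 / B) * ennreal (exp (Y x))"
        using d B(2) by (cases "d = 0") (auto simp: W_def simp flip: ennreal_mult intro!: ennreal_leI)
    qed
    also have "\<dots> = ennreal (1 / B) * exp_moment m Y" by (rule nn_integral_cmult) measurable
    also have "\<dots> \<le> ennreal (1 / B) * ennreal B" by (intro mult_left_mono B) auto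
    also have "\<dots> = 1" using B(2) by (simp flip: ennreal_mult)
    finally show ?thesis .
  qed
  have W0: "W x \<ge> 0" for x using B(2) by (simp add: W_def)
  have Wint: "integrable f W"
  proof (rule integrableI_nonneg)
    show "W \<in> borel_measurable f" by measurable
    show "(\<integral>\<^sup>+x. ennreal (W x) \<partial>f) < \<infinity>" using WI by (simp add: le_less_trans[OF WI])
  qed (use W0 in auto)
  have W1: "(\<integral>x. W x \<partial>f) \<le> 1"
    using WI W0 nn_integral_eq_integral[OF Wint] by (simp add: ennreal_le_1)
  have key: "AE x in f. Y x - h x - ln B \<le> W x - 1"
    using Dpos Dfin'
  proof eventually_elim
    case (elim x)
    then obtain d where d: "D x = ennreal d" "d > 0" by (cases "D x") auto
    have "ln (W x) = Y x - h x - ln B" using d B(2) by (simp add: W_def h_def ln_div ln_mult)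
    moreover have "W x > 0" using d B(2) by (simp add: W_def)
    ultimately show ?case using ln_le_minus_one[of "W x"] by simp
  qed
  show "(\<integral>\<^sup>+x. ennreal (Y x) \<partial>f) < \<infinity>"
  proof -
    have i: "integrable f (\<lambda>x. W x + \<bar>h x\<bar> + \<bar>ln B\<bar>)" using Wint hint by simp
    have "(\<integral>\<^sup>+x. ennreal (Y x) \<partial>f) \<le> (\<integral>\<^sup>+x. ennreal (W x + \<bar>h x\<bar> + \<bar>ln B\<bar>) \<partial>f)"
      by (rule nn_integral_mono_AE) (use key in \<open>eventually_elim, intro ennreal_leI, linarith\<close>)
    also have "\<dots> = ennreal (\<integral>x. W x + \<bar>h x\<bar> + \<bar>ln B\<bar> \<partial>f)" using i W0 by (intro nn_integral_eq_integral) auto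
    also have "\<dots> < \<infinity>" by simp
    finally show ?thesis .
  qed
  assume Yint: "integrable f Y"
  have "(\<integral>x. Y x - h x - ln B \<partial>f) \<le> (\<integral>x. W x - 1 \<partial>f)"
    by (rule integral_mono_AE[OF _ _ key]) (use Yint hint Wint in auto)
  also have "\<dots> \<le> 0" using Wint W1 by (simp add: f.prob_space)
  finally show "(\<integral>x. Y x \<partial>f) \<le> KL_divergence (exp 1) m f + ln B"
    using Yint hint by (simp add: KL_divergence_def h f.prob_space)
qed

section \<open>Energy and commutator as second-order statistics\<close>

lemma distr_PiM_pair:
  assumes "prob_space M" and ij: "i < N" "j < N" "i \<noteq> j"
  shows "distr (tensor_power N M) (M \<Otimes>\<^sub>M M) (\<lambda>X. (X i, X j)) = M \<Otimes>\<^sub>M M"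
proof -
  interpret prob_space M by fact
  interpret PS: product_prob_space "\<lambda>_. M" "{..<N}" ..
  have [measurable]: "(\<lambda>X. (X i, X j)) \<in> measurable (tensor_power N M) (M \<Otimes>\<^sub>M M)" using ij by (intro measurable_Pair measurable_component_singleton) auto
  have "M \<Otimes>\<^sub>M M = distr (tensor_power N M) (M \<Otimes>\<^sub>M M) (\<lambda>X. (X i, X j))"
  proof (rule pair_measure_eqI)
    fix A B assume AB[measurable]: "A \<in> sets M" "B \<in> sets M"
    let ?E = "\<lambda>k. if k = i then A else B"
    have "emeasure (distr (tensor_power N M) (M \<Otimes>\<^sub>M M) (\<lambda>X. (X i, X j))) (A \<times> B)
      = emeasure (tensor_power N M) ((\<lambda>X. (X i, X j)) -` (A \<times> B) \<inter> space (tensor_power N M))"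
      by (rule emeasure_distr) measurable
    also have "(\<lambda>X. (X i, X j)) -` (A \<times> B) \<inter> space (tensor_power N M) = prod_emb {..<N} (\<lambda>_. M) {i, j} (Pi\<^sub>E {i, j} ?E)"
      using ij by (auto simp: prod_emb_def space_PiM PiE_iff)
    also have "emeasure (tensor_power N M) \<dots> = (\<Prod>k\<in>{i, j}. emeasure M (?E k))"
      using ij AB by (intro PS.emeasure_PiM_emb) auto
    also have "\<dots> = emeasure M A * emeasure M B" using ij by simp
    finally show "emeasure M A * emeasure M B = emeasure (distr (tensor_power N M) (M \<Otimes>\<^sub>M M) (\<lambda>X. (X i, X j))) (A \<times> B)" ..
  qed (simp_all add: sigma_finite_measure_axioms)
  then show ?thesis ..
qed

lemma integral_PiM_pair:
  fixes f :: "'a \<Rightarrow> 'a \<Rightarrow> real"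
  assumes M: "prob_space M" and ij: "i < N" "j < N" "i \<noteq> j" and f: "integrable (M \<Otimes>\<^sub>M M) (case_prod f)"
  shows "integrable (tensor_power N M) (\<lambda>X. f (X i) (X j))"
    and "(\<integral>X. f (X i) (X j) \<partial>tensor_power N M) = (\<integral>x. \<integral>y. f x y \<partial>M \<partial>M)"
proof -
  interpret prob_space M by fact
  interpret PP: pair_prob_space M M ..
  have m: "(\<lambda>X. (X i, X j)) \<in> measurable (tensor_power N M) (M \<Otimes>\<^sub>M M)" using ij by (intro measurable_Pair measurable_component_singleton) auto
  have fm: "case_prod f \<in> borel_measurable (M \<Otimes>\<^sub>M M)" using f by (rule borel_measurable_integrable)
  have "integrable (tensor_power N M) (\<lambda>X. case_prod f (X i, X j))"
    by (rule integrable_distr[OF m]) (simp only: distr_PiM_pair[OF M ij] f)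
  then show "integrable (tensor_power N M) (\<lambda>X. f (X i) (X j))" by simp
  have "(\<integral>X. case_prod f (X i, X j) \<partial>tensor_power N M) = (\<integral>p. case_prod f p \<partial>distr (tensor_power N M) (M \<Otimes>\<^sub>M M) (\<lambda>X. (X i, X j)))"
    by (rule integral_distr[OF m fm, symmetric])
  also have "\<dots> = (\<integral>x. \<integral>y. f x y \<partial>M \<partial>M)"
    unfolding distr_PiM_pair[OF M ij] using PP.integral_fst[OF f] by simp
  finally show "(\<integral>X. f (X i) (X j) \<partial>tensor_power N M) = (\<integral>x. \<integral>y. f x y \<partial>M \<partial>M)" by simp
qed

lemma integral_PiM_component:
  fixes f :: "'a \<Rightarrow> real"
  assumes M: "prob_space M" and i: "i < N" and f: "integrable M f"
  shows "integrable (tensor_power N M) (\<lambda>X. f (X i))" "(\<integral>X. f (X i) \<partial>tensor_power N M) = (\<integral>x. f x \<partial>M)"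
proof -
  have d: "distr (tensor_power N M) M (\<lambda>X. X i) = M" using distr_PiM_component[of "{..<N}" "\<lambda>_. M" i] M i by simp
  have m: "(\<lambda>X. X i) \<in> measurable (tensor_power N M) M" using i by (intro measurable_component_singleton) auto
  show "integrable (tensor_power N M) (\<lambda>X. f (X i))"
    by (rule integrable_distr[OF m]) (simp add: d f)
  show "(\<integral>X. f (X i) \<partial>tensor_power N M) = (\<integral>x. f x \<partial>M)"
    using integral_distr[OF m borel_measurable_integrable[OF f]] by (simp add: d)
qed

text \<open>Counting terms gives (N - 1) c - 2 N c + N c = -c. The missing diagonal leaves a mean
  independent of N; in Jensen's inequality for the partition function it becomes the exponent
  \<beta> I_\<mu>.\<close>

lemma ustat_mean:
  fixes q :: "'a \<Rightarrow> 'a \<Rightarrow> real"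
  assumes M: "prob_space M" and N: "N \<ge> 1" and q: "integrable (M \<Otimes>\<^sub>M M) (case_prod q)"
  shows "integrable (tensor_power N M) (ustat N M q)"
    and "(\<integral>X. ustat N M q X \<partial>tensor_power N M) = - (\<integral>x. \<integral>y. q x y \<partial>M \<partial>M)"
proof -
  interpret prob_space M by fact
  interpret PP: pair_prob_space M M ..
  interpret T: prob_space "tensor_power N M" by (intro prob_space_PiM M)
  let ?P = "tensor_power N M"
  let ?c = "\<integral>x. \<integral>y. q x y \<partial>M \<partial>M"
  have m: "integrable M (\<lambda>x. \<integral>y. q x y \<partial>M)" by (rule PP.integrable_fst[OF q])
  have i1: "integrable ?P (\<lambda>X. \<Sum>i<N. \<Sum>j\<in>{..<N} - {i}. q (X i) (X j))"
    by (intro Bochner_Integration.integrable_sum integral_PiM_pair[OF M _ _ _ q]) auto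
  have i2: "integrable ?P (\<lambda>X. \<Sum>i<N. \<integral>y. q (X i) y \<partial>M)"
    by (intro Bochner_Integration.integrable_sum integral_PiM_component[OF M _ m]) auto
  have e1: "(\<integral>X. offdiag_sum N (\<lambda>i j. q (X i) (X j)) \<partial>?P) = real N * (real N - 1) * ?c"
  proof -
    have "(\<integral>X. offdiag_sum N (\<lambda>i j. q (X i) (X j)) \<partial>?P)
      = (\<Sum>i<N. \<integral>X. (\<Sum>j\<in>{..<N} - {i}. q (X i) (X j)) \<partial>?P)"
      by (intro Bochner_Integration.integral_sum Bochner_Integration.integrable_sum integral_PiM_pair[OF M _ _ _ q]) auto
    also have "\<dots> = offdiag_sum N (\<lambda>i j. \<integral>X. q (X i) (X j) \<partial>?P)"
      by (intro sum.cong refl Bochner_Integration.integral_sum integral_PiM_pair[OF M _ _ _ q]) auto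
    also have "\<dots> = offdiag_sum N (\<lambda>i j. ?c)"
      by (intro sum.cong refl integral_PiM_pair[OF M _ _ _ q]) auto
    also have "\<dots> = real N * (real N - 1) * ?c" using N by (simp add: card_Diff_singleton of_nat_diff)
    finally show ?thesis .
  qed
  have e2: "(\<integral>X. (\<Sum>i<N. \<integral>y. q (X i) y \<partial>M) \<partial>?P) = real N * ?c"
  proof -
    have "(\<integral>X. (\<Sum>i<N. \<integral>y. q (X i) y \<partial>M) \<partial>?P) = (\<Sum>i<N. \<integral>X. (\<integral>y. q (X i) y \<partial>M) \<partial>?P)"
      by (intro Bochner_Integration.integral_sum integral_PiM_component[OF M _ m]) auto
    also have "\<dots> = (\<Sum>i<N. ?c)" by (intro sum.cong refl integral_PiM_component[OF M _ m]) auto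
    finally show ?thesis by simp
  qed
  show "integrable ?P (ustat N M q)"
    unfolding ustat_def using i1 i2 by simp
  have "(\<integral>X. ustat N M q X \<partial>?P) = 1 / real N * (real N * (real N - 1) * ?c) - 2 * (real N * ?c) + real N * ?c"
    unfolding ustat_def using i1 i2 by (simp add: e1 e2 T.prob_space)
  then show "(\<integral>X. ustat N M q X \<partial>?P) = - ?c" using N by (simp add: field_simps)
qed

lemma measurable_ustat:
  fixes q :: "'a \<Rightarrow> 'a \<Rightarrow> real"
  assumes "prob_space M" and [measurable]: "case_prod q \<in> borel_measurable (M \<Otimes>\<^sub>M M)"
  shows "ustat N M q \<in> borel_measurable (tensor_power N M)"
proof -
  interpret prob_space M by fact
  have "(\<lambda>x. \<integral>y. q x y \<partial>M) \<in> borel_measurable M" by measurable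
  then have [measurable]: "(\<lambda>X. \<integral>y. q (X i) y \<partial>M) \<in> borel_measurable (tensor_power N M)" if "i < N" for i
    by (rule measurable_compose[rotated]) (use that in \<open>auto intro: measurable_component_singleton\<close>)
  have [measurable]: "(\<lambda>X. q (X i) (X j)) \<in> borel_measurable (tensor_power N M)" if "i < N" "j < N" for i j
    using measurable_compose[OF measurable_Pair[OF measurable_component_singleton[of i "{..<N}" "\<lambda>_. M"] measurable_component_singleton[of j "{..<N}" "\<lambda>_. M"]] assms(2)] that by simp
  show ?thesis unfolding ustat_def by (intro borel_measurable_add borel_measurable_diff borel_measurable_times borel_measurable_sum borel_measurable_const) auto
qed

lemma ustat_scale: "ustat N M (\<lambda>x y. c * q x y) X = c * ustat N M q X"
proof -
  have "(\<Sum>i<N. \<integral>y. c * q (X i) y \<partial>M) = c * (\<Sum>i<N. \<integral>y. q (X i) y \<partial>M)" by (simp add: sum_distrib_left)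
  moreover have "(\<integral>x. \<integral>y. c * q x y \<partial>M \<partial>M) = c * (\<integral>x. \<integral>y. q x y \<partial>M \<partial>M)" by simp
  moreover have "offdiag_sum N (\<lambda>i j. c * q (X i) (X j)) = c * offdiag_sum N (\<lambda>i j. q (X i) (X j))"
    by (simp add: sum_distrib_left)
  ultimately show ?thesis unfolding ustat_def by (simp only: algebra_simps)
qed

lemma ustat_add:
  assumes M: "prob_space M" and i: "\<And>x. integrable M (q x)" "\<And>x. integrable M (q' x)"
    and p: "integrable (M \<Otimes>\<^sub>M M) (case_prod q)" "integrable (M \<Otimes>\<^sub>M M) (case_prod q')"
  shows "ustat N M (\<lambda>x y. q x y + q' x y) X = ustat N M q X + ustat N M q' X"
proof -
  interpret prob_space M by fact
  interpret PP: pair_prob_space M M ..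
  have "(\<integral>x. \<integral>y. q x y + q' x y \<partial>M \<partial>M) = (\<integral>x. \<integral>y. q x y \<partial>M \<partial>M) + (\<integral>x. \<integral>y. q' x y \<partial>M \<partial>M)"
    using i PP.integrable_fst[OF p(1)] PP.integrable_fst[OF p(2)] by simp
  then show ?thesis unfolding ustat_def using i by (simp add: sum.distrib algebra_simps)
qed

text \<open>Centring with c = 2 I_\<mu>, the double integral of g, turns the statistic of g into
  exactly twice N F_N.\<close>

lemma mod_energy_eq_ustat:
  fixes \<mu> :: "'a::euclidean_space measure"
  assumes "prob_space \<mu>" and N: "N \<ge> 1" and g: "integrable (\<mu> \<Otimes>\<^sub>M \<mu>) (\<lambda>(x, y). riesz s (x - y))"
  shows "real N * mod_energy s N X \<mu> = ustat N \<mu> (\<lambda>x y. 1 / 2 * riesz s (x - y)) X"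
    and "(\<integral>x. \<integral>y. 1 / 2 * riesz s (x - y) \<partial>\<mu> \<partial>\<mu>) = self_energy s \<mu>"
proof -
  interpret prob_space \<mu> by fact
  interpret PP: pair_prob_space \<mu> \<mu> ..
  have I: "2 * self_energy s \<mu> = (\<integral>x. \<integral>y. riesz s (x - y) \<partial>\<mu> \<partial>\<mu>)"
    unfolding self_energy_def using PP.integral_fst[OF g] by simp
  then show "(\<integral>x. \<integral>y. 1 / 2 * riesz s (x - y) \<partial>\<mu> \<partial>\<mu>) = self_energy s \<mu>" by simp
  let ?S = "\<Sum>i<N. \<Sum>j\<in>{..<N} - {i}. centered_riesz s \<mu> (X i) (X j)" and ?H = "\<Sum>i<N. pot s \<mu> (X i)"
  have "ustat N \<mu> (\<lambda>x y. riesz s (x - y)) X = 1 / real N * ?S - 2 / real N * ?H + 2 * self_energy s \<mu>"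
    unfolding centered_riesz_def by (rule ustat_centered[OF N]) (simp_all add: pot_def I)
  moreover have "real N * mod_energy s N X \<mu> = 1 / 2 * (1 / real N * ?S - 2 / real N * ?H + 2 * self_energy s \<mu>)"
    unfolding mod_energy_def using N by (simp add: power2_eq_square field_simps)
  ultimately show "real N * mod_energy s N X \<mu> = ustat N \<mu> (\<lambda>x y. 1 / 2 * riesz s (x - y)) X"
    by (simp only: ustat_scale)
qed

lemma empirical_integral:
  fixes f :: "'a::euclidean_space \<Rightarrow> real"
  assumes N: "N \<ge> 1" and f: "f \<in> borel_measurable borel"
  shows "prob_space (empirical N X)" "sets (empirical N X) = sets borel"
    "integrable (empirical N X) f" "(\<integral>x. f x \<partial>empirical N X) = 1 / real N * (\<Sum>i<N. f (X i))"
proof -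
  let ?U = "uniform_count_measure {..<N}"
  interpret U: prob_space ?U using N by (intro prob_space_uniform_count_measure) (auto simp: lessThan_empty_iff)
  have X: "X \<in> measurable ?U borel" by (simp add: measurable_def space_uniform_count_measure)
  show "prob_space (empirical N X)" unfolding empirical_def using X by (rule U.prob_space_distr)
  show "sets (empirical N X) = sets borel" by (simp add: empirical_def)
  have "integrable ?U (\<lambda>i. f (X i))"
  proof (rule U.integrable_const_bound)
    show "AE i in ?U. norm (f (X i)) \<le> (\<Sum>i<N. \<bar>f (X i)\<bar>)"
      by (rule AE_I2) (auto simp: space_uniform_count_measure intro!: member_le_sum)
    show "(\<lambda>i. f (X i)) \<in> borel_measurable ?U" using X f by (rule measurable_compose)
  qed
  then show "integrable (empirical N X) f" unfolding empirical_def using X f by (subst integrable_distr_eq) auto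
  show "(\<integral>x. f x \<partial>empirical N X) = 1 / real N * (\<Sum>i<N. f (X i))"
    unfolding empirical_def using X f by (subst integral_distr) (auto simp: integral_uniform_count_measure)
qed

lemma offdiag_integral_eq:
  assumes "\<And>x. k x x = 0"
  shows "offdiag_integral k \<mu> \<nu> = (\<integral>(x, y). k x y \<partial>(\<mu> \<Otimes>\<^sub>M \<nu>))"
  unfolding offdiag_integral_def set_lebesgue_integral_def
  by (rule Bochner_Integration.integral_cong) (use assms in \<open>auto simp: indicator_def\<close>)

text \<open>Since \<open>k\<close> vanishes on the diagonal, the off-diagonal integrals are ordinary
  double integrals, also against the empirical measure with its atoms. The two mixed terms integrate
  \<open>k\<close> in different arguments, and symmetrising merges them into one sum.\<close>

lemma commutator_form_eq_ustat:
  fixes \<mu> :: "'a::euclidean_space measure" and k :: "'a \<Rightarrow> 'a \<Rightarrow> real"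
  assumes "prob_space \<mu>" and sets[measurable_cong]: "sets \<mu> = sets borel" and N: "N \<ge> 1"
    and k[measurable]: "case_prod k \<in> borel_measurable (borel \<Otimes>\<^sub>M borel)" and diag: "\<And>x. k x x = 0"
    and i1: "\<And>x. integrable \<mu> (k x)" and i2: "\<And>y. integrable \<mu> (\<lambda>x. k x y)" and i: "integrable (\<mu> \<Otimes>\<^sub>M \<mu>) (case_prod k)"
  shows "real N * (offdiag_integral k (empirical N X) (empirical N X) - offdiag_integral k (empirical N X) \<mu>
      - offdiag_integral k \<mu> (empirical N X) + offdiag_integral k \<mu> \<mu>) = ustat N \<mu> (\<lambda>x y. (k x y + k y x) / 2) X"
proof -
  let ?E = "empirical N X"
  interpret prob_space \<mu> by fact
  interpret E: prob_space ?E by (rule empirical_integral[OF N borel_measurable_const])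
  have setsE[measurable_cong]: "sets ?E = sets borel" by (rule empirical_integral[OF N borel_measurable_const])
  interpret PP: pair_prob_space \<mu> \<mu> ..
  interpret EP: pair_prob_space ?E \<mu> ..
  interpret EE: pair_prob_space ?E ?E ..
  interpret PE: pair_prob_space \<mu> ?E ..
  have fub: "(\<integral>(x, y). h x y \<partial>(?E \<Otimes>\<^sub>M \<nu>)) = 1 / real N * (\<Sum>i<N. \<integral>y. h (X i) y \<partial>\<nu>)"
    if \<nu>: "prob_space \<nu>" "sets \<nu> = sets borel" and h[measurable]: "case_prod h \<in> borel_measurable (borel \<Otimes>\<^sub>M borel)" and hi: "\<And>x. integrable \<nu> (h x)"
    for \<nu> and h :: "'a \<Rightarrow> 'a \<Rightarrow> real"
  proof -
    interpret \<nu>: prob_space \<nu> by fact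
    interpret P: pair_prob_space ?E \<nu> ..
    note [measurable_cong] = \<nu>(2)
    have "integrable (?E \<Otimes>\<^sub>M \<nu>) (case_prod h)"
    proof (rule P.Fubini_integrable)
      show "integrable ?E (\<lambda>x. \<integral>y. norm (case_prod h (x, y)) \<partial>\<nu>)" by (rule empirical_integral[OF N]) measurable
    qed (use hi in auto)
    then have "(\<integral>(x, y). h x y \<partial>(?E \<Otimes>\<^sub>M \<nu>)) = (\<integral>x. \<integral>y. h x y \<partial>\<nu> \<partial>?E)" by (rule P.integral_fst[symmetric])
    also have "\<dots> = 1 / real N * (\<Sum>i<N. \<integral>y. h (X i) y \<partial>\<nu>)"
      by (rule empirical_integral[OF N]) measurable
    finally show ?thesis .
  qed
  have kx: "k x \<in> borel_measurable borel" for x by measurable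
  have EE: "offdiag_integral k ?E ?E = 1 / real N * (\<Sum>i<N. 1 / real N * (\<Sum>j<N. k (X i) (X j)))"
    unfolding offdiag_integral_eq[of k, OF diag]
    by (subst fub) (simp_all add: E.prob_space_axioms setsE empirical_integral[OF N kx] k)
  have EP: "offdiag_integral k ?E \<mu> = 1 / real N * (\<Sum>i<N. \<integral>y. k (X i) y \<partial>\<mu>)"
    unfolding offdiag_integral_eq[of k, OF diag] by (rule fub) (fact prob_space_axioms sets k i1)+
  have PE: "offdiag_integral k \<mu> ?E = 1 / real N * (\<Sum>i<N. \<integral>x. k x (X i) \<partial>\<mu>)"
  proof -
    have "offdiag_integral k \<mu> ?E = (\<integral>(x, y). case_prod k (y, x) \<partial>(?E \<Otimes>\<^sub>M \<mu>))"
      unfolding offdiag_integral_eq[of k, OF diag] by (rule PE.integral_product_swap[symmetric]) measurable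
    also have "\<dots> = (\<integral>(x, y). k y x \<partial>(?E \<Otimes>\<^sub>M \<mu>))" by simp
    also have "\<dots> = 1 / real N * (\<Sum>i<N. \<integral>x. k x (X i) \<partial>\<mu>)"
      by (rule fub) (use prob_space_axioms sets i2 in \<open>simp_all\<close>)
    finally show ?thesis .
  qed
  have PPk: "offdiag_integral k \<mu> \<mu> = (\<integral>x. \<integral>y. k x y \<partial>\<mu> \<partial>\<mu>)"
    unfolding offdiag_integral_eq[of k, OF diag] by (rule PP.integral_fst[OF i, symmetric])
  have swap: "(\<integral>x. \<integral>y. k y x \<partial>\<mu> \<partial>\<mu>) = (\<integral>x. \<integral>y. k x y \<partial>\<mu> \<partial>\<mu>)" by (rule PP.Fubini_integral[OF i])
  have s0: "(\<integral>x. \<integral>y. (k x y + k y x) / 2 \<partial>\<mu> \<partial>\<mu>) = (\<integral>x. \<integral>y. k x y \<partial>\<mu> \<partial>\<mu>)"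
    using i1 i2 PP.integrable_fst[OF i] PP.integrable_snd[OF i] swap by simp
  have s1: "(\<Sum>i<N. \<integral>y. (k (X i) y + k y (X i)) / 2 \<partial>\<mu>) = ((\<Sum>i<N. \<integral>y. k (X i) y \<partial>\<mu>) + (\<Sum>i<N. \<integral>x. k x (X i) \<partial>\<mu>)) / 2"
    using i1 i2 by (simp add: sum.distrib sum_divide_distrib[symmetric])
  have s2: "offdiag_sum N (\<lambda>i j. (k (X i) (X j) + k (X j) (X i)) / 2) = (\<Sum>i<N. \<Sum>j<N. k (X i) (X j))"
  proof -
    have "offdiag_sum N (\<lambda>i j. (k (X i) (X j) + k (X j) (X i)) / 2) = (\<Sum>i<N. \<Sum>j<N. (k (X i) (X j) + k (X j) (X i)) / 2)"
      by (rule sum.cong[OF refl], rule sum.mono_neutral_left) (auto simp: diag)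
    also have "\<dots> = ((\<Sum>i<N. \<Sum>j<N. k (X i) (X j)) + (\<Sum>i<N. \<Sum>j<N. k (X j) (X i))) / 2"
      by (simp add: sum.distrib sum_divide_distrib[symmetric])
    also have "(\<Sum>i<N. \<Sum>j<N. k (X j) (X i)) = (\<Sum>i<N. \<Sum>j<N. k (X i) (X j))" by (rule sum.swap)
    finally show ?thesis by simp
  qed
  have EE': "offdiag_integral k ?E ?E = 1 / real N * (1 / real N * (\<Sum>i<N. \<Sum>j<N. k (X i) (X j)))"
    unfolding EE by (simp only: sum_distrib_left[symmetric])
  show ?thesis unfolding ustat_def s0 s1 s2 EE' EP PE PPk using N by (simp add: field_simps)
qed

lemma ennreal_add_le: "ennreal (a + b) \<le> ennreal a + ennreal b"
proof -
  have "ennreal (a + b) \<le> ennreal (max 0 a + max 0 b)" by (rule ennreal_leI) auto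
  also have "\<dots> = ennreal (max 0 a) + ennreal (max 0 b)" by (rule ennreal_plus) auto
  also have "\<dots> = ennreal a + ennreal b" by (simp add: max_def ennreal_neg)
  finally show ?thesis .
qed

section \<open>The statistics of the Riesz gas\<close>

text \<open>\<open>C0\<close> is a parameter, not a constant obtained inside, because it is chosen
  before \<mu> and v: C_sr is built from it and may depend only on the dimension, s and n.\<close>

locale riesz_gas =
  fixes s :: real and n :: nat and \<mu> :: "'a::euclidean_space measure" and v :: "'a \<Rightarrow> 'a" and C0 \<Lambda> :: real
  assumes n_ge_1: "n \<ge> 1" and s_nonneg: "0 \<le> s" and s_less: "s < real DIM('a) / 2"
    and density: "bounded_density_prob \<mu>" and lipschitz: "\<Lambda>-lipschitz_on UNIV v"
    and log_energy: "s = 0 \<Longrightarrow> (\<integral>\<^sup>+ (x, y). ennreal \<bar>ln (norm (x - y))\<bar> \<partial>(\<mu> \<Otimes>\<^sub>M \<mu>)) < \<infinity>"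
    and C0_pos: "C0 > 0"
    and C0_bound: "\<And>z w :: 'a. z \<noteq> 0 \<Longrightarrow> \<bar>grad_contract n (riesz s) z w\<bar> \<le> C0 * norm z powr (- s - n) * norm w ^ n"
begin

sublocale prob_space \<mu>
  using density by (simp add: bounded_density_prob_def)

sublocale PP: pair_prob_space \<mu> \<mu> ..

lemma sets_eq [measurable_cong, simp]: "sets \<mu> = sets borel"
  using density by (auto simp: bounded_density_prob_def)

lemma space_eq [simp]: "space \<mu> = UNIV"
  using sets_eq_imp_space_eq[OF sets_eq] by simp

abbreviation "G \<equiv> grad_sup v"

abbreviation T :: "nat \<Rightarrow> (nat \<Rightarrow> 'a) measure" where "T N \<equiv> tensor_power N \<mu>"
abbreviation "Z N \<beta> \<equiv> mod_partition s N \<beta> \<mu>"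
abbreviation "I \<equiv> self_energy s \<mu>"
abbreviation "NF N X \<equiv> real N * mod_energy s N X \<mu>"
abbreviation "gibbs_moment N \<beta> c \<equiv> exp_moment (mod_gibbs s N \<beta> \<mu>) (\<lambda>X. c * real N * commutator s n N v X \<mu>)"
abbreviation "NA N X \<equiv> real N * commutator s n N v X \<mu>"

definition k :: "'a \<Rightarrow> 'a \<Rightarrow> real" where
  "k x y = grad_contract n (riesz s) (x - y) (v x - v y)"

text \<open>The commutator only sees the symmetric part of its kernel, so the parity of \<open>\<nabla>\<^sup>\<otimes>\<^sup>n g\<close> is not needed.\<close>

definition ksym :: "'a \<Rightarrow> 'a \<Rightarrow> real" where
  "ksym x y = (k x y + k y x) / 2"

lemma k_diag: "k x x = 0"
  unfolding k_def using grad_contract_riesz(3)[OF n_ge_1, of s] by simp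

lemma v_measurable: "v \<in> borel_measurable borel"
  using lipschitz by (intro borel_measurable_continuous_onI lipschitz_on_continuous_on)

lemma k_measurable [measurable]: "(\<lambda>(x, y). k x y) \<in> borel_measurable (borel \<Otimes>\<^sub>M borel)"
  unfolding k_def by (rule grad_contract_riesz(2)[OF n_ge_1 v_measurable])

lemma ksym_measurable [measurable]: "(\<lambda>(x, y). ksym x y) \<in> borel_measurable (\<mu> \<Otimes>\<^sub>M \<mu>)"
  unfolding ksym_def by measurable

lemma riesz_measurable [measurable]: "riesz s \<in> borel_measurable borel"
  unfolding riesz_def by measurable

text \<open>Each of the n factors v x - v y gains G |x - y|. Together they compensate the n
  derivatives and leave a singularity of order |x - y|^(-s).\<close>

lemma k_bound: "\<bar>k x y\<bar> \<le> C0 * G ^ n * norm (x - y) powr (- s)"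
proof (cases "x = y")
  case False
  let ?r = "norm (x - y)"
  have r: "?r > 0" using False by simp
  have "\<bar>k x y\<bar> \<le> C0 * ?r powr (- s - n) * norm (v x - v y) ^ n"
    unfolding k_def using False by (intro C0_bound) simp
  also have "\<dots> \<le> C0 * ?r powr (- s - n) * (G * ?r) ^ n"
    using C0_pos grad_sup_lipschitz[OF lipschitz] by (intro mult_left_mono power_mono) auto
  also have "\<dots> = C0 * G ^ n * (?r powr (- s - n) * ?r powr n)"
    using r by (simp add: power_mult_distrib powr_realpow mult_ac)
  also have "?r powr (- s - n) * ?r powr n = ?r powr (- s)" by (simp flip: powr_add)
  finally show ?thesis .
qed (simp add: k_diag)

lemma ksym_bound: "\<bar>ksym x y\<bar> \<le> C0 * G ^ n * norm (x - y) powr (- s)"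
proof -
  have "\<bar>(a + b) / 2\<bar> \<le> c" if "\<bar>a\<bar> \<le> c" "\<bar>b\<bar> \<le> c" for a b c :: real
    using that by (auto simp: abs_le_iff)
  then show ?thesis
    using k_bound[of x y] k_bound[of y x] unfolding ksym_def norm_minus_commute[of y x] by blast
qed

lemma powr_integral_bound:
  assumes "0 \<le> t" "t < real DIM('a)"
  obtains C where "C \<ge> 0" "\<And>x. (\<integral>\<^sup>+y. ennreal (norm (x - y) powr (- t)) \<partial>\<mu>) \<le> ennreal C"
  using bounded_density_powr_bound[OF density assms] by blast

lemma s_less_dim: "s < real DIM('a)"
proof -
  have "real DIM('a) > 0" by simp
  then show ?thesis using s_less by linarith
qed

lemma powr_integrable: "integrable \<mu> (\<lambda>y. norm (x - y) powr (- s))"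
proof -
  obtain C where "\<And>x. (\<integral>\<^sup>+y. ennreal (norm (x - y) powr (- s)) \<partial>\<mu>) \<le> ennreal C"
    using powr_integral_bound[OF s_nonneg s_less_dim] by blast
  from this[of x] show ?thesis by (intro integrableI_bounded) (auto simp: le_less_trans)
qed

lemma powr_integrable_pair: "integrable (\<mu> \<Otimes>\<^sub>M \<mu>) (\<lambda>(x, y). norm (x - y) powr (- s))"
proof (rule integrableI_bounded)
  obtain C where C: "\<And>x. (\<integral>\<^sup>+y. ennreal (norm (x - y) powr (- s)) \<partial>\<mu>) \<le> ennreal C"
    using powr_integral_bound[OF s_nonneg s_less_dim] by blast
  have "(\<integral>\<^sup>+p. ennreal (norm (case p of (x, y) \<Rightarrow> norm (x - y) powr (- s))) \<partial>(\<mu> \<Otimes>\<^sub>M \<mu>))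
    = (\<integral>\<^sup>+x. \<integral>\<^sup>+y. ennreal (norm (x - y) powr (- s)) \<partial>\<mu> \<partial>\<mu>)"
    by (subst nn_integral_fst[symmetric]) auto
  also have "\<dots> \<le> (\<integral>\<^sup>+x. ennreal C \<partial>\<mu>)" by (intro nn_integral_mono C)
  also have "\<dots> < \<infinity>" by (simp add: emeasure_space_1[simplified])
  finally show "(\<integral>\<^sup>+p. ennreal (norm (case p of (x, y) \<Rightarrow> norm (x - y) powr (- s))) \<partial>(\<mu> \<Otimes>\<^sub>M \<mu>)) < \<infinity>" .
qed measurable

lemma k_integrable: "integrable \<mu> (k x)" "integrable \<mu> (\<lambda>y. k y x)" "integrable (\<mu> \<Otimes>\<^sub>M \<mu>) (\<lambda>(x, y). k x y)"
proof -
  have le: "\<bar>k x y\<bar> \<le> \<bar>C0 * G ^ n * norm (x - y) powr (- s)\<bar>" for x y using k_bound[of x y] by linarith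
  show "integrable \<mu> (k x)"
    by (rule Bochner_Integration.integrable_bound[OF integrable_mult_right[OF powr_integrable[of x], of "C0 * G ^ n"]]) (use le in auto)
  show "integrable \<mu> (\<lambda>y. k y x)"
    by (rule Bochner_Integration.integrable_bound[OF integrable_mult_right[OF powr_integrable[of x], of "C0 * G ^ n"]])
      (use le in \<open>auto simp: norm_minus_commute[of x]\<close>)
  show "integrable (\<mu> \<Otimes>\<^sub>M \<mu>) (\<lambda>(x, y). k x y)"
    by (rule Bochner_Integration.integrable_bound[OF integrable_mult_right[OF powr_integrable_pair, of "C0 * G ^ n"]]) (use le in auto)
qed

lemma ksym_integrable: "integrable \<mu> (ksym x)" "integrable (\<mu> \<Otimes>\<^sub>M \<mu>) (\<lambda>(x, y). ksym x y)"
proof -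
  show "integrable \<mu> (ksym x)" unfolding ksym_def using k_integrable by simp
  have "integrable (\<mu> \<Otimes>\<^sub>M \<mu>) (\<lambda>(x, y). case_prod k (y, x))" by (rule PP.integrable_product_swap[OF k_integrable(3)])
  then show "integrable (\<mu> \<Otimes>\<^sub>M \<mu>) (\<lambda>(x, y). ksym x y)"
    unfolding ksym_def using k_integrable(3) by (simp add: split_beta')
qed

lemma riesz_integrable: "integrable (\<mu> \<Otimes>\<^sub>M \<mu>) (\<lambda>(x, y). riesz s (x - y))"
proof (cases "s = 0")
  case True
  show ?thesis
  proof (rule integrableI_bounded)
    have "(\<integral>\<^sup>+p. ennreal (norm (case p of (x, y) \<Rightarrow> riesz s (x - y))) \<partial>(\<mu> \<Otimes>\<^sub>M \<mu>)) =
      (\<integral>\<^sup>+ (x, y). ennreal \<bar>ln (norm (x - y))\<bar> \<partial>(\<mu> \<Otimes>\<^sub>M \<mu>))"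
      using True by (intro nn_integral_cong) (auto simp: riesz_def)
    then show "(\<integral>\<^sup>+p. ennreal (norm (case p of (x, y) \<Rightarrow> riesz s (x - y))) \<partial>(\<mu> \<Otimes>\<^sub>M \<mu>)) < \<infinity>"
      using log_energy[OF True] by simp
  qed measurable
next
  case False
  then have "(\<lambda>(x, y). riesz s (x - y)) = (\<lambda>p::'a \<times> 'a. (case p of (x, y) \<Rightarrow> norm (x - y) powr (- s)) / s)"
    by (auto simp: riesz_def fun_eq_iff)
  then show ?thesis using powr_integrable_pair by simp
qed

lemma N_mod_energy:
  assumes "N \<ge> 1"
  shows "NF N X = ustat N \<mu> (\<lambda>x y. 1 / 2 * riesz s (x - y)) X"
  by (rule mod_energy_eq_ustat(1)[OF prob_space_axioms assms riesz_integrable])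

lemma N_commutator:
  assumes "N \<ge> 1"
  shows "NA N X = ustat N \<mu> ksym X"
  using commutator_form_eq_ustat[OF prob_space_axioms sets_eq assms k_measurable k_diag k_integrable]
  unfolding commutator_def Let_def k_def[symmetric, abs_def] ksym_def[abs_def] .

lemma energy_measurable:
  assumes "N \<ge> 1"
  shows "(\<lambda>X. mod_energy s N X \<mu>) \<in> borel_measurable (T N)"
proof -
  have "mod_energy s N X \<mu> = 1 / real N * ustat N \<mu> (\<lambda>x y. 1 / 2 * riesz s (x - y)) X" for X
    unfolding N_mod_energy[OF assms, symmetric] using assms by simp
  moreover have "ustat N \<mu> (\<lambda>x y. 1 / 2 * riesz s (x - y)) \<in> borel_measurable (T N)"
    by (rule measurable_ustat[OF prob_space_axioms]) measurable
  ultimately show ?thesis by simp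
qed

lemma commutator_measurable:
  assumes "N \<ge> 1"
  shows "(\<lambda>X. commutator s n N v X \<mu>) \<in> borel_measurable (T N)"
proof -
  have "commutator s n N v X \<mu> = 1 / real N * ustat N \<mu> ksym X" for X
    unfolding N_commutator[OF assms, symmetric] using assms by simp
  moreover have "ustat N \<mu> ksym \<in> borel_measurable (T N)"
    by (rule measurable_ustat[OF prob_space_axioms]) measurable
  ultimately show ?thesis by simp
qed

lemma prob_space_tensor: "prob_space (T N)"
  by (intro prob_space_PiM prob_space_axioms)

lemma self_energy_nonneg: "0 < s \<Longrightarrow> 0 \<le> I"
  unfolding self_energy_def by (intro mult_nonneg_nonneg Bochner_Integration.integral_nonneg) (auto simp: riesz_def)

lemma partition_ge:
  assumes N: "N \<ge> 1"
  shows "ennreal (exp (\<beta> * I)) \<le> Z N \<beta>"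
proof -
  let ?q = "\<lambda>x y. 1 / 2 * riesz s (x - y)"
  have "integrable (\<mu> \<Otimes>\<^sub>M \<mu>) (\<lambda>p. 1 / 2 * (case p of (x, y) \<Rightarrow> riesz s (x - y)))"
    using riesz_integrable by (rule integrable_mult_right)
  then have i: "integrable (\<mu> \<Otimes>\<^sub>M \<mu>) (\<lambda>(x, y). ?q x y)" by (simp only: split_beta')
  have eq: "- \<beta> * ustat N \<mu> ?q X = - \<beta> * real N * mod_energy s N X \<mu>" for X
    by (simp only: N_mod_energy[OF N, symmetric] mult.assoc)
  have "ennreal (exp (\<integral>X. - \<beta> * ustat N \<mu> ?q X \<partial>T N)) \<le> exp_moment (T N) (\<lambda>X. - \<beta> * ustat N \<mu> ?q X)"
    by (intro nn_integral_exp_ge_exp_integral prob_space_tensor integrable_mult_right ustat_mean[OF prob_space_axioms N i])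
  also have "(\<integral>X. - \<beta> * ustat N \<mu> ?q X \<partial>T N) = - \<beta> * (\<integral>X. ustat N \<mu> ?q X \<partial>T N)"
    by (rule integral_mult_right_zero)
  also have "\<dots> = \<beta> * I"
    unfolding ustat_mean(2)[OF prob_space_axioms N i] mod_energy_eq_ustat(2)[OF prob_space_axioms N riesz_integrable] by simp
  finally show ?thesis unfolding mod_partition_def eq .
qed

text \<open>The partition function is finite by assumption and positive by its lower bound, so the
  normalisation can be multiplied back in \<open>ennreal\<close>.\<close>

lemma gibbs_exp_moment:
  assumes N: "N \<ge> 1" and fin: "Z N \<beta> < \<infinity>"
  shows "exp_moment (T N) (\<lambda>X. - \<beta> * NF N X + c * NA N X)
    = Z N \<beta> * gibbs_moment N \<beta> c"
proof -
  let ?Z = "Z N \<beta>" and ?T = "T N"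
  have Z0: "?Z \<noteq> 0" using partition_ge[OF N, of \<beta>] by (metis ennreal_eq_0_iff exp_gt_zero leD le_zero_eq not_less)
  note [measurable] = energy_measurable[OF N] commutator_measurable[OF N]
  have "gibbs_moment N \<beta> c
    = (\<integral>\<^sup>+X. ennreal (exp (- \<beta> * real N * mod_energy s N X \<mu>)) / ?Z * ennreal (exp (c * real N * commutator s n N v X \<mu>)) \<partial>?T)"
    unfolding mod_gibbs_def by (rule nn_integral_density) measurable
  also have "\<dots> = (\<integral>\<^sup>+X. ennreal (exp (- \<beta> * NF N X + c * NA N X)) / ?Z \<partial>?T)"
  proof (rule nn_integral_cong)
    fix X
    have "exp (- \<beta> * NF N X + c * NA N X)
      = exp (- \<beta> * real N * mod_energy s N X \<mu>) * exp (c * real N * commutator s n N v X \<mu>)"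
      by (simp only: exp_add mult.assoc)
    moreover have "a / ?Z * b = (a * b) / ?Z" for a b :: ennreal by (simp add: divide_ennreal_def mult_ac)
    ultimately show "ennreal (exp (- \<beta> * real N * mod_energy s N X \<mu>)) / ?Z * ennreal (exp (c * real N * commutator s n N v X \<mu>))
      = ennreal (exp (- \<beta> * NF N X + c * NA N X)) / ?Z"
      by (simp only: ennreal_mult exp_ge_zero)
  qed
  also have "\<dots> = exp_moment ?T (\<lambda>X. - \<beta> * NF N X + c * NA N X) / ?Z"
    by (rule nn_integral_divide) measurable
  finally have eq: "gibbs_moment N \<beta> c
    = exp_moment ?T (\<lambda>X. - \<beta> * NF N X + c * NA N X) / ?Z" .
  have "?Z * (a / ?Z) = a" for a
    using Z0 fin ennreal_mult_divide_eq[of ?Z a] by (simp add: ennreal_times_divide mult.commute less_top)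
  then show ?thesis unfolding eq ..
qed

end

section \<open>Modulated Gibbs measures\<close>

context riesz_gas begin

text \<open>Dividing by the lower bound of the partition function is the origin of the factor exp
  (-\<beta> I_\<mu>) in \<open>C_em\<close>.\<close>

lemma gibbs_exp_moment_le:
  assumes N: "N \<ge> 1" and fin: "Z N \<beta> < \<infinity>" and B: "B \<ge> 0"
    and le: "exp_moment (T N) (\<lambda>X. - \<beta> * NF N X + c * NA N X) \<le> ennreal B"
  shows "gibbs_moment N \<beta> c \<le> ennreal (exp (- \<beta> * I) * B)"
proof -
  let ?e = "exp (\<beta> * I)" and ?Q = "gibbs_moment N \<beta> c"
  have "ennreal ?e * ?Q \<le> Z N \<beta> * ?Q" by (intro mult_right_mono partition_ge N) auto
  also have "\<dots> \<le> ennreal B" using le unfolding gibbs_exp_moment[OF N fin] .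
  finally have "ennreal (exp (- \<beta> * I)) * (ennreal ?e * ?Q) \<le> ennreal (exp (- \<beta> * I)) * ennreal B"
    by (rule mult_left_mono) simp
  moreover have "ennreal (exp (- \<beta> * I)) * ennreal ?e = 1"
    by (simp flip: ennreal_mult exp_add)
  ultimately show ?thesis using B by (simp add: ennreal_mult mult.assoc[symmetric])
qed

text \<open>The variational inequality is applied to -\<beta> N F_N + \<sigma> \<epsilon> N A_n,
  whose exponential moment under the product measure is the partition function times the Gibbs
  moment, hence at most C_pf C; both signs and division by \<epsilon> give the constants.
  Integrability comes first: the exponent -\<beta> N F_N alone shows that the negative part of F_N
  is integrable, an infinite positive part makes the claim trivial, and otherwise the two signs
  control both parts of A_n.\<close>

lemma commutator_bound_of_exp_moment:
  assumes \<beta>: "\<beta> > 0" and \<epsilon>: "\<epsilon> > 0" and C: "C > 0"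
    and part: "\<And>N. N \<ge> 1 \<Longrightarrow> Z N \<beta> \<le> ennreal (C_ub \<beta>)"
    and em: "exp_moment_bound s n \<mu> v \<beta> \<epsilon> C"
  shows "commutator_bound s n \<mu> v \<beta> (\<beta> / \<epsilon>) (1 / \<epsilon> * (ln (C_pf C_ub \<beta>) + ln C))"
  unfolding commutator_bound_def
proof (intro allI impI)
  fix N :: nat and f assume N: "1 \<le> N" and f: "prob_space f \<and> sets f = sets (\<Pi>\<^sub>M i\<in>{..<N}. (borel :: 'a measure))"
  let ?T = "T N" and ?F = "\<lambda>X. mod_energy s N X \<mu>" and ?A = "\<lambda>X. commutator s n N v X \<mu>"
  let ?E = "mod_free_energy s \<beta> N f \<mu>" and ?Cp = "C_pf C_ub \<beta>"
  have r: "real N > 0" using N by simp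
  interpret f: prob_space f using f by simp
  have "sets ?T = sets (\<Pi>\<^sub>M i\<in>{..<N}. (borel :: 'a measure))" by (intro sets_PiM_cong) auto
  then have sets[measurable_cong]: "sets f = sets ?T" using f by simp
  note [measurable] = energy_measurable[OF N] commutator_measurable[OF N]
  have Cp: "?Cp > 0" "?Cp \<ge> 1" by (simp_all add: C_pf_def less_max_iff_disj le_max_iff_disj)
  have part': "Z N \<beta> \<le> ennreal ?Cp"
    by (rule order_trans[OF part[OF N]]) (simp add: C_pf_def ennreal_leI)
  then have fin: "Z N \<beta> < \<infinity>" by (simp add: le_less_trans)
  let ?goal = "(?E \<noteq> \<infinity> \<longrightarrow> integrable f ?A) \<and> ereal \<bar>\<integral>X. real N * ?A X \<partial>f\<bar>
      \<le> ereal (\<beta> / \<epsilon>) * ereal (real N) * ?E + ereal (1 / \<epsilon> * (ln ?Cp + ln C))"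
  have goal_inf: ?goal if "?E = \<infinity>"
    using that \<beta> \<epsilon> r by simp
  show ?goal
  proof (cases "absolutely_continuous ?T f \<and> integrable f (entropy_density (exp 1) ?T f)")
    case False
    then have "rel_entropy f ?T = \<infinity>" by (simp add: rel_entropy_def)
    then have "?E = \<infinity>" using \<beta> r by (simp add: mod_free_energy_def)
    then show ?thesis by (rule goal_inf)
  next
    case True
    define H where "H = KL_divergence (exp 1) ?T f"
    have H: "rel_entropy f ?T = ereal H" using True by (simp add: rel_entropy_def H_def)
    note dv = donsker_varadhan[OF prob_space_tensor f.prob_space_axioms sets conjunct1[OF True] conjunct2[OF True]]
    have part_exp: "exp_moment ?T (\<lambda>X. - \<beta> * (real N * ?F X)) \<le> ennreal ?Cp"
      using part' by (simp add: mod_partition_def mult.assoc)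
    have negF: "(\<integral>\<^sup>+X. ennreal (- ?F X) \<partial>f) < \<infinity>"
    proof -
      have "(\<integral>\<^sup>+X. ennreal (- \<beta> * (real N * ?F X)) \<partial>f) < \<infinity>"
        by (rule dv(1)[OF _ part_exp Cp(1)]) measurable
      moreover have "ennreal (- \<beta> * (real N * ?F X)) = ennreal (\<beta> * real N) * ennreal (- ?F X)" for X
        using \<beta> r by (subst ennreal_mult'[symmetric]) (auto simp: mult.assoc)
      ultimately have "ennreal (\<beta> * real N) * (\<integral>\<^sup>+X. ennreal (- ?F X) \<partial>f) < \<infinity>"
        by (simp add: nn_integral_cmult)
      then show ?thesis using \<beta> r by (auto simp: ennreal_mult_less_top)
    qed
    show ?thesis
    proof (cases "(\<integral>\<^sup>+X. ennreal (?F X) \<partial>f) = \<infinity>")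
      case True
      \<comment> \<open>The finite negative part excludes \<infinity> - \<infinity>.\<close>
      then have "ext_expectation f ?F = \<infinity>"
        using negF by (cases "\<integral>\<^sup>+X. ennreal (- ?F X) \<partial>f") (auto simp: ext_expectation_def)
      then have "?E = \<infinity>" by (simp add: mod_free_energy_def H)
      then show ?thesis by (rule goal_inf)
    next
      case False
      have Fint: "integrable f ?F"
        unfolding real_integrable_def using False negF by auto
      have ext: "ext_expectation f ?F = ereal (\<integral>X. ?F X \<partial>f)"
      proof -
        obtain a where a: "(\<integral>\<^sup>+X. ennreal (?F X) \<partial>f) = ennreal a" "a \<ge> 0" using False by (cases "\<integral>\<^sup>+X. ennreal (?F X) \<partial>f") auto
        obtain b where b: "(\<integral>\<^sup>+X. ennreal (- ?F X) \<partial>f) = ennreal b" "b \<ge> 0" using negF by (cases "\<integral>\<^sup>+X. ennreal (- ?F X) \<partial>f") auto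
        have "(\<integral>X. ?F X \<partial>f) = a - b" using real_lebesgue_integral_def[OF Fint] a b by simp
        then show ?thesis using a b by (simp add: ext_expectation_def)
      qed
      have E: "?E = ereal (H / (\<beta> * real N) + (\<integral>X. ?F X \<partial>f))"
        by (simp add: mod_free_energy_def H ext)
      let ?Y = "\<lambda>\<sigma> X. - \<beta> * (real N * ?F X) + \<sigma> * \<epsilon> * (real N * ?A X)"
      have Yexp: "exp_moment ?T (\<lambda>X. ?Y \<sigma> X) \<le> ennreal (?Cp * C)" if \<sigma>: "\<sigma> \<in> {1, -1}" for \<sigma>
      proof -
        have "gibbs_moment N \<beta> (\<sigma> * \<epsilon>)
          \<le> (SUP N\<in>{1..}. gibbs_moment N \<beta> (\<sigma> * \<epsilon>))"
          using N by (intro SUP_upper) auto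
        also have "\<dots> \<le> ennreal C" using em \<sigma> unfolding exp_moment_bound_def by blast
        finally have "Z N \<beta> * gibbs_moment N \<beta> (\<sigma> * \<epsilon>) \<le> ennreal ?Cp * ennreal C"
          using part' by (intro mult_mono) auto
        then show ?thesis using Cp C unfolding gibbs_exp_moment[OF N fin, of "\<sigma> * \<epsilon>"] by (simp add: ennreal_mult)
      qed
      have Ypos: "(\<integral>\<^sup>+X. ennreal (?Y \<sigma> X) \<partial>f) < \<infinity>" if \<sigma>: "\<sigma> \<in> {1, -1}" for \<sigma>
        by (rule dv(1)[OF _ Yexp[OF \<sigma>]], measurable) (use Cp C in simp)
      have absF: "(\<integral>\<^sup>+X. ennreal (\<beta> * real N * \<bar>?F X\<bar>) \<partial>f) < \<infinity>"
        using integrable_mult_right[OF integrable_abs[OF Fint], of "\<beta> * real N"] \<beta> r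
        unfolding integrable_iff_bounded by (simp add: abs_mult)
      have Apos: "(\<integral>\<^sup>+X. ennreal (\<sigma> * ?A X) \<partial>f) < \<infinity>" if \<sigma>: "\<sigma> \<in> {1, -1}" for \<sigma>
      proof -
        have "ennreal (\<epsilon> * real N) * (\<integral>\<^sup>+X. ennreal (\<sigma> * ?A X) \<partial>f) = (\<integral>\<^sup>+X. ennreal (\<epsilon> * real N * (\<sigma> * ?A X)) \<partial>f)"
          using \<epsilon> r by (simp add: ennreal_mult' nn_integral_cmult)
        also have "\<dots> \<le> (\<integral>\<^sup>+X. ennreal (?Y \<sigma> X) + ennreal (\<beta> * real N * \<bar>?F X\<bar>) \<partial>f)"
        proof (rule nn_integral_mono)
          fix X
          have "\<beta> * real N * ?F X \<le> \<beta> * real N * \<bar>?F X\<bar>" using \<beta> r by (intro mult_left_mono) auto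
          then have "\<epsilon> * real N * (\<sigma> * ?A X) \<le> ?Y \<sigma> X + \<beta> * real N * \<bar>?F X\<bar>" by (simp add: mult_ac)
          then have "ennreal (\<epsilon> * real N * (\<sigma> * ?A X)) \<le> ennreal (?Y \<sigma> X + \<beta> * real N * \<bar>?F X\<bar>)" by (rule ennreal_leI)
          also have "\<dots> \<le> ennreal (?Y \<sigma> X) + ennreal (\<beta> * real N * \<bar>?F X\<bar>)" by (rule ennreal_add_le)
          finally show "ennreal (\<epsilon> * real N * (\<sigma> * ?A X)) \<le> ennreal (?Y \<sigma> X) + ennreal (\<beta> * real N * \<bar>?F X\<bar>)" .
        qed
        also have "\<dots> = (\<integral>\<^sup>+X. ennreal (?Y \<sigma> X) \<partial>f) + (\<integral>\<^sup>+X. ennreal (\<beta> * real N * \<bar>?F X\<bar>) \<partial>f)"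
          by (rule nn_integral_add) measurable
        also have "\<dots> < \<infinity>" using Ypos[OF \<sigma>] absF by (simp add: ennreal_add_less_top)
        finally show ?thesis using \<epsilon> r by (auto simp: ennreal_mult_less_top)
      qed
      have Aint: "integrable f ?A"
        unfolding real_integrable_def using Apos[of 1] Apos[of "-1"] by auto
      have main: "\<sigma> * \<epsilon> * (real N * (\<integral>X. ?A X \<partial>f)) \<le> \<beta> * real N * (\<integral>X. ?F X \<partial>f) + H + (ln ?Cp + ln C)" if \<sigma>: "\<sigma> \<in> {1, -1}" for \<sigma>
      proof -
        have Yint: "integrable f (?Y \<sigma>)" using Fint Aint by simp
        have "(\<integral>X. ?Y \<sigma> X \<partial>f) \<le> H + ln (?Cp * C)"
          unfolding H_def by (rule dv(2)[OF _ Yexp[OF \<sigma>] _ Yint], measurable) (use Cp C in simp)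
        moreover have "(\<integral>X. ?Y \<sigma> X \<partial>f) = - \<beta> * (real N * (\<integral>X. ?F X \<partial>f)) + \<sigma> * \<epsilon> * (real N * (\<integral>X. ?A X \<partial>f))"
          using Fint Aint by simp
        ultimately show ?thesis using Cp C by (simp add: ln_mult mult_ac)
      qed
      have "\<epsilon> * \<bar>real N * (\<integral>X. ?A X \<partial>f)\<bar> \<le> \<beta> * real N * (\<integral>X. ?F X \<partial>f) + H + (ln ?Cp + ln C)"
        using main[of 1] main[of "-1"] \<epsilon> by (cases "real N * (\<integral>X. ?A X \<partial>f) \<ge> 0") auto
      then have "\<bar>real N * (\<integral>X. ?A X \<partial>f)\<bar> \<le> (\<beta> * real N * (\<integral>X. ?F X \<partial>f) + H + (ln ?Cp + ln C)) / \<epsilon>"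
        using \<epsilon> by (simp add: pos_le_divide_eq mult.commute)
      also have "\<dots> = \<beta> / \<epsilon> * real N * (H / (\<beta> * real N) + (\<integral>X. ?F X \<partial>f)) + 1 / \<epsilon> * (ln ?Cp + ln C)"
        using \<beta> \<epsilon> r by (simp add: field_simps)
      finally show ?thesis using Aint unfolding E by simp
    qed
  qed
qed

section \<open>Exponential moments of the commutator under the Gibbs measure\<close>

lemma commutator_eq_0:
  assumes "G = 0" "N \<ge> 1"
  shows "commutator s n N v X \<mu> = 0"
proof -
  have 0: "G ^ n = 0" using assms n_ge_1 by (simp add: zero_power)
  have "k x y = 0" for x y using k_bound[of x y] unfolding 0 by simp
  then have "ksym = (\<lambda>x y. 0)" by (simp add: ksym_def fun_eq_iff)
  then have "NA N X = 0" using N_commutator[OF assms(2), of X] by (simp add: ustat_def)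
  then show ?thesis using assms by simp
qed

text \<open>The commutator vanishes, so the moment is the total mass of the normalised Gibbs
  measure.\<close>

lemma exp_moment_bound_const:
  assumes "G = 0" and fin: "\<And>N. N \<ge> 1 \<Longrightarrow> Z N \<beta> < \<infinity>"
  shows "exp_moment_bound s n \<mu> v \<beta> \<epsilon> 1"
  unfolding exp_moment_bound_def
proof (intro ballI SUP_least)
  fix \<sigma> :: real and N :: nat assume N: "N \<in> {1..}"
  then have N: "N \<ge> 1" by simp
  let ?Z = "Z N \<beta>"
  have Z0: "?Z \<noteq> 0" using partition_ge[OF N, of \<beta>] by (metis ennreal_eq_0_iff exp_gt_zero le_zero_eq not_less)
  have "?Z = ?Z * gibbs_moment N \<beta> (\<sigma> * \<epsilon>)"
    using gibbs_exp_moment[OF N fin[OF N], of "\<sigma> * \<epsilon>"]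
    by (simp add: commutator_eq_0[OF assms(1) N] mod_partition_def mult.assoc)
  moreover have "?Z * q / ?Z = q" for q
    using Z0 fin[OF N] ennreal_mult_divide_eq[of ?Z q] by (simp add: mult.commute less_top)
  moreover have "?Z / ?Z = 1" using Z0 fin[OF N] by (intro ennreal_divide_self) simp_all
  ultimately have "gibbs_moment N \<beta> (\<sigma> * \<epsilon>) = 1"
    by metis
  then show "gibbs_moment N \<beta> (\<sigma> * \<epsilon>) \<le> ennreal 1" by simp
qed

text \<open>
  For \<open>s > 0\<close> the repulsive kernel absorbs the commutator kernel, so that their combination is bounded
  above. For \<open>s = 0\<close> the commutator kernel is bounded and the energy is controlled by the partition function.
\<close>

lemma exp_moment_local:
  assumes G: "G > 0" and C_sr: "C_sr \<ge> C0 * s" "C_sr > 0" and \<sigma>: "\<bar>\<sigma>\<bar> = 1"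
    and part: "\<And>\<beta> N. \<beta> \<ge> 0 \<Longrightarrow> N \<ge> 1 \<Longrightarrow> Z N \<beta> \<le> ennreal (C_ub \<beta>)"
  shows "\<exists>b>0. \<exists>C. \<forall>N\<ge>1. exp_moment (T N) (\<lambda>X. b * (- NF N X
    + \<sigma> / (4 * C_sr * G ^ n) * NA N X)) \<le> ennreal C"
proof -
  define c where "c = \<sigma> / (4 * C_sr * G ^ n)"
  have GC: "4 * C_sr * G ^ n > 0" using G C_sr by simp
  \<comment> \<open>The powers of G cancel, which is the reason for dividing by G^n in \<epsilon>;
    the resulting bound on the kernel is free of v.\<close>
  have cabs: "\<bar>c\<bar> * (C0 * G ^ n) = C0 / (4 * C_sr)"
    using G C_sr \<sigma> by (simp add: c_def abs_mult field_simps)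
  have ck: "\<bar>c * ksym x y\<bar> \<le> C0 / (4 * C_sr) * norm (x - y) powr (- s)" for x y
  proof -
    have "\<bar>c * ksym x y\<bar> \<le> \<bar>c\<bar> * (C0 * G ^ n * norm (x - y) powr (- s))"
      unfolding abs_mult by (intro mult_left_mono ksym_bound) auto
    also have "\<dots> = \<bar>c\<bar> * (C0 * G ^ n) * norm (x - y) powr (- s)" by (simp only: mult.assoc)
    finally show ?thesis unfolding cabs .
  qed
  have ksym_sym: "ksym x y = ksym y x" for x y by (simp add: ksym_def add.commute)
  have riesz_sym: "riesz s (x - y) = riesz s (y - x)" for x y :: 'a by (simp add: riesz_def norm_minus_commute)
  \<comment> \<open>Second moments of the kernels involve the exponent 2s, and 2s < d is the
    assumption on s.\<close>
  obtain D where D: "D \<ge> 0" "\<And>x. (\<integral>\<^sup>+y. ennreal (norm (x - y) powr (- (2 * s))) \<partial>\<mu>) \<le> ennreal D"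
    using powr_integral_bound[of "2 * s"] s_nonneg s_less by auto
  have sq: "integrable \<mu> (\<lambda>y. (q x y)\<^sup>2) \<and> (\<integral>y. (q x y)\<^sup>2 \<partial>\<mu>) \<le> K\<^sup>2 * D"
    if [measurable]: "case_prod q \<in> borel_measurable (\<mu> \<Otimes>\<^sub>M \<mu>)"
      and le: "\<And>x y. \<bar>q x y\<bar> \<le> K * norm (x - y) powr (- s)" for q K x
  proof -
    have sqle: "(q x y)\<^sup>2 \<le> K\<^sup>2 * norm (x - y) powr (- (2 * s))" for y
    proof -
      have "(q x y)\<^sup>2 = \<bar>q x y\<bar>\<^sup>2" by simp
      also have "\<dots> \<le> (K * norm (x - y) powr (- s))\<^sup>2" using le[of x y] by (rule power_mono) simp
      also have "\<dots> = K\<^sup>2 * norm (x - y) powr (- (2 * s))"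
        by (simp add: power_mult_distrib power2_eq_square flip: powr_add)
      finally show ?thesis .
    qed
    have i: "integrable \<mu> (\<lambda>y. norm (x - y) powr (- (2 * s)))"
      using D(2)[of x] by (intro integrableI_bounded) (auto simp: le_less_trans)
    have iD: "(\<integral>y. norm (x - y) powr (- (2 * s)) \<partial>\<mu>) \<le> D"
      using D nn_integral_eq_integral[OF i] D(2)[of x] by simp
    have "q x \<in> borel_measurable \<mu>" by measurable
    then have i2: "integrable \<mu> (\<lambda>y. (q x y)\<^sup>2)"
      by (intro Bochner_Integration.integrable_bound[OF integrable_mult_right[OF i, of "K\<^sup>2"]]) (use sqle in auto)
    have "(\<integral>y. (q x y)\<^sup>2 \<partial>\<mu>) \<le> (\<integral>y. K\<^sup>2 * norm (x - y) powr (- (2 * s)) \<partial>\<mu>)"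
      by (intro integral_mono i2 integrable_mult_right i sqle)
    also have "\<dots> \<le> K\<^sup>2 * D" using iD by (simp add: mult_left_mono)
    finally show ?thesis using i2 by simp
  qed
  show ?thesis
  proof (cases "s = 0")
    case False
    then have s: "s > 0" using s_nonneg by simp
    define q where "q x y = - (1 / 2 * riesz s (x - y)) + c * ksym x y" for x y
    have qm[measurable]: "case_prod q \<in> borel_measurable (\<mu> \<Otimes>\<^sub>M \<mu>)" unfolding q_def by measurable
    have rz: "riesz s z = norm z powr (- s) / s" for z :: 'a using False by (simp add: riesz_def)
    have qle: "q x y \<le> 0" for x y
    proof -
      let ?p = "norm (x - y) powr (- s)"
      \<comment> \<open>By C0 s \<le> C_sr the left side is at most 1/(4s), half of the coefficient
        1/(2s) that the repulsion -g/2 provides.\<close>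
      have "C0 / (4 * C_sr) \<le> 1 / (2 * s)" using C_sr s C0_pos by (simp add: field_simps)
      then have "C0 / (4 * C_sr) * ?p \<le> 1 / (2 * s) * ?p" by (intro mult_right_mono) auto
      moreover have "c * ksym x y \<le> C0 / (4 * C_sr) * ?p" using ck[of x y] by (rule abs_le_D1)
      ultimately show ?thesis by (simp add: q_def rz)
    qed
    define K where "K = 1 / (2 * s) + C0 / (4 * C_sr)"
    have qabs: "\<bar>q x y\<bar> \<le> K * norm (x - y) powr (- s)" for x y
    proof -
      have "\<bar>q x y\<bar> \<le> \<bar>- (1 / 2 * riesz s (x - y))\<bar> + \<bar>c * ksym x y\<bar>" unfolding q_def by (rule abs_triangle_ineq)
      also have "\<bar>- (1 / 2 * riesz s (x - y))\<bar> = 1 / (2 * s) * norm (x - y) powr (- s)" using s by (simp add: rz)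
      finally show ?thesis using ck[of x y] by (simp add: K_def distrib_right)
    qed
    have "\<exists>b>0. \<exists>C. \<forall>N\<ge>1. exp_moment (T N) (\<lambda>X. b * ustat N \<mu> q X) \<le> ennreal C"
    proof (rule ustat_exp_moment[OF prob_space_axioms qm _ qle])
      show "q x y = q y x" for x y by (simp add: q_def ksym_sym[of x y] riesz_sym[of x y])
    qed (use sq[OF qm qabs] in auto)
    moreover have "ustat N \<mu> q X = - NF N X + c * NA N X" if "N \<ge> 1" for N X
    proof -
      let ?g = "\<lambda>x y. 1 / 2 * riesz s (x - y)"
      have g1: "integrable \<mu> (\<lambda>y. -1 * ?g x y)" for x
        unfolding rz using powr_integrable[of x] by (intro integrable_mult_right integrable_divide)
      have "integrable (\<mu> \<Otimes>\<^sub>M \<mu>) (\<lambda>p. -1 * (1 / 2 * (case p of (x, y) \<Rightarrow> riesz s (x - y))))"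
        using riesz_integrable by (intro integrable_mult_right)
      then have g2: "integrable (\<mu> \<Otimes>\<^sub>M \<mu>) (\<lambda>(x, y). -1 * ?g x y)" by (simp only: split_beta')
      have "integrable (\<mu> \<Otimes>\<^sub>M \<mu>) (\<lambda>p. c * (case p of (x, y) \<Rightarrow> ksym x y))"
        using ksym_integrable(2) by (rule integrable_mult_right)
      then have k2: "integrable (\<mu> \<Otimes>\<^sub>M \<mu>) (\<lambda>(x, y). c * ksym x y)" by (simp only: split_beta')
      have "q = (\<lambda>x y. -1 * ?g x y + c * ksym x y)" by (simp add: q_def fun_eq_iff)
      then have "ustat N \<mu> q X = ustat N \<mu> (\<lambda>x y. -1 * ?g x y) X + ustat N \<mu> (\<lambda>x y. c * ksym x y) X"
        using ustat_add[OF prob_space_axioms g1 integrable_mult_right[OF ksym_integrable(1)] g2 k2] by simp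
      also have "\<dots> = - (1 / 2 * ustat N \<mu> (\<lambda>x y. riesz s (x - y)) X) + c * ustat N \<mu> ksym X"
        unfolding ustat_scale by simp
      finally show ?thesis
        unfolding N_mod_energy[OF that] N_commutator[OF that] ustat_scale .
    qed
    ultimately show ?thesis unfolding c_def by simp
  next
    case True
    define K where "K = C0 / (4 * C_sr)"
    have K0: "K \<ge> 0" using C0_pos C_sr by (simp add: K_def)
    define q where "q x y = c * ksym x y" for x y
    have qm[measurable]: "case_prod q \<in> borel_measurable (\<mu> \<Otimes>\<^sub>M \<mu>)" unfolding q_def by measurable
    have qabs: "\<bar>q x y\<bar> \<le> K * norm (x - y) powr (- s)" for x y unfolding q_def K_def by (rule ck)
    have qle: "q x y \<le> K" for x y
    proof -
      have "K * norm (x - y) powr (- s) \<le> K * 1" using True K0 by (intro mult_left_mono) auto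
      then show ?thesis using qabs[of x y] by simp
    qed
    have "\<exists>b>0. \<exists>C. \<forall>N\<ge>1. exp_moment (T N) (\<lambda>X. b * ustat N \<mu> q X) \<le> ennreal C"
    proof (rule ustat_exp_moment[OF prob_space_axioms qm _ qle])
      show "q x y = q y x" for x y by (simp add: q_def ksym_sym[of x y])
    qed (use sq[OF qm qabs] in auto)
    then obtain b C where b: "b > 0" and C: "\<And>N. N \<ge> 1 \<Longrightarrow> exp_moment (T N) (\<lambda>X. b * ustat N \<mu> q X) \<le> ennreal C" by blast
    define A where "A = max 1 (C_ub b)"
    define B where "B = max 1 C"
    show ?thesis
    \<comment> \<open>Energy and commutator are each controlled at inverse temperature
      \<open>b\<close>; Cauchy-Schwarz controls their sum at \<open>b / 2\<close>.\<close>
    proof (rule exI[of _ "b / 2"], intro conjI exI[of _ "sqrt A * sqrt B"] allI impI)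
      fix N :: nat assume N: "N \<ge> 1"
      note [measurable] = energy_measurable[OF N] commutator_measurable[OF N]
      have "exp_moment (T N) (\<lambda>X. (- b * NF N X + b * (c * NA N X)) / 2) \<le> ennreal (sqrt A * sqrt B)"
      proof (rule nn_integral_exp_Cauchy_Schwarz)
        show "exp_moment (T N) (\<lambda>X. - b * NF N X) \<le> ennreal A"
          using order_trans[OF part[of b N], of "ennreal A"] b N by (simp add: mod_partition_def mult.assoc A_def ennreal_leI)
        have "ustat N \<mu> q X = c * NA N X" for X
          unfolding q_def[abs_def] ustat_scale N_commutator[OF N] ..
        then show "exp_moment (T N) (\<lambda>X. b * (c * NA N X)) \<le> ennreal B"
          using order_trans[OF C[OF N], of "ennreal B"] by (simp add: B_def ennreal_leI)
        show "A > 0" "B > 0" by (simp_all add: A_def B_def less_max_iff_disj)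
      qed measurable
      moreover have "(- b * NF N X + b * (c * NA N X)) / 2
        = b / 2 * (- NF N X + c * NA N X)" for X
        by (simp add: algebra_simps add_divide_distrib diff_divide_distrib)
      ultimately show "exp_moment (T N) (\<lambda>X. b / 2 * (- NF N X
        + \<sigma> / (4 * C_sr * G ^ n) * NA N X)) \<le> ennreal (sqrt A * sqrt B)"
        by (simp only: c_def)
    qed (use b in simp)
  qed
qed

text \<open>Free of C_ub and L, so that a threshold with this property can be fixed before they are
  quantified. The bound e leaves all dependence on \<mu> and v to \<open>b\<close>.\<close>

definition subcritical :: "real \<Rightarrow> real \<Rightarrow> bool" where
  "subcritical C b \<longleftrightarrow> (\<forall>\<sigma>\<in>{1, -1}. \<forall>\<beta>. 0 < \<beta> \<longrightarrow> \<beta> \<le> b \<longrightarrow> (\<forall>N\<ge>1.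
    exp_moment (T N) (\<lambda>X. \<beta> * (- NF N X + \<sigma> / (4 * C * G ^ n) * NA N X)) \<le> ennreal (exp 1)))"

text \<open>Each sign has its own threshold, below which the local estimate improves to the bound e;
  the smaller of the two serves both signs.\<close>

lemma exp_moment_threshold:
  assumes G: "G > 0" and C_sr: "C_sr \<ge> C0 * s" "C_sr > 0"
    and part: "\<And>\<beta> N. \<beta> \<ge> 0 \<Longrightarrow> N \<ge> 1 \<Longrightarrow> Z N \<beta> \<le> ennreal (C_ub \<beta>)"
  shows "\<exists>\<beta>_loc>0. subcritical C_sr \<beta>_loc"
proof -
  let ?Y = "\<lambda>\<sigma> N X. - NF N X + \<sigma> / (4 * C_sr * G ^ n) * NA N X"
  have *: "\<exists>b'>0. \<forall>\<beta>. 0 < \<beta> \<longrightarrow> \<beta> \<le> b' \<longrightarrow> (\<forall>N\<ge>1. exp_moment (T N) (\<lambda>X. \<beta> * ?Y \<sigma> N X) \<le> ennreal (exp 1))"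
    if \<sigma>: "\<bar>\<sigma>\<bar> = 1" for \<sigma>
  proof -
    obtain b C where b: "b > 0" and C: "\<And>N. N \<ge> 1 \<Longrightarrow> exp_moment (T N) (\<lambda>X. b * ?Y \<sigma> N X) \<le> ennreal C"
      using exp_moment_local[OF G C_sr \<sigma> part] by blast
    show ?thesis
    proof (rule exp_moment_small_temperature[OF prob_space_tensor _ b C])
      fix N :: nat assume N: "1 \<le> N"
      note [measurable] = energy_measurable[OF N] commutator_measurable[OF N]
      show "?Y \<sigma> N \<in> borel_measurable (T N)" by measurable
    qed
  qed
  obtain b1 where b1: "b1 > 0" "\<And>\<beta> N. 0 < \<beta> \<Longrightarrow> \<beta> \<le> b1 \<Longrightarrow> N \<ge> 1 \<Longrightarrow> exp_moment (T N) (\<lambda>X. \<beta> * ?Y 1 N X) \<le> ennreal (exp 1)"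
    using *[of 1] by auto
  obtain b2 where b2: "b2 > 0" "\<And>\<beta> N. 0 < \<beta> \<Longrightarrow> \<beta> \<le> b2 \<Longrightarrow> N \<ge> 1 \<Longrightarrow> exp_moment (T N) (\<lambda>X. \<beta> * ?Y (-1) N X) \<le> ennreal (exp 1)"
    using *[of "-1"] by auto
  show ?thesis
    unfolding subcritical_def
  proof (intro exI[of _ "min b1 b2"] conjI ballI allI impI)
    fix \<sigma> \<beta> :: real and N :: nat
    assume "\<sigma> \<in> {1, -1}" and h: "0 < \<beta>" "\<beta> \<le> min b1 b2" "1 \<le> N"
    then consider "\<sigma> = 1" | "\<sigma> = -1" by blast
    then show "exp_moment (T N) (\<lambda>X. \<beta> * ?Y \<sigma> N X) \<le> ennreal (exp 1)"
      by cases (use b1(2)[of \<beta> N] b2(2)[of \<beta> N] h in simp_all)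
  qed (use b1(1) b2(1) in simp)
qed

text \<open>Up to the threshold the exponent is exactly \<beta> times the subcritical statistic.
  Beyond it, -\<beta> N F_N + \<sigma> \<epsilon> N A_n is the average of -(2\<beta> - \<beta>_loc)
  N F_N and \<beta>_loc times that statistic. Averaging turns the 4 into the 8 of
  \<open>eps_em\<close>, and Cauchy-Schwarz produces the square roots and the argument of
  \<open>C_ub\<close> in \<open>C_em\<close>.\<close>

lemma exp_moment_bound_em:
  assumes G: "G > 0" and C_sr: "C_sr > 0" and loc: "\<beta>_loc > 0" and L: "L \<ge> 1" and \<beta>: "\<beta> > 0"
    and part: "\<And>\<beta> N. \<beta> \<ge> 0 \<Longrightarrow> N \<ge> 1 \<Longrightarrow> Z N \<beta> \<le> ennreal (C_ub \<beta>)"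
    and sub: "subcritical C_sr \<beta>_loc"
  shows "C_em s L \<beta>_loc C_ub \<mu> \<beta> > 0"
    and "exp_moment_bound s n \<mu> v \<beta> (eps_em C_sr \<beta>_loc n v \<beta>) (C_em s L \<beta>_loc C_ub \<mu> \<beta>)"
proof -
  have thr: "exp_moment (T N) (\<lambda>X. \<beta> * (- NF N X + \<sigma> / (4 * C_sr * G ^ n) * NA N X)) \<le> ennreal (exp 1)"
    if "\<sigma> \<in> {1, -1}" "0 < \<beta>" "\<beta> \<le> \<beta>_loc" "N \<ge> 1" for \<sigma> \<beta> N
    using sub that unfolding subcritical_def by blast
  let ?\<epsilon> = "eps_em C_sr \<beta>_loc n v \<beta>" and ?C = "C_em s L \<beta>_loc C_ub \<mu> \<beta>"
  have fin: "Z N \<beta>' < \<infinity>" if "\<beta>' \<ge> 0" "N \<ge> 1" for \<beta>' N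
    using part[OF that] by (simp add: le_less_trans)
  \<comment> \<open>The lower bound of the partition function at N = 1 forces the upper constant to
    be positive, as Cauchy-Schwarz and the logarithm of \<open>C_em\<close> require.\<close>
  have Cub: "C_ub \<beta>' > 0" if "\<beta>' \<ge> 0" for \<beta>'
  proof -
    have "ennreal (exp (\<beta>' * I)) \<le> ennreal (C_ub \<beta>')"
      using partition_ge[of 1 \<beta>'] part[OF that, of 1] by (simp add: order_trans)
    then show ?thesis by (metis ennreal_eq_0_iff exp_gt_zero le_zero_eq not_less)
  qed
  have eL: "exp 1 + L > 0" "exp 1 \<le> exp 1 + L" using L by (auto simp: add_pos_pos)
  show "?C > 0" using eL Cub[of "2 * \<beta> - \<beta>_loc"] \<beta> by (auto simp: C_em_def)
  have "gibbs_moment N \<beta> (\<sigma> * ?\<epsilon>) \<le> ennreal ?C"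
    if \<sigma>: "\<sigma> \<in> {1, -1}" and N: "N \<ge> 1" for \<sigma> N
  proof -
    let ?F = "\<lambda>X. NF N X" and ?A = "\<lambda>X. NA N X" and ?T = "T N"
    let ?Y = "\<lambda>X. - ?F X + \<sigma> / (4 * C_sr * G ^ n) * ?A X"
    note [measurable] = energy_measurable[OF N] commutator_measurable[OF N]
    note le = gibbs_exp_moment_le[OF N fin[OF less_imp_le[OF \<beta>] N], of _ "\<sigma> * ?\<epsilon>"]
    show ?thesis
    proof (cases "\<beta> \<le> \<beta>_loc")
      case True
      have eq: "- \<beta> * ?F X + \<sigma> * ?\<epsilon> * ?A X = \<beta> * ?Y X" for X
        using True by (simp add: eps_em_def algebra_simps)
      have "exp_moment ?T (\<lambda>X. - \<beta> * ?F X + \<sigma> * ?\<epsilon> * ?A X) \<le> ennreal (exp 1 + L)"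
        unfolding eq using thr[OF \<sigma> \<beta> True N] ennreal_leI[OF eL(2)] by (rule order_trans)
      from le[OF _ this] eL have 1: "gibbs_moment N \<beta> (\<sigma> * ?\<epsilon>)
        \<le> ennreal (exp (- \<beta> * I) * (exp 1 + L))" by simp
      have "exp (- \<beta> * I) * (exp 1 + L) \<le> ?C"
      proof (cases "s > 0")
        case s: True
        \<comment> \<open>For s > 0 the energy is nonnegative, so the factor exp (-\<beta> I_\<mu>)
          is dropped, as in the first case of \<open>C_em\<close>.\<close>
        have "exp (- \<beta> * I) \<le> 1" using self_energy_nonneg[OF s] \<beta> by simp
        then have "exp (- \<beta> * I) * (exp 1 + L) \<le> 1 * (exp 1 + L)" using eL by (intro mult_right_mono) auto
        then show ?thesis using s True by (simp add: C_em_def)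
      qed (use True in \<open>simp add: C_em_def\<close>)
      with 1 show ?thesis by (meson ennreal_leI order_trans)
    next
      case False
      let ?b = "2 * \<beta> - \<beta>_loc"
      have b0: "?b \<ge> 0" using False \<beta> by simp
      have eq: "- \<beta> * ?F X + \<sigma> * ?\<epsilon> * ?A X = (- ?b * ?F X + \<beta>_loc * ?Y X) / 2" for X
        using False G C_sr by (simp add: eps_em_def field_simps)
      have "exp_moment ?T (\<lambda>X. - \<beta> * ?F X + \<sigma> * ?\<epsilon> * ?A X) \<le> ennreal (sqrt (C_ub ?b) * sqrt (exp 1 + L))"
        unfolding eq
      proof (rule nn_integral_exp_Cauchy_Schwarz)
        show "exp_moment ?T (\<lambda>X. - ?b * ?F X) \<le> ennreal (C_ub ?b)"
          using part[OF b0 N] unfolding mod_partition_def mult.assoc .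
        show "exp_moment ?T (\<lambda>X. \<beta>_loc * ?Y X) \<le> ennreal (exp 1 + L)"
          using thr[OF \<sigma> loc order_refl N] ennreal_leI[OF eL(2)] by (rule order_trans)
      qed (use Cub[OF b0] eL in \<open>auto intro!: borel_measurable_times borel_measurable_add borel_measurable_uminus\<close>)
      from le[OF _ this] Cub[OF b0] eL show ?thesis using False by (simp add: C_em_def mult_ac)
    qed
  qed
  then show "exp_moment_bound s n \<mu> v \<beta> ?\<epsilon> ?C"
    unfolding exp_moment_bound_def by (intro ballI SUP_least) auto
qed

end

theorem theorem2p8:
  fixes n :: nat and s :: real
  assumes "n \<ge> 1"
    and "0 \<le> s" and "s < real DIM('a::euclidean_space) / 2"
  shows "\<exists>C_sr>0. \<forall>(\<mu> :: 'a measure) (v :: 'a \<Rightarrow> 'a).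
    bounded_density_prob \<mu> \<longrightarrow>
    (\<exists>\<Lambda>. \<Lambda>-lipschitz_on UNIV v) \<longrightarrow>
    (s = 0 \<longrightarrow> (\<integral>\<^sup>+ (x, y). ennreal \<bar>ln (norm (x - y))\<bar> \<partial>(\<mu> \<Otimes>\<^sub>M \<mu>)) < \<infinity>) \<longrightarrow>
    (\<exists>\<beta>_loc>0. \<forall>L\<ge>1. \<forall>C_ub :: real \<Rightarrow> real.
      (\<forall>\<beta>\<ge>0. (SUP N\<in>{1..}. mod_partition s N \<beta> \<mu>) \<le> ennreal (C_ub \<beta>)) \<longrightarrow>
      (\<forall>\<beta>>0.
        (grad_sup v = 0 \<longrightarrow> (\<forall>\<epsilon>>0.
           exp_moment_bound s n \<mu> v \<beta> \<epsilon> 1 \<and>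
           commutator_bound s n \<mu> v \<beta> (\<beta> / \<epsilon>) (1 / \<epsilon> * (ln (C_pf C_ub \<beta>) + ln 1)))) \<and>
        (grad_sup v > 0 \<longrightarrow>
           (let \<epsilon> = eps_em C_sr \<beta>_loc n v \<beta>; C = C_em s L \<beta>_loc C_ub \<mu> \<beta> in
             \<epsilon> > 0 \<and>
             exp_moment_bound s n \<mu> v \<beta> \<epsilon> C \<and>
             commutator_bound s n \<mu> v \<beta> (\<beta> / \<epsilon>) (1 / \<epsilon> * (ln (C_pf C_ub \<beta>) + ln C))))))"
proof -
  obtain C0 where C0: "C0 > 0"
    "\<And>z w :: 'a. z \<noteq> 0 \<Longrightarrow> \<bar>grad_contract n (riesz s) z w\<bar> \<le> C0 * norm z powr (- s - n) * norm w ^ n"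
    using grad_contract_riesz(1)[OF assms(1), of s] by blast
  \<comment> \<open>\<open>C0 * s\<close> is what the absorption by -g/2 asks for; adding 1 keeps
    the constant positive at s = 0.\<close>
  define C_sr where "C_sr = C0 * s + 1"
  have C_sr: "C_sr \<ge> C0 * s" "C_sr > 0" using C0(1) assms(2) by (auto simp: C_sr_def add_nonneg_pos)
  show ?thesis
  proof (rule exI[of _ C_sr], intro conjI C_sr(2) allI impI, elim exE, goal_cases)
    case (1 \<mu> v \<Lambda>)
    then interpret riesz_gas s n \<mu> v C0 \<Lambda>
      using assms C0 by unfold_locales auto
    let ?part = "\<lambda>C_ub :: real \<Rightarrow> real. \<forall>\<beta>\<ge>0. (SUP N\<in>{1..}. Z N \<beta>) \<le> ennreal (C_ub \<beta>)"
    have part: "Z N \<beta> \<le> ennreal (C_ub \<beta>)" if "?part C_ub" "\<beta> \<ge> 0" "N \<ge> 1" for C_ub \<beta> N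
    proof -
      have "Z N \<beta> \<le> (SUP N\<in>{1..}. Z N \<beta>)" using that by (intro SUP_upper) auto
      also have "\<dots> \<le> ennreal (C_ub \<beta>)" using that by blast
      finally show ?thesis .
    qed
    \<comment> \<open>The threshold may use that some \<open>C_ub\<close> exists, but not a particular one: it is chosen first.\<close>
    have "\<exists>\<beta>_loc>0. (\<exists>C_ub. ?part C_ub) \<longrightarrow> G > 0 \<longrightarrow> subcritical C_sr \<beta>_loc"
    proof (cases "(\<exists>C_ub. ?part C_ub) \<and> G > 0")
      case True
      then obtain C_ub where "?part C_ub" by blast
      from exp_moment_threshold[OF _ C_sr part[OF this]] True show ?thesis by blast
    next
      \<comment> \<open>Nothing is demanded of the threshold in this case, and 1 is an arbitrary
        positive value.\<close>
      case False
      then show ?thesis by (intro exI[of _ 1]) auto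
    qed
    then obtain \<beta>_loc where loc: "\<beta>_loc > 0"
      and sub: "(\<exists>C_ub. ?part C_ub) \<Longrightarrow> G > 0 \<Longrightarrow> subcritical C_sr \<beta>_loc" by blast
    show ?case
    proof (rule exI[of _ \<beta>_loc], intro conjI loc allI impI)
      fix L :: real and C_ub :: "real \<Rightarrow> real" and \<beta> :: real
      assume L: "1 \<le> L" and p: "?part C_ub" and \<beta>: "0 < \<beta>"
      note part = part[OF p]
      have fin: "Z N \<beta> < \<infinity>" if "N \<ge> 1" for N
        using part[OF less_imp_le[OF \<beta>] that] by (simp add: le_less_trans)
      note bound = commutator_bound_of_exp_moment[where C_ub = C_ub, OF \<beta> _ _ part[OF less_imp_le[OF \<beta>]]]
      {
        fix \<epsilon> :: real assume G: "G = 0" and \<epsilon>: "\<epsilon> > 0"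
        show em: "exp_moment_bound s n \<mu> v \<beta> \<epsilon> 1" by (rule exp_moment_bound_const[OF G fin])
        show "commutator_bound s n \<mu> v \<beta> (\<beta> / \<epsilon>) (1 / \<epsilon> * (ln (C_pf C_ub \<beta>) + ln 1))"
          by (rule bound[OF \<epsilon> zero_less_one _ em])
      next
        assume G: "G > 0"
        have "\<exists>C_ub. ?part C_ub" using p by blast
        note em = exp_moment_bound_em[OF G C_sr(2) loc L \<beta> part sub[OF this G]]
        have \<epsilon>: "eps_em C_sr \<beta>_loc n v \<beta> > 0" using G C_sr(2) loc \<beta> by (simp add: eps_em_def)
        show "let \<epsilon> = eps_em C_sr \<beta>_loc n v \<beta>; C = C_em s L \<beta>_loc C_ub \<mu> \<beta> in
             \<epsilon> > 0 \<and> exp_moment_bound s n \<mu> v \<beta> \<epsilon> C \<and>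
             commutator_bound s n \<mu> v \<beta> (\<beta> / \<epsilon>) (1 / \<epsilon> * (ln (C_pf C_ub \<beta>) + ln C))"
          unfolding Let_def using \<epsilon> em(2) bound[OF \<epsilon> em(1) _ em(2)] by blast
      }
    qed
  qed
qed

end
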